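(* Work in $\mathsf{ZF}$. Let $\alpha$ be an ordinal, let $j:V_\alpha\to V_\alpha$ be a non-identity fully elementary embedding, and let $a,b\in V_\alpha$. Then $j$ is not definable over $(V_\alpha,\in)$ from any parameter $p\in(j(a)\mid j(b))$.
   Context: Quine–Rosser pairs: let $s:V\to V$ be $s(n)=n+1$ for $n<\omega$ and $s(u)=u$ for $u\notin\omega$; let $f_0(X)=s``X$ and $f_1(X)=(s``X)\cup\{\emptyset\}$; set $\lceil x,y\rceil=f_0``x\cup f_1``y$. For sets $a,b$ and any $x$, let $(a)_x=\{y:\lceil x,y\rceil\in a\}$ and $(a\mid b)=\{(a)_x:x\in b\}$. $j$ is definable over $V_\alpha$ from $p$ iff there is a first-order formula $\varphi$ of set theory with $j(u)=w\iff V_\alpha\models\varphi(u,w,p)$ for all $u,w\in V_\alpha$. *)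

theory Defs
  imports Main
begin

datatype form =
    FMem nat nat
  | FEq nat nat
  | FNeg form
  | FConj form form
  | FEx nat form

fun sat :: "('v \<Rightarrow> 'v \<Rightarrow> bool) \<Rightarrow> ('v \<Rightarrow> bool) \<Rightarrow> form \<Rightarrow> (nat \<Rightarrow> 'v) \<Rightarrow> bool" where
  "sat m D (FMem i k) e = m (e i) (e k)"
| "sat m D (FEq i k) e = (e i = e k)"
| "sat m D (FNeg \<phi>) e = (\<not> sat m D \<phi> e)"
| "sat m D (FConj \<phi> \<psi>) e = (sat m D \<phi> e \<and> sat m D \<psi> e)"
| "sat m D (FEx i \<phi>) e = (\<exists>x. D x \<and> sat m D \<phi> (e(i := x)))"

definition zf_model :: "('v \<Rightarrow> 'v \<Rightarrow> bool) \<Rightarrow> bool" where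
  "zf_model m \<longleftrightarrow>
     \<comment> \<open>extensionality\<close>
     (\<forall>x y. (\<forall>z. m z x \<longleftrightarrow> m z y) \<longrightarrow> x = y) \<and>
     \<comment> \<open>foundation\<close>
     (\<forall>x. (\<exists>y. m y x) \<longrightarrow> (\<exists>y. m y x \<and> \<not> (\<exists>z. m z y \<and> m z x))) \<and>
     \<comment> \<open>pairing\<close>
     (\<forall>x y. \<exists>p. m x p \<and> m y p) \<and>
     \<comment> \<open>union\<close>
     (\<forall>x. \<exists>u. \<forall>y z. m z y \<and> m y x \<longrightarrow> m z u) \<and>
     \<comment> \<open>power set\<close>
     (\<forall>x. \<exists>p. \<forall>z. (\<forall>w. m w z \<longrightarrow> m w x) \<longrightarrow> m z p) \<and>
     \<comment> \<open>infinity\<close>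
     (\<exists>x. (\<exists>e. m e x \<and> (\<forall>z. \<not> m z e)) \<and>
          (\<forall>u. m u x \<longrightarrow> (\<exists>s. m s x \<and> (\<forall>z. m z s \<longleftrightarrow> m z u \<or> z = u)))) \<and>
     \<comment> \<open>separation schema (parameters via the assignment)\<close>
     (\<forall>\<phi> env x. \<exists>y. \<forall>z. m z y \<longleftrightarrow> m z x \<and> sat m (\<lambda>_. True) \<phi> (env(0 := z))) \<and>
     \<comment> \<open>replacement schema\<close>
     (\<forall>\<phi> env x. (\<forall>u. m u x \<longrightarrow> (\<exists>!w. sat m (\<lambda>_. True) \<phi> (env(0 := u, 1 := w)))) \<longrightarrow>
        (\<exists>y. \<forall>w. m w y \<longleftrightarrow> (\<exists>u. m u x \<and> sat m (\<lambda>_. True) \<phi> (env(0 := u, 1 := w)))))"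

definition setof :: "('v \<Rightarrow> 'v \<Rightarrow> bool) \<Rightarrow> ('v \<Rightarrow> bool) \<Rightarrow> 'v" where
  "setof m P = (THE y. \<forall>z. m z y \<longleftrightarrow> P z)"

definition msubset :: "('v \<Rightarrow> 'v \<Rightarrow> bool) \<Rightarrow> 'v \<Rightarrow> 'v \<Rightarrow> bool" where
  "msubset m x y \<longleftrightarrow> (\<forall>z. m z x \<longrightarrow> m z y)"

definition mempty :: "('v \<Rightarrow> 'v \<Rightarrow> bool) \<Rightarrow> 'v" where
  "mempty m = setof m (\<lambda>z. False)"

definition msucc :: "('v \<Rightarrow> 'v \<Rightarrow> bool) \<Rightarrow> 'v \<Rightarrow> 'v" where
  "msucc m n = setof m (\<lambda>z. m z n \<or> z = n)"

definition mtransitive :: "('v \<Rightarrow> 'v \<Rightarrow> bool) \<Rightarrow> 'v \<Rightarrow> bool" where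
  "mtransitive m x \<longleftrightarrow> (\<forall>y. m y x \<longrightarrow> msubset m y x)"

text \<open>Von Neumann ordinals (in ZF, with foundation: transitive sets of transitive sets).\<close>
definition mordinal :: "('v \<Rightarrow> 'v \<Rightarrow> bool) \<Rightarrow> 'v \<Rightarrow> bool" where
  "mordinal m x \<longleftrightarrow> mtransitive m x \<and> (\<forall>y. m y x \<longrightarrow> mtransitive m y)"

definition minductive :: "('v \<Rightarrow> 'v \<Rightarrow> bool) \<Rightarrow> 'v \<Rightarrow> bool" where
  "minductive m x \<longleftrightarrow> m (mempty m) x \<and> (\<forall>u. m u x \<longrightarrow> m (msucc m u) x)"

definition momega :: "('v \<Rightarrow> 'v \<Rightarrow> bool) \<Rightarrow> 'v" where
  "momega m = (THE x. minductive m x \<and> (\<forall>y. minductive m y \<longrightarrow> msubset m x y))"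

definition mimage :: "('v \<Rightarrow> 'v \<Rightarrow> bool) \<Rightarrow> ('v \<Rightarrow> 'v) \<Rightarrow> 'v \<Rightarrow> 'v" where
  "mimage m F X = setof m (\<lambda>z. \<exists>x. m x X \<and> z = F x)"

definition kpair :: "('v \<Rightarrow> 'v \<Rightarrow> bool) \<Rightarrow> 'v \<Rightarrow> 'v \<Rightarrow> 'v" where
  "kpair m x y = setof m (\<lambda>z. z = setof m (\<lambda>w. w = x) \<or> z = setof m (\<lambda>w. w = x \<or> w = y))"

definition mapp :: "('v \<Rightarrow> 'v \<Rightarrow> bool) \<Rightarrow> 'v \<Rightarrow> 'v \<Rightarrow> 'v" where
  "mapp m f x = (THE y. m (kpair m x y) f)"

definition mV :: "('v \<Rightarrow> 'v \<Rightarrow> bool) \<Rightarrow> 'v \<Rightarrow> 'v" where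
  "mV m \<alpha> = (THE v. \<exists>f.
      (\<forall>x y y'. m (kpair m x y) f \<and> m (kpair m x y') f \<longrightarrow> y = y') \<and>
      (\<forall>\<beta>. m \<beta> (msucc m \<alpha>) \<longrightarrow> (\<exists>y. m (kpair m \<beta> y) f)) \<and>
      (\<forall>\<beta>. m \<beta> (msucc m \<alpha>) \<longrightarrow>
          mapp m f \<beta> = setof m (\<lambda>z. \<exists>\<gamma>. m \<gamma> \<beta> \<and> msubset m z (mapp m f \<gamma>))) \<and>
      v = mapp m f \<alpha>)"

section \<open>Quine--Rosser pairs\<close>

definition qr_s :: "('v \<Rightarrow> 'v \<Rightarrow> bool) \<Rightarrow> 'v \<Rightarrow> 'v" where
  "qr_s m u = (if m u (momega m) then msucc m u else u)"

definition qr_f0 :: "('v \<Rightarrow> 'v \<Rightarrow> bool) \<Rightarrow> 'v \<Rightarrow> 'v" where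
  "qr_f0 m X = mimage m (qr_s m) X"

definition qr_f1 :: "('v \<Rightarrow> 'v \<Rightarrow> bool) \<Rightarrow> 'v \<Rightarrow> 'v" where
  "qr_f1 m X = setof m (\<lambda>z. m z (qr_f0 m X) \<or> z = mempty m)"

definition qr_pair :: "('v \<Rightarrow> 'v \<Rightarrow> bool) \<Rightarrow> 'v \<Rightarrow> 'v \<Rightarrow> 'v" where
  "qr_pair m x y = setof m (\<lambda>z. m z (mimage m (qr_f0 m) x) \<or> m z (mimage m (qr_f1 m) y))"

definition qr_sec :: "('v \<Rightarrow> 'v \<Rightarrow> bool) \<Rightarrow> 'v \<Rightarrow> 'v \<Rightarrow> 'v" where
  "qr_sec m a x = setof m (\<lambda>y. m (qr_pair m x y) a)"

definition qr_fam :: "('v \<Rightarrow> 'v \<Rightarrow> bool) \<Rightarrow> 'v \<Rightarrow> 'v \<Rightarrow> 'v" where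
  "qr_fam m a b = mimage m (qr_sec m a) b"

definition fully_elementary :: "('v \<Rightarrow> 'v \<Rightarrow> bool) \<Rightarrow> 'v \<Rightarrow> ('v \<Rightarrow> 'v) \<Rightarrow> bool" where
  "fully_elementary m V j \<longleftrightarrow>
     (\<forall>x. m x V \<longrightarrow> m (j x) V) \<and>
     (\<forall>\<phi> e. (\<forall>i. m (e i) V) \<longrightarrow> (sat m (\<lambda>x. m x V) \<phi> e \<longleftrightarrow> sat m (\<lambda>x. m x V) \<phi> (j \<circ> e)))"

definition definable_from :: "('v \<Rightarrow> 'v \<Rightarrow> bool) \<Rightarrow> 'v \<Rightarrow> ('v \<Rightarrow> 'v) \<Rightarrow> 'v \<Rightarrow> bool" where
  "definable_from m V j p \<longleftrightarrow>
     (\<exists>\<phi>. \<forall>u w. m u V \<longrightarrow> m w V \<longrightarrow>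
        (j u = w \<longleftrightarrow> sat m (\<lambda>x. m x V) \<phi> ((\<lambda>_. p)(0 := u, 1 := w))))"

end

theory Submission
  imports Defs
begin

text \<open>
  Suppose \<open>j\<close> is defined over \<open>V\<^sub>\<alpha>\<close> by \<open>\<phi>\<close> from \<open>p = (j a)\<^sub>x\<^sub>0\<close> with \<open>x\<^sub>0 \<in> j b\<close>, and for \<open>x \<in> b\<close> let
  \<open>k\<^sub>x\<close> be the relation defined by \<open>\<phi>\<close> from \<open>(a)\<^sub>x\<close>. For every \<open>A \<in> V\<^sub>\<alpha>\<close> the set of \<open>x \<in> b\<close> with
  \<open>k\<^sub>x A = j A\<close> is large, that is, its image under \<open>j\<close> contains \<open>x\<^sub>0\<close>: this only says that
  \<open>j (j A) = j (j A)\<close>. Start with a large set \<open>B\<^sub>0\<close> of \<open>x\<close> for which \<open>k\<^sub>x\<close> preserves the finitely many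
  formulas needed and \<open>k\<^sub>x a = j a\<close>, and let \<open>B\<^sub>i\<^sub>+\<^sub>1 = {x \<in> B\<^sub>i. k\<^sub>x B\<^sub>i = j B\<^sub>i}\<close>. The intersection \<open>B\<close> of
  the \<open>B\<^sub>i\<close> is large because \<open>j\<close> fixes \<open>\<omega>\<close> pointwise, and \<open>k\<^sub>x B = j B\<close> for all \<open>x \<in> B\<close>. Let \<open>\<mu>\<close> be the
  least critical point of the \<open>k\<^sub>x\<close> with \<open>x \<in> B\<close>, attained at \<open>x\<close>. Both \<open>j \<mu>\<close> and \<open>k\<^sub>x \<mu>\<close> are the least
  critical point of the family given by \<open>j a\<close> and \<open>j B\<close>, so \<open>j \<mu> = k\<^sub>x \<mu> \<noteq> \<mu>\<close> and \<open>\<mu>\<close> is at least the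
  critical point \<open>\<kappa>\<close> of \<open>j\<close>. But \<open>j\<close> itself belongs to that family, so \<open>j \<mu> \<le> \<kappa> < j \<kappa> \<le> j \<mu>\<close>.

  Only finitely many instances of elementarity enter, so no internal satisfaction relation is needed
  and the model may have a nonstandard \<open>\<omega>\<close>. Critical points are taken among the levels \<open>V\<^sub>\<gamma>\<close> instead of
  the ordinals, since levels are definable over every \<open>V\<^sub>\<alpha>\<close> without coding functions.
\<close>

section \<open>Relations definable by formulas\<close>

lemma sat_finite_support:
  "\<exists>N. \<forall>e e'. (\<forall>n<N. e n = e' n) \<longrightarrow> sat m D \<phi> e = sat m D \<phi> e'"
proof (induction \<phi>)
  case (FMem i k)
  show ?case by (rule exI[of _ "Suc (max i k)"]) (auto simp: less_Suc_eq_le)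
next
  case (FEq i k)
  show ?case by (rule exI[of _ "Suc (max i k)"]) (auto simp: less_Suc_eq_le)
next
  case (FNeg \<phi>)
  then show ?case by simp
next
  case (FConj \<phi> \<psi>)
  then obtain N N' where N: "\<And>e e'. (\<forall>n<N. e n = e' n) \<Longrightarrow> sat m D \<phi> e = sat m D \<phi> e'"
    "\<And>e e'. (\<forall>n<N'. e n = e' n) \<Longrightarrow> sat m D \<psi> e = sat m D \<psi> e'" by blast
  have "sat m D (FConj \<phi> \<psi>) e = sat m D (FConj \<phi> \<psi>) e'" if "\<forall>n<max N N'. e n = e' n" for e e'
    using N[of e e'] that by simp
  then show ?case by blast
next
  case (FEx i \<phi>)
  then obtain N where N: "\<And>e e'. (\<forall>n<N. e n = e' n) \<Longrightarrow> sat m D \<phi> e = sat m D \<phi> e'" by blast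
  show ?case
  proof (intro exI[of _ N] allI impI)
    fix e e' :: "nat \<Rightarrow> 'a" assume "\<forall>n<N. e n = e' n"
    then have "sat m D \<phi> (e(i := x)) = sat m D \<phi> (e'(i := x))" for x
      by (intro N) simp
    then show "sat m D (FEx i \<phi>) e = sat m D (FEx i \<phi>) e'" by simp
  qed
qed

text \<open>\<open>\<rho>\<close> need not be injective. Only a bound variable needs care: it is
  moved to a fresh one, which changes \<open>\<rho>\<close>, so the induction is over all
  \<open>\<rho>\<close>.\<close>

lemma sat_rename: "\<exists>\<psi>. \<forall>e. sat m D \<psi> e = sat m D \<phi> (\<lambda>n. e (\<rho> n))"
proof (induction \<phi> arbitrary: \<rho>)
  case (FMem i k)
  show ?case by (rule exI[of _ "FMem (\<rho> i) (\<rho> k)"]) simp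
next
  case (FEq i k)
  show ?case by (rule exI[of _ "FEq (\<rho> i) (\<rho> k)"]) simp
next
  case (FNeg \<phi>)
  then obtain \<phi>' where "\<forall>e. sat m D \<phi>' e = sat m D \<phi> (\<lambda>n. e (\<rho> n))" by blast
  then show ?case by (intro exI[of _ "FNeg \<phi>'"]) simp
next
  case (FConj \<phi> \<psi>)
  then obtain \<phi>' \<psi>' where "\<forall>e. sat m D \<phi>' e = sat m D \<phi> (\<lambda>n. e (\<rho> n))" "\<forall>e. sat m D \<psi>' e = sat m D \<psi> (\<lambda>n. e (\<rho> n))" by blast
  then show ?case by (intro exI[of _ "FConj \<phi>' \<psi>'"]) simp
next
  case (FEx i \<phi>)
  obtain N where N: "\<And>e e'. (\<forall>n<N. e n = e' n) \<Longrightarrow> sat m D \<phi> e = sat m D \<phi> e'"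
    using sat_finite_support by blast
  \<comment> \<open>By finite support only the images of indices below \<open>N\<close> count. Some
    \<open>k\<close> avoids them all, and binding it captures nothing.\<close>
  obtain k where k: "\<And>n. n < N \<Longrightarrow> \<rho> n \<noteq> k"
    using ex_new_if_finite[OF infinite_UNIV_nat finite_imageI[OF finite_lessThan, of \<rho> N]]
    by (metis image_eqI lessThan_iff)
  obtain \<psi> where \<psi>: "\<And>e. sat m D \<psi> e = sat m D \<phi> (\<lambda>n. e ((\<rho>(i := k)) n))"
    using FEx.IH by blast
  have "sat m D \<psi> (e(k := x)) = sat m D \<phi> ((\<lambda>n. e (\<rho> n))(i := x))" for e x
    unfolding \<psi> using k by (intro N) auto
  then show ?case by (intro exI[of _ "FEx k \<psi>"]) simp
qed

text \<open>Variable 0 is reserved for the set and the others are shifted past it, so no quantifier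
  captures it. Truth over a set thus becomes truth in the model with the set as a parameter.\<close>

lemma sat_relativize:
  "\<exists>\<psi>. \<forall>e. sat m (\<lambda>_. True) \<psi> e = sat m (\<lambda>x. m x (e 0)) \<phi> (\<lambda>n. e (Suc n))"
proof (induction \<phi>)
  case (FMem i k)
  show ?case by (rule exI[of _ "FMem (Suc i) (Suc k)"]) simp
next
  case (FEq i k)
  show ?case by (rule exI[of _ "FEq (Suc i) (Suc k)"]) simp
next
  case (FNeg \<phi>)
  then obtain \<phi>' where "\<forall>e. sat m (\<lambda>_. True) \<phi>' e = sat m (\<lambda>x. m x (e 0)) \<phi> (\<lambda>n. e (Suc n))" by blast
  then show ?case by (intro exI[of _ "FNeg \<phi>'"]) simp
next
  case (FConj \<phi> \<psi>)
  then obtain \<phi>' \<psi>' where "\<forall>e. sat m (\<lambda>_. True) \<phi>' e = sat m (\<lambda>x. m x (e 0)) \<phi> (\<lambda>n. e (Suc n))" "\<forall>e. sat m (\<lambda>_. True) \<psi>' e = sat m (\<lambda>x. m x (e 0)) \<psi> (\<lambda>n. e (Suc n))" by blast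
  then show ?case by (intro exI[of _ "FConj \<phi>' \<psi>'"]) simp
next
  case (FEx i \<phi>)
  then obtain \<psi> where \<psi>: "\<And>e. sat m (\<lambda>_. True) \<psi> e = sat m (\<lambda>x. m x (e 0)) \<phi> (\<lambda>n. e (Suc n))"
    by blast
  have "(\<lambda>n. (e(Suc i := x)) (Suc n)) = (\<lambda>n. e (Suc n))(i := x)" for e :: "nat \<Rightarrow> 'a" and x
    by auto
  then show ?case by (intro exI[of _ "FEx (Suc i) (FConj (FMem (Suc i) 0) \<psi>)"]) (simp add: \<psi>)
qed

section \<open>Relations definable with parameters\<close>

definition tm :: "'v set \<Rightarrow> ((nat \<Rightarrow> 'v) \<Rightarrow> 'v) \<Rightarrow> bool" where
  "tm A t \<longleftrightarrow> (\<exists>i. t = (\<lambda>e. e i)) \<or> (\<exists>c\<in>A. t = (\<lambda>e. c))"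

text \<open>Definability is attached to a HOL predicate on assignments, so that it can be proved by
  \<open>intro\<close> along the shape of the predicate. The table \<open>\<sigma>\<close> tells
  which variables of the formula read an entry of the assignment and which read a parameter.\<close>

definition dfn :: "('v \<Rightarrow> 'v \<Rightarrow> bool) \<Rightarrow> ('v \<Rightarrow> bool) \<Rightarrow> 'v set \<Rightarrow> ((nat \<Rightarrow> 'v) \<Rightarrow> bool) \<Rightarrow> bool" where
  "dfn m D A R \<longleftrightarrow> (\<exists>\<phi> \<sigma>. (\<forall>n. tm A (\<sigma> n)) \<and>
     (\<forall>e. (\<forall>i. D (e i)) \<longrightarrow> (sat m D \<phi> (\<lambda>n. \<sigma> n e) \<longleftrightarrow> R e)))"

lemma dfnE:
  assumes "dfn m D A R"
  obtains \<phi> \<sigma> where "\<And>n. tm A (\<sigma> n)"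
    "\<And>e. (\<And>i. D (e i)) \<Longrightarrow> sat m D \<phi> (\<lambda>n. \<sigma> n e) \<longleftrightarrow> R e"
  using assms unfolding dfn_def by blast

lemma dfnI:
  assumes "\<And>n. tm A (\<sigma> n)"
    and "\<And>e. (\<And>i. D (e i)) \<Longrightarrow> sat m D \<phi> (\<lambda>n. \<sigma> n e) \<longleftrightarrow> R e"
  shows "dfn m D A R"
  using assms unfolding dfn_def by blast

lemma tm_var: "tm A (\<lambda>e. e i)"
  by (auto simp: tm_def)

lemma tm_const: "c \<in> A \<Longrightarrow> tm A (\<lambda>e. c)"
  by (auto simp: tm_def)

lemma tm_comp: "tm A t \<Longrightarrow> (\<And>i. tm A (s i)) \<Longrightarrow> tm A (\<lambda>e. t (\<lambda>i. s i e))"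
  unfolding tm_def by fast

lemma tm_mono: "tm A t \<Longrightarrow> A \<subseteq> A' \<Longrightarrow> tm A' t"
  by (auto simp: tm_def)

lemma dfn_mono:
  assumes "dfn m D A R" and "A \<subseteq> A'"
  shows "dfn m D A' R"
proof -
  obtain \<phi> \<sigma> where "\<And>n. tm A (\<sigma> n)"
    "\<And>e. (\<And>i. D (e i)) \<Longrightarrow> sat m D \<phi> (\<lambda>n. \<sigma> n e) \<longleftrightarrow> R e"
    using assms(1) by (rule dfnE) blast
  then show ?thesis using assms(2) by (intro dfnI[of A' \<sigma> D m \<phi>]) (auto intro: tm_mono)
qed

lemma dfn_cong:
  assumes "dfn m D A R" and "\<And>e. (\<And>i. D (e i)) \<Longrightarrow> R e \<longleftrightarrow> R' e"
  shows "dfn m D A R'"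
proof -
  obtain \<phi> \<sigma> where "\<And>n. tm A (\<sigma> n)"
    "\<And>e. (\<And>i. D (e i)) \<Longrightarrow> sat m D \<phi> (\<lambda>n. \<sigma> n e) \<longleftrightarrow> R e"
    using assms(1) by (rule dfnE) blast
  then show ?thesis using assms(2) by (intro dfnI[of A \<sigma> D m \<phi>]) auto
qed

lemma dfn_sat:
  assumes "\<And>n. tm A (\<sigma> n)"
  shows "dfn m D A (\<lambda>e. sat m D \<phi> (\<lambda>n. \<sigma> n e))"
  using assms by (intro dfnI) auto

lemma dfn_mem: "tm A t \<Longrightarrow> tm A t' \<Longrightarrow> dfn m D A (\<lambda>e. m (t e) (t' e))"
  using dfn_sat[of A "\<lambda>n. if n = 0 then t else t'" m D "FMem 0 1"] by simp

lemma dfn_eq: "tm A t \<Longrightarrow> tm A t' \<Longrightarrow> dfn m D A (\<lambda>e. t e = t' e)"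
  using dfn_sat[of A "\<lambda>n. if n = 0 then t else t'" m D "FEq 0 1"] by simp

lemma dfn_not:
  assumes "dfn m D A P"
  shows "dfn m D A (\<lambda>e. \<not> P e)"
proof -
  obtain \<phi> \<sigma> where "\<And>n. tm A (\<sigma> n)"
    "\<And>e. (\<And>i. D (e i)) \<Longrightarrow> sat m D \<phi> (\<lambda>n. \<sigma> n e) \<longleftrightarrow> P e"
    using assms by (rule dfnE) blast
  then show ?thesis by (intro dfnI[of A \<sigma> D m "FNeg \<phi>"]) auto
qed

text \<open>The two formulas come with unrelated tables. Renaming puts the first on even and the
  second on odd variables, and the tables are interleaved accordingly.\<close>

lemma dfn_conj:
  assumes "dfn m D A P" and "dfn m D A Q"
  shows "dfn m D A (\<lambda>e. P e \<and> Q e)"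
proof -
  obtain \<phi> \<sigma> where 1: "\<And>n. tm A (\<sigma> n)"
    "\<And>e. (\<And>i. D (e i)) \<Longrightarrow> sat m D \<phi> (\<lambda>n. \<sigma> n e) \<longleftrightarrow> P e"
    using assms(1) by (rule dfnE) blast
  obtain \<psi> \<tau> where 2: "\<And>n. tm A (\<tau> n)"
    "\<And>e. (\<And>i. D (e i)) \<Longrightarrow> sat m D \<psi> (\<lambda>n. \<tau> n e) \<longleftrightarrow> Q e"
    using assms(2) by (rule dfnE) blast
  obtain \<phi>' where \<phi>': "\<And>e. sat m D \<phi>' e = sat m D \<phi> (\<lambda>n. e (2 * n))"
    using sat_rename[of m D \<phi> "\<lambda>n. 2 * n"] by blast
  obtain \<psi>' where \<psi>': "\<And>e. sat m D \<psi>' e = sat m D \<psi> (\<lambda>n. e (2 * n + 1))"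
    using sat_rename[of m D \<psi> "\<lambda>n. 2 * n + 1"] by blast
  define \<upsilon> where "\<upsilon> n = (if even n then \<sigma> (n div 2) else \<tau> (n div 2))" for n
  have "\<upsilon> (2 * n) = \<sigma> n" "\<upsilon> (2 * n + 1) = \<tau> n" for n by (auto simp: \<upsilon>_def)
  then have "(\<forall>i. D (e i)) \<longrightarrow> sat m D (FConj \<phi>' \<psi>') (\<lambda>n. \<upsilon> n e) = (P e \<and> Q e)" for e
    using 1(2) 2(2) by (simp add: \<phi>' \<psi>')
  moreover have "tm A (\<upsilon> n)" for n using 1(1) 2(1) by (simp add: \<upsilon>_def)
  ultimately show ?thesis by (intro dfnI[of A \<upsilon> D m "FConj \<phi>' \<psi>'"]) blast+
qed

lemma dfn_disj:
  assumes "dfn m D A P" and "dfn m D A Q"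
  shows "dfn m D A (\<lambda>e. P e \<or> Q e)"
  by (rule dfn_cong[OF dfn_not[OF dfn_conj[OF assms[THEN dfn_not]]]]) blast

lemma dfn_imp:
  assumes "dfn m D A P" and "dfn m D A Q"
  shows "dfn m D A (\<lambda>e. P e \<longrightarrow> Q e)"
  by (rule dfn_cong[OF dfn_disj[OF dfn_not[OF assms(1)] assms(2)]]) blast

lemma dfn_iff:
  assumes "dfn m D A P" and "dfn m D A Q"
  shows "dfn m D A (\<lambda>e. P e \<longleftrightarrow> Q e)"
  by (rule dfn_cong[OF dfn_conj[OF dfn_imp[OF assms] dfn_imp[OF assms(2,1)]]]) blast

text \<open>A quantified variable is put at position \<open>0\<close> and the other variables move up by one.\<close>

lemma dfn_ex:
  assumes "dfn m D A (\<lambda>e. Q (e 0) (\<lambda>n. e (Suc n)))"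
  shows "dfn m D A (\<lambda>e. \<exists>x. D x \<and> Q x e)"
proof -
  obtain \<phi> \<sigma> where \<sigma>: "\<And>n. tm A (\<sigma> n)"
    "\<And>e. (\<And>i. D (e i)) \<Longrightarrow> sat m D \<phi> (\<lambda>n. \<sigma> n e) \<longleftrightarrow> Q (e 0) (\<lambda>n. e (Suc n))"
    using assms by (rule dfnE) blast
  \<comment> \<open>\<open>FEx\<close> binds a variable of the formula, whereas the quantified value
    sits in the assignment. All variables whose table entry reads position 0 are therefore merged
    into variable 0, which is then bound.\<close>
  obtain \<phi>' where \<phi>': "\<And>e. sat m D \<phi>' e = sat m D \<phi> (\<lambda>n. e (if \<sigma> n = (\<lambda>e. e 0) then 0 else Suc n))"
    using sat_rename[of m D \<phi> "\<lambda>n. if \<sigma> n = (\<lambda>e. e 0) then 0 else Suc n"] by blast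
  \<comment> \<open>Entry 0 and the \<open>e 0\<close> put in front of \<open>e\<close> are dummies:
    the former is overwritten by the binder, and nothing that \<open>\<phi>'\<close> still looks up
    depends on the latter.\<close>
  define \<tau> where "\<tau> n = (case n of 0 \<Rightarrow> (\<lambda>e. e 0) | Suc k \<Rightarrow> (\<lambda>e. \<sigma> k (case_nat (e 0) e)))" for n
  have "tm A (\<tau> n)" for n
  proof (cases n)
    case 0
    then show ?thesis by (simp add: \<tau>_def tm_var)
  next
    case (Suc k)
    have "tm A (\<lambda>e. \<sigma> k (\<lambda>i. (case i of 0 \<Rightarrow> (\<lambda>e. e 0) | Suc l \<Rightarrow> (\<lambda>e. e l)) e))"
      by (rule tm_comp[OF \<sigma>(1)]) (auto intro: tm_var split: nat.split)
    also have "(\<lambda>e. \<sigma> k (\<lambda>i. (case i of 0 \<Rightarrow> (\<lambda>e. e 0) | Suc l \<Rightarrow> (\<lambda>e. e l)) e)) = \<tau> n"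
      unfolding \<tau>_def Suc by (auto intro!: ext arg_cong[of _ _ "\<sigma> k"] split: nat.split)
    finally show ?thesis .
  qed
  moreover have "sat m D (FEx 0 \<phi>') (\<lambda>n. \<tau> n e) \<longleftrightarrow> (\<exists>x. D x \<and> Q x e)" if "\<forall>i. D (e i)" for e
  proof -
    have "((\<lambda>n. \<tau> n e)(0 := x)) (if \<sigma> n = (\<lambda>e. e 0) then 0 else Suc n) = \<sigma> n (case_nat x e)" for x n
      using \<sigma>(1)[of n] unfolding tm_def \<tau>_def by (auto split: nat.split)
    then have "sat m D (FEx 0 \<phi>') (\<lambda>n. \<tau> n e) \<longleftrightarrow> (\<exists>x. D x \<and> sat m D \<phi> (\<lambda>n. \<sigma> n (case_nat x e)))"
      by (simp add: \<phi>')
    moreover have "sat m D \<phi> (\<lambda>n. \<sigma> n (case_nat x e)) \<longleftrightarrow> Q x e" if "D x" for x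
      using \<sigma>(2)[of "case_nat x e"] \<open>D x\<close> \<open>\<forall>i. D (e i)\<close> by (simp split: nat.split)
    ultimately show ?thesis by blast
  qed
  ultimately show ?thesis by (intro dfnI[of A \<tau> D m "FEx 0 \<phi>'"]) blast+
qed

lemma dfn_all:
  assumes "dfn m D A (\<lambda>e. Q (e 0) (\<lambda>n. e (Suc n)))"
  shows "dfn m D A (\<lambda>e. \<forall>x. D x \<longrightarrow> Q x e)"
  using dfn_not[OF dfn_ex[OF dfn_not[OF assms]]] by simp

lemma dfn_subst:
  assumes "dfn m D A R" and "\<And>i. tm A (t i)" and "\<And>c. c \<in> A \<Longrightarrow> D c"
  shows "dfn m D A (\<lambda>e. R (\<lambda>i. t i e))"
proof -
  obtain \<phi> \<sigma> where \<sigma>: "\<And>n. tm A (\<sigma> n)"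
    "\<And>e. (\<And>i. D (e i)) \<Longrightarrow> sat m D \<phi> (\<lambda>n. \<sigma> n e) \<longleftrightarrow> R e"
    using assms(1) by (rule dfnE) blast
  have "D (t i e)" if "\<forall>i. D (e i)" for e i
    using assms(2)[of i] assms(3) that unfolding tm_def by auto
  then have "sat m D \<phi> (\<lambda>n. \<sigma> n (\<lambda>i. t i e)) \<longleftrightarrow> R (\<lambda>i. t i e)" if "\<And>i. D (e i)" for e
    using \<sigma>(2)[of "\<lambda>i. t i e"] that by blast
  moreover have "tm A (\<lambda>e. \<sigma> n (\<lambda>i. t i e))" for n
    by (rule tm_comp[OF \<sigma>(1) assms(2)])
  ultimately show ?thesis by (intro dfnI[of A "\<lambda>n e. \<sigma> n (\<lambda>i. t i e)" D m \<phi>]) blast+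
qed

text \<open>Four places are the largest arity that occurs below; smaller arities are padded by
  repeating an argument.\<close>

lemma dfn_subst4:
  assumes "dfn m D A (\<lambda>e. P (e 0) (e 1) (e 2) (e 3))" and "\<And>c. c \<in> A \<Longrightarrow> D c"
    and "tm A t0" "tm A t1" "tm A t2" "tm A t3"
  shows "dfn m D A (\<lambda>e. P (t0 e) (t1 e) (t2 e) (t3 e))"
  using dfn_subst[OF assms(1), of "\<lambda>i. if i = 0 then t0 else if i = 1 then t1 else if i = 2 then t2 else t3"]
    assms by (simp cong: if_cong)

lemma dfn_subst3:
  assumes "dfn m D A (\<lambda>e. P (e 0) (e 1) (e 2))" and "\<And>c. c \<in> A \<Longrightarrow> D c"
    and "tm A t0" "tm A t1" "tm A t2"
  shows "dfn m D A (\<lambda>e. P (t0 e) (t1 e) (t2 e))"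
  using dfn_subst4[of m D A "\<lambda>x y z _. P x y z" t0 t1 t2 t2] assms by simp

lemma dfn_subst2:
  assumes "dfn m D A (\<lambda>e. P (e 0) (e 1))" and "\<And>c. c \<in> A \<Longrightarrow> D c"
    and "tm A t0" "tm A t1"
  shows "dfn m D A (\<lambda>e. P (t0 e) (t1 e))"
  using dfn_subst4[of m D A "\<lambda>x y _ _. P x y" t0 t1 t1 t1] assms by simp

lemma dfn_subst1:
  assumes "dfn m D A (\<lambda>e. P (e 0))" and "\<And>c. c \<in> A \<Longrightarrow> D c" and "tm A t0"
  shows "dfn m D A (\<lambda>e. P (t0 e))"
  using dfn_subst4[of m D A "\<lambda>x _ _ _. P x" t0 t0 t0 t0] assms by simp

lemma dfn_bex:
  assumes "\<And>x y. D y \<Longrightarrow> m x y \<Longrightarrow> D x" and "\<And>c. c \<in> A \<Longrightarrow> D c" and t: "tm A t"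
    and Q: "dfn m D A (\<lambda>e. Q (e 0) (\<lambda>n. e (Suc n)))"
  shows "dfn m D A (\<lambda>e. \<exists>x. m x (t e) \<and> Q x e)"
proof -
  have "dfn m D A (\<lambda>e. \<exists>x. D x \<and> m x (t e) \<and> Q x e)"
    by (intro dfn_ex dfn_conj dfn_mem tm_var Q tm_comp[OF t])
  then show ?thesis
  proof (rule dfn_cong)
    fix e assume "\<And>i::nat. D (e i)"
    then have "D (t e)" using t assms(2) unfolding tm_def by auto
    then show "(\<exists>x. D x \<and> m x (t e) \<and> Q x e) \<longleftrightarrow> (\<exists>x. m x (t e) \<and> Q x e)"
      using assms(1) by blast
  qed
qed

lemma dfn_ball:
  assumes "\<And>x y. D y \<Longrightarrow> m x y \<Longrightarrow> D x" and "\<And>c. c \<in> A \<Longrightarrow> D c" and t: "tm A t"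
    and Q: "dfn m D A (\<lambda>e. Q (e 0) (\<lambda>n. e (Suc n)))"
  shows "dfn m D A (\<lambda>e. \<forall>x. m x (t e) \<longrightarrow> Q x e)"
  using dfn_not[OF dfn_bex[OF assms(1-3) dfn_not[OF Q]]] by simp

text \<open>The form in which the axiom schemas take a formula: arguments first, parameters after
  them.\<close>

lemma dfn_binary_formula:
  assumes "dfn m D A (\<lambda>e. P (e 0) (e 1))"
  obtains \<psi> c where "\<And>n. c n \<in> A \<or> c n = c0"
    "\<And>u w. D u \<Longrightarrow> D w \<Longrightarrow> sat m D \<psi> (case_nat u (case_nat w c)) \<longleftrightarrow> P u w"
proof -
  obtain \<phi> \<sigma> where \<sigma>: "\<And>n. tm A (\<sigma> n)"
    "\<And>e. (\<And>i. D (e i)) \<Longrightarrow> sat m D \<phi> (\<lambda>n. \<sigma> n e) \<longleftrightarrow> P (e 0) (e 1)"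
    using assms by (rule dfnE) blast
  let ?v = "\<lambda>n. \<exists>i. \<sigma> n = (\<lambda>e. e i)"
  \<comment> \<open>\<open>P\<close> looks only at entries 0 and 1, so assignments that are constant
    from entry 1 on suffice; every variable term other than the first then reads
    \<open>w\<close>.\<close>
  let ?r = "\<lambda>n. if \<sigma> n = (\<lambda>e. e 0) then 0 else if ?v n then 1 else Suc (Suc n)"
  obtain \<psi> where \<psi>: "\<And>e. sat m D \<psi> e = sat m D \<phi> (\<lambda>n. e (?r n))"
    using sat_rename[of m D \<phi> ?r] by blast
  \<comment> \<open>\<open>c0\<close> fills the places of variable terms, which \<open>?r\<close>
    never looks up. A parameter term is constant, so it may be evaluated at
    \<open>undefined\<close>.\<close>
  let ?c = "\<lambda>n. if ?v n then c0 else \<sigma> n undefined"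
  have "?c n \<in> A \<or> ?c n = c0" for n using \<sigma>(1)[of n] unfolding tm_def by auto
  moreover have "sat m D \<psi> (case_nat u (case_nat w ?c)) \<longleftrightarrow> P u w" if "D u" "D w" for u w
  proof -
    let ?e = "case_nat u (\<lambda>_. w)"
    have "case_nat u (case_nat w ?c) (?r n) = \<sigma> n ?e" for n
    proof (cases "?v n")
      case True
      then obtain i where i: "\<sigma> n = (\<lambda>e. e i)" by blast
      show ?thesis
      proof (cases "\<sigma> n = (\<lambda>e. e 0)")
        case True
        then have "\<sigma> n ?e = u" by simp
        then show ?thesis using True by simp
      next
        case False
        then have "i \<noteq> 0" using i by auto
        then have "\<sigma> n ?e = w" using i by (simp split: nat.split)
        then show ?thesis using False True by simp
      qed
    next
      case False
      then obtain d where "\<sigma> n = (\<lambda>e. d)" using \<sigma>(1)[of n] unfolding tm_def by auto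
      then show ?thesis using False by auto
    qed
    then have "sat m D \<psi> (case_nat u (case_nat w ?c)) \<longleftrightarrow> sat m D \<phi> (\<lambda>n. \<sigma> n ?e)" unfolding \<psi> by simp
    also have "\<dots> \<longleftrightarrow> P u w" using \<sigma>(2)[of ?e] that by (simp split: nat.split)
    finally show ?thesis .
  qed
  ultimately show ?thesis by (rule that)
qed

lemma dfn_unary_formula:
  assumes "dfn m D A (\<lambda>e. P (e 0))" and "D c0"
  obtains \<psi> c where "\<And>n. c n \<in> A \<or> c n = c0"
    "\<And>z. D z \<Longrightarrow> sat m D \<psi> (case_nat z c) \<longleftrightarrow> P z"
proof -
  obtain \<psi> c where c: "\<And>n. c n \<in> A \<or> c n = c0"
    "\<And>u w. D u \<Longrightarrow> D w \<Longrightarrow> sat m D \<psi> (case_nat u (case_nat w c)) \<longleftrightarrow> P u"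
    using assms(1) by (rule dfn_binary_formula[where P = "\<lambda>u _. P u"]) blast
  have "case_nat c0 c n \<in> A \<or> case_nat c0 c n = c0" for n using c(1) by (simp split: nat.split)
  moreover have "D z \<Longrightarrow> sat m D \<psi> (case_nat z (case_nat c0 c)) \<longleftrightarrow> P z" for z
    using c(2) assms(2) by blast
  ultimately show ?thesis by (rule that)
qed

text \<open>Elementarity moves a whole assignment of the formula, parameters included. Since
  \<open>j\<close> fixes the parameters, this amounts to moving \<open>e\<close>.\<close>

lemma dfn_elementary:
  assumes "dfn m D A R" and "\<And>i. D (e i)" and "\<And>c. c \<in> A \<Longrightarrow> D c \<and> j c = c"
    and el: "\<And>\<phi> e. (\<And>i. D (e i)) \<Longrightarrow> sat m D \<phi> e \<longleftrightarrow> sat m D \<phi> (j \<circ> e)"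
    and jD: "\<And>x. D x \<Longrightarrow> D (j x)"
  shows "R e \<longleftrightarrow> R (\<lambda>i. j (e i))"
proof -
  obtain \<phi> \<sigma> where \<sigma>: "\<And>n. tm A (\<sigma> n)"
    "\<And>e. (\<And>i. D (e i)) \<Longrightarrow> sat m D \<phi> (\<lambda>n. \<sigma> n e) \<longleftrightarrow> R e"
    using assms(1) by (rule dfnE) blast
  have "j \<circ> (\<lambda>n. \<sigma> n e) = (\<lambda>n. \<sigma> n (\<lambda>i. j (e i)))"
  proof
    fix n show "(j \<circ> (\<lambda>n. \<sigma> n e)) n = \<sigma> n (\<lambda>i. j (e i))"
      using \<sigma>(1)[of n] assms(3) unfolding tm_def by auto
  qed
  moreover have "D (\<sigma> n e)" for n
    using \<sigma>(1)[of n] assms(2,3) unfolding tm_def by auto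
  ultimately show ?thesis using el[of "\<lambda>n. \<sigma> n e" \<phi>] \<sigma>(2) assms(2) jD by simp
qed

section \<open>Set theory inside a model\<close>

text \<open>One set of rules serves the whole model and the domain \<open>W\<close>, the latter with
  two parameter sets: all of \<open>W\<close>, and the elements fixed by the embedding.\<close>

locale transitive_domain =
  fixes m :: "'v \<Rightarrow> 'v \<Rightarrow> bool" (infix "\<epsilon>" 50) and D :: "'v \<Rightarrow> bool" and A :: "'v set"
  assumes D_trans: "D y \<Longrightarrow> x \<epsilon> y \<Longrightarrow> D x"
    and A_D: "c \<in> A \<Longrightarrow> D c"
begin

lemma dfn_bounded_ex:
  "tm A t \<Longrightarrow> dfn m D A (\<lambda>e. Q (e 0) (\<lambda>n. e (Suc n))) \<Longrightarrow> dfn m D A (\<lambda>e. \<exists>x. x \<epsilon> t e \<and> Q x e)"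
  by (rule dfn_bex) (auto intro: D_trans A_D)

lemma dfn_bounded_all:
  "tm A t \<Longrightarrow> dfn m D A (\<lambda>e. Q (e 0) (\<lambda>n. e (Suc n))) \<Longrightarrow> dfn m D A (\<lambda>e. \<forall>x. x \<epsilon> t e \<longrightarrow> Q x e)"
  by (rule dfn_ball) (auto intro: D_trans A_D)

lemmas dfn_base = tm_var tm_const dfn_mem dfn_eq dfn_not dfn_conj dfn_disj dfn_imp dfn_iff
  dfn_bounded_ex dfn_bounded_all dfn_ex dfn_all

lemma dfn_lift1: "dfn m D A (\<lambda>e. P (e 0)) \<Longrightarrow> tm A t0 \<Longrightarrow> dfn m D A (\<lambda>e. P (t0 e))"
  by (rule dfn_subst1) (auto intro: A_D)

lemma dfn_lift2:
  "dfn m D A (\<lambda>e. P (e 0) (e 1)) \<Longrightarrow> tm A t0 \<Longrightarrow> tm A t1 \<Longrightarrow> dfn m D A (\<lambda>e. P (t0 e) (t1 e))"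
  by (rule dfn_subst2) (auto intro: A_D)

lemma dfn_lift3:
  "dfn m D A (\<lambda>e. P (e 0) (e 1) (e 2)) \<Longrightarrow> tm A t0 \<Longrightarrow> tm A t1 \<Longrightarrow> tm A t2 \<Longrightarrow>
    dfn m D A (\<lambda>e. P (t0 e) (t1 e) (t2 e))"
  by (rule dfn_subst3) (auto intro: A_D)

lemma dfn_lift4:
  "dfn m D A (\<lambda>e. P (e 0) (e 1) (e 2) (e 3)) \<Longrightarrow> tm A t0 \<Longrightarrow> tm A t1 \<Longrightarrow> tm A t2 \<Longrightarrow> tm A t3 \<Longrightarrow>
    dfn m D A (\<lambda>e. P (t0 e) (t1 e) (t2 e) (t3 e))"
  by (rule dfn_subst4) (auto intro: A_D)

lemma dfn_msubset:
  assumes "tm A t" "tm A s"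
  shows "dfn m D A (\<lambda>e. msubset m (t e) (s e))"
  by (rule dfn_lift2[where P = "msubset m", OF _ assms]) (unfold msubset_def, intro dfn_base)

end

section \<open>Consequences of the axioms in the model\<close>

locale zf =
  fixes m :: "'v \<Rightarrow> 'v \<Rightarrow> bool" (infix "\<epsilon>" 50)
  assumes zf: "zf_model m"
begin

sublocale U: transitive_domain m "\<lambda>_. True" UNIV
  by unfold_locales auto

abbreviation dfnU :: "((nat \<Rightarrow> 'v) \<Rightarrow> bool) \<Rightarrow> bool" where
  "dfnU R \<equiv> dfn m (\<lambda>_. True) UNIV R"

lemma dfnU_ex: "dfnU (\<lambda>e. Q (e 0) (\<lambda>n. e (Suc n))) \<Longrightarrow> dfnU (\<lambda>e. \<exists>x. Q x e)"
  using dfn_ex[of m "\<lambda>_. True" UNIV Q] by simp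

lemma dfnU_all: "dfnU (\<lambda>e. Q (e 0) (\<lambda>n. e (Suc n))) \<Longrightarrow> dfnU (\<lambda>e. \<forall>x. Q x e)"
  using dfn_all[of m "\<lambda>_. True" UNIV Q] by simp

lemmas dfnU_base = tm_var tm_const[OF UNIV_I] dfn_mem dfn_eq dfn_not dfn_conj dfn_disj dfn_imp
  dfn_iff dfnU_ex dfnU_all U.dfn_msubset

lemma
  shows extensionality_ax: "\<forall>x y. (\<forall>z. z \<epsilon> x \<longleftrightarrow> z \<epsilon> y) \<longrightarrow> x = y"
    and foundation_ax: "\<forall>x. (\<exists>y. y \<epsilon> x) \<longrightarrow> (\<exists>y. y \<epsilon> x \<and> \<not> (\<exists>z. z \<epsilon> y \<and> z \<epsilon> x))"
    and pairing_ax: "\<forall>x y. \<exists>p. x \<epsilon> p \<and> y \<epsilon> p"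
    and union_ax: "\<forall>x. \<exists>u. \<forall>y z. z \<epsilon> y \<and> y \<epsilon> x \<longrightarrow> z \<epsilon> u"
    and power_ax: "\<forall>x. \<exists>p. \<forall>z. (\<forall>w. w \<epsilon> z \<longrightarrow> w \<epsilon> x) \<longrightarrow> z \<epsilon> p"
    and infinity_ax: "\<exists>x. (\<exists>e. e \<epsilon> x \<and> (\<forall>z. \<not> z \<epsilon> e)) \<and>
      (\<forall>u. u \<epsilon> x \<longrightarrow> (\<exists>s. s \<epsilon> x \<and> (\<forall>z. z \<epsilon> s \<longleftrightarrow> z \<epsilon> u \<or> z = u)))"
    and separation_ax: "\<forall>\<phi> env x. \<exists>y. \<forall>z. z \<epsilon> y \<longleftrightarrow> z \<epsilon> x \<and> sat m (\<lambda>_. True) \<phi> (env(0 := z))"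
    and replacement_ax: "\<forall>\<phi> env x. (\<forall>u. u \<epsilon> x \<longrightarrow> (\<exists>!w. sat m (\<lambda>_. True) \<phi> (env(0 := u, 1 := w)))) \<longrightarrow>
      (\<exists>y. \<forall>w. w \<epsilon> y \<longleftrightarrow> (\<exists>u. u \<epsilon> x \<and> sat m (\<lambda>_. True) \<phi> (env(0 := u, 1 := w))))"
  unfolding atomize_conj conj_assoc by (rule zf[unfolded zf_model_def])

lemma ext: "(\<And>z. z \<epsilon> x \<longleftrightarrow> z \<epsilon> y) \<Longrightarrow> x = y"
  using extensionality_ax by simp

lemma foundation: "y \<epsilon> x \<Longrightarrow> \<exists>y. y \<epsilon> x \<and> (\<forall>z. z \<epsilon> y \<longrightarrow> \<not> z \<epsilon> x)"
  using foundation_ax by metis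

lemma separation:
  assumes "dfnU (\<lambda>e. P (e 0))"
  shows "\<exists>y. \<forall>z. z \<epsilon> y \<longleftrightarrow> z \<epsilon> x \<and> P z"
proof -
  obtain \<psi> c where \<psi>: "\<And>z. sat m (\<lambda>_. True) \<psi> (case_nat z c) \<longleftrightarrow> P z"
    using assms TrueI by (rule dfn_unary_formula) blast
  \<comment> \<open>The default in place 0 never matters, because the schema overwrites that place
    by \<open>z\<close>.\<close>
  have "(case_nat undefined c)(0 := z) = case_nat z c" for z
    by (auto split: nat.split)
  moreover have "\<exists>y. \<forall>z. z \<epsilon> y \<longleftrightarrow> z \<epsilon> x \<and> sat m (\<lambda>_. True) \<psi> ((case_nat undefined c)(0 := z))"
    using separation_ax by blast
  ultimately show ?thesis by (simp add: \<psi>)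
qed

lemma replacement:
  assumes "dfnU (\<lambda>e. P (e 0) (e 1))" and "\<And>u. u \<epsilon> x \<Longrightarrow> \<exists>!w. P u w"
  shows "\<exists>y. \<forall>w. w \<epsilon> y \<longleftrightarrow> (\<exists>u. u \<epsilon> x \<and> P u w)"
proof -
  obtain \<psi> c where \<psi>: "\<And>u w. sat m (\<lambda>_. True) \<psi> (case_nat u (case_nat w c)) \<longleftrightarrow> P u w"
    using assms(1) by (rule dfn_binary_formula) blast
  let ?e = "case_nat undefined (case_nat undefined c)"
  have e: "?e(0 := u, 1 := w) = case_nat u (case_nat w c)" for u w
    by (auto split: nat.split)
  have "(\<forall>u. u \<epsilon> x \<longrightarrow> (\<exists>!w. sat m (\<lambda>_. True) \<psi> (?e(0 := u, 1 := w)))) \<longrightarrow>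
    (\<exists>y. \<forall>w. w \<epsilon> y \<longleftrightarrow> (\<exists>u. u \<epsilon> x \<and> sat m (\<lambda>_. True) \<psi> (?e(0 := u, 1 := w))))"
    using replacement_ax[rule_format, of x \<psi> ?e] by blast
  then show ?thesis unfolding e \<psi> using assms(2) by blast
qed

lemma least_in:
  assumes "dfnU (\<lambda>e. P (e 0))" and "z \<epsilon> x" and "P z"
  shows "\<exists>z. z \<epsilon> x \<and> P z \<and> (\<forall>y. y \<epsilon> z \<longrightarrow> y \<epsilon> x \<longrightarrow> \<not> P y)"
proof -
  obtain s where "\<And>z. z \<epsilon> s \<longleftrightarrow> z \<epsilon> x \<and> P z" using separation[OF assms(1)] by blast
  then show ?thesis using foundation[of z s] assms(2,3) by blast
qed

lemma setof_eq: "(\<And>z. z \<epsilon> y \<longleftrightarrow> P z) \<Longrightarrow> setof m P = y"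
  unfolding setof_def by (rule the_equality) (auto intro: ext)

lemma mem_setof: "\<exists>y. \<forall>z. z \<epsilon> y \<longleftrightarrow> P z \<Longrightarrow> z \<epsilon> setof m P \<longleftrightarrow> P z"
  using setof_eq by metis

lemma mem_setof_bounded:
  assumes "dfnU (\<lambda>e. P (e 0))" and "\<And>z. P z \<Longrightarrow> z \<epsilon> x"
  shows "z \<epsilon> setof m P \<longleftrightarrow> P z"
  using separation[OF assms(1), of x] assms(2) by (intro mem_setof) blast

lemma mem_mempty [simp]: "\<not> z \<epsilon> mempty m"
proof -
  have "z \<epsilon> setof m (\<lambda>z. z \<noteq> z) \<longleftrightarrow> z \<noteq> z"
    by (rule mem_setof_bounded) (intro dfnU_base, simp)
  then show ?thesis by (simp add: mempty_def)
qed

lemma mempty_eq: "(\<And>z. \<not> z \<epsilon> x) \<Longrightarrow> x = mempty m"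
  by (rule ext) simp

lemma mem_upair [simp]: "z \<epsilon> setof m (\<lambda>w. w = x \<or> w = y) \<longleftrightarrow> z = x \<or> z = y"
proof -
  obtain p where "x \<epsilon> p" "y \<epsilon> p" using pairing_ax by blast
  then show ?thesis by (intro mem_setof_bounded[of _ p]) (intro dfnU_base, auto)
qed

lemma mem_singleton [simp]: "z \<epsilon> setof m (\<lambda>w. w = x) \<longleftrightarrow> z = x"
  using mem_upair[of z x x] by simp

lemma mem_kpair: "z \<epsilon> kpair m x y \<longleftrightarrow>
    z = setof m (\<lambda>w. w = x) \<or> z = setof m (\<lambda>w. w = x \<or> w = y)"
  unfolding kpair_def by simp

lemma kpair_inject [simp]: "kpair m x y = kpair m x' y' \<longleftrightarrow> x = x' \<and> y = y'"
proof
  assume eq: "kpair m x y = kpair m x' y'"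
  have "z \<epsilon> kpair m x y \<Longrightarrow> x \<epsilon> z" for x y z by (auto simp: mem_kpair)
  \<comment> \<open>The singleton of \<open>x\<close> is an element of the second pair, so it
    contains \<open>x'\<close>.\<close>
  then have x: "x = x'"
    using eq mem_kpair[of "setof m (\<lambda>w. w = x)" x y] by (metis mem_singleton)
  \<comment> \<open>The union of the pair is \<open>{x, y}\<close>; once the first coordinates
    agree, it determines the second.\<close>
  have U: "(\<exists>u. u \<epsilon> kpair m x y \<and> z \<epsilon> u) \<longleftrightarrow> z = x \<or> z = y" for z x y
    by (auto simp: mem_kpair)
  have "z = x \<or> z = y \<longleftrightarrow> z = x \<or> z = y'" for z
    using U[of x y z] U[of x y' z] unfolding eq[unfolded x[symmetric]] by simp
  then show "x = x' \<and> y = y'" using x by metis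
qed simp

lemma union_ex: "\<exists>u. \<forall>z. z \<epsilon> u \<longleftrightarrow> (\<exists>y. y \<epsilon> x \<and> z \<epsilon> y)"
proof -
  obtain u where "\<forall>y z. z \<epsilon> y \<and> y \<epsilon> x \<longrightarrow> z \<epsilon> u" using union_ax by blast
  moreover have "\<exists>v. \<forall>z. z \<epsilon> v \<longleftrightarrow> z \<epsilon> u \<and> (\<exists>y. y \<epsilon> x \<and> z \<epsilon> y)"
    by (rule separation) (intro dfnU_base)
  ultimately show ?thesis by blast
qed

lemma binary_union_ex: "\<exists>u. \<forall>z. z \<epsilon> u \<longleftrightarrow> z \<epsilon> x \<or> z \<epsilon> y"
  using union_ex[of "setof m (\<lambda>w. w = x \<or> w = y)"] by auto

lemma power_ex: "\<exists>p. \<forall>z. z \<epsilon> p \<longleftrightarrow> msubset m z x"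
proof -
  obtain p where "\<forall>z. msubset m z x \<longrightarrow> z \<epsilon> p"
    using power_ax unfolding msubset_def by blast
  moreover have "\<exists>v. \<forall>z. z \<epsilon> v \<longleftrightarrow> z \<epsilon> p \<and> msubset m z x"
    by (rule separation) (intro dfnU_base)
  ultimately show ?thesis by blast
qed

lemma insert_ex: "\<exists>y. \<forall>z. z \<epsilon> y \<longleftrightarrow> z \<epsilon> x \<or> z = c"
  using binary_union_ex[of x "setof m (\<lambda>w. w = c)"] by simp

lemma mem_msucc [simp]: "z \<epsilon> msucc m n \<longleftrightarrow> z \<epsilon> n \<or> z = n"
  unfolding msucc_def by (rule mem_setof) (rule insert_ex)

lemma mem_irrefl [simp]: "\<not> x \<epsilon> x"
  using foundation[of x "setof m (\<lambda>w. w = x)"] by auto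

lemma mem_asym: "x \<epsilon> y \<Longrightarrow> \<not> y \<epsilon> x"
  using foundation[of x "setof m (\<lambda>w. w = x \<or> w = y)"] by auto

lemma msucc_inject [simp]: "msucc m x = msucc m y \<longleftrightarrow> x = y"
  using mem_msucc mem_asym by metis

lemma msucc_neq_mempty [simp]: "msucc m x \<noteq> mempty m" "mempty m \<noteq> msucc m x"
  using mem_msucc mem_mempty by metis+

section \<open>Natural numbers of the model\<close>

lemma dfnU_msucc:
  assumes "tm UNIV t" "tm UNIV s"
  shows "dfnU (\<lambda>e. t e = msucc m (s e))"
proof (rule U.dfn_lift2[where P = "\<lambda>x y. x = msucc m y", OF _ assms])
  have "dfnU (\<lambda>e. \<forall>z. z \<epsilon> e 0 \<longleftrightarrow> z \<epsilon> e 1 \<or> z = e 1)"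
    by (intro dfnU_base)
  then show "dfnU (\<lambda>e. e 0 = msucc m (e 1))"
    by (rule dfn_cong) (auto intro: ext)
qed

lemma dfnU_minductive:
  assumes "tm UNIV t"
  shows "dfnU (\<lambda>e. minductive m (t e))"
proof (rule U.dfn_lift1[where P = "\<lambda>x. minductive m x", OF _ assms])
  have "dfnU (\<lambda>e. mempty m \<epsilon> e 0 \<and> (\<forall>u. u \<epsilon> e 0 \<longrightarrow> (\<exists>s. s \<epsilon> e 0 \<and> s = msucc m u)))"
    by (intro dfnU_base dfnU_msucc)
  then show "dfnU (\<lambda>e. minductive m (e 0))"
    by (rule dfn_cong) (auto simp: minductive_def)
qed

lemma momega_least: "minductive m (momega m) \<and> (\<forall>y. minductive m y \<longrightarrow> msubset m (momega m) y)"
proof -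
  obtain I where I: "\<exists>e. e \<epsilon> I \<and> (\<forall>z. \<not> z \<epsilon> e)"
    "\<forall>u. u \<epsilon> I \<longrightarrow> (\<exists>s. s \<epsilon> I \<and> (\<forall>z. z \<epsilon> s \<longleftrightarrow> z \<epsilon> u \<or> z = u))"
    using infinity_ax by blast
  have "mempty m \<epsilon> I" using I(1) mempty_eq by metis
  moreover have "msucc m u \<epsilon> I" if "u \<epsilon> I" for u
  proof -
    obtain s where s: "s \<epsilon> I" "\<forall>z. z \<epsilon> s \<longleftrightarrow> z \<epsilon> u \<or> z = u" using I(2) \<open>u \<epsilon> I\<close> by blast
    then have "s = msucc m u" by (intro ext) simp
    then show ?thesis using s(1) by simp
  qed
  ultimately have indI: "minductive m I" by (simp add: minductive_def)
  have "\<exists>w. \<forall>z. z \<epsilon> w \<longleftrightarrow> z \<epsilon> I \<and> (\<forall>J. minductive m J \<longrightarrow> z \<epsilon> J)"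
    by (rule separation) (intro dfnU_base dfnU_minductive)
  then obtain w where w: "\<And>z. z \<epsilon> w \<longleftrightarrow> z \<epsilon> I \<and> (\<forall>J. minductive m J \<longrightarrow> z \<epsilon> J)" by blast
  have "minductive m w" using indI w unfolding minductive_def by auto
  moreover have "msubset m w y" if "minductive m y" for y using that w unfolding msubset_def by blast
  ultimately have "\<exists>x. minductive m x \<and> (\<forall>y. minductive m y \<longrightarrow> msubset m x y)" by blast
  moreover have "x = x'" if "minductive m x \<and> (\<forall>y. minductive m y \<longrightarrow> msubset m x y)"
    "minductive m x' \<and> (\<forall>y. minductive m y \<longrightarrow> msubset m x' y)" for x x'
    using that unfolding msubset_def by (intro ext) blast
  ultimately have "\<exists>!x. minductive m x \<and> (\<forall>y. minductive m y \<longrightarrow> msubset m x y)" by (rule ex_ex1I)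
  then show ?thesis unfolding momega_def by (rule theI')
qed

lemma mempty_momega [simp]: "mempty m \<epsilon> momega m"
  and msucc_momega: "n \<epsilon> momega m \<Longrightarrow> msucc m n \<epsilon> momega m"
  using momega_least unfolding minductive_def by auto

text \<open>For membership in a set no definability is asked; so this serves predicates definable
  over the model as well as those definable over \<open>W\<close>.\<close>

lemma momega_induct_set:
  assumes "mempty m \<epsilon> s" and "\<And>n. n \<epsilon> momega m \<Longrightarrow> n \<epsilon> s \<Longrightarrow> msucc m n \<epsilon> s"
    and "n \<epsilon> momega m"
  shows "n \<epsilon> s"
proof -
  have "\<exists>y. \<forall>z. z \<epsilon> y \<longleftrightarrow> z \<epsilon> momega m \<and> z \<epsilon> s"
    by (rule separation) (intro dfnU_base)
  then obtain y where y: "\<And>z. z \<epsilon> y \<longleftrightarrow> z \<epsilon> momega m \<and> z \<epsilon> s" by blast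
  have "minductive m y" using assms(1,2) y msucc_momega by (simp add: minductive_def)
  then show ?thesis using momega_least assms(3) y unfolding msubset_def by blast
qed

lemma momega_induct [consumes 2, case_names zero succ]:
  assumes "dfnU (\<lambda>e. P (e 0))" and "n \<epsilon> momega m"
    and "P (mempty m)" and "\<And>n. n \<epsilon> momega m \<Longrightarrow> P n \<Longrightarrow> P (msucc m n)"
  shows "P n"
proof -
  obtain s where s: "\<And>z. z \<epsilon> s \<longleftrightarrow> z \<epsilon> momega m \<and> P z" using separation[OF assms(1)] by blast
  have "n \<epsilon> s"
    by (rule momega_induct_set) (use s assms msucc_momega in auto)
  then show ?thesis using s by blast
qed

lemma momega_trans: "k \<epsilon> n \<Longrightarrow> n \<epsilon> momega m \<Longrightarrow> k \<epsilon> momega m"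
proof -
  assume "k \<epsilon> n" "n \<epsilon> momega m"
  have "\<forall>k. k \<epsilon> n \<longrightarrow> k \<epsilon> momega m"
    using _ \<open>n \<epsilon> momega m\<close> by (rule momega_induct) (intro dfnU_base, auto)
  then show ?thesis using \<open>k \<epsilon> n\<close> by blast
qed

lemma nat_trans: "l \<epsilon> k \<Longrightarrow> k \<epsilon> n \<Longrightarrow> n \<epsilon> momega m \<Longrightarrow> l \<epsilon> n"
proof -
  assume "l \<epsilon> k" "k \<epsilon> n" "n \<epsilon> momega m"
  have "\<forall>k. k \<epsilon> n \<longrightarrow> (\<forall>l. l \<epsilon> k \<longrightarrow> l \<epsilon> n)"
    using _ \<open>n \<epsilon> momega m\<close> by (rule momega_induct) (intro dfnU_base, auto)
  then show ?thesis using \<open>k \<epsilon> n\<close> \<open>l \<epsilon> k\<close> by blast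
qed

lemma mem_mimage:
  assumes "dfnU (\<lambda>e. e 1 = F (e 0))"
  shows "z \<epsilon> mimage m F X \<longleftrightarrow> (\<exists>x. x \<epsilon> X \<and> z = F x)"
  unfolding mimage_def by (rule mem_setof, rule replacement[OF assms]) simp

end

section \<open>Quine-Rosser pairs and their definability\<close>

locale zf_domain = zf m + transitive_domain m D A
  for m :: "'v \<Rightarrow> 'v \<Rightarrow> bool" (infix "\<epsilon>" 50) and D A +
  assumes omega_A: "momega m \<in> A"
begin

text \<open>Equality with the value \<open>y\<close> of an operation can be tested by quantifiers
  over \<open>D\<close> as soon as the elements of \<open>y\<close> lie in \<open>D\<close>; closure
  of \<open>D\<close> under the operation is not presupposed.\<close>

lemma eq_iff_D: "D x \<Longrightarrow> (\<And>z. z \<epsilon> y \<Longrightarrow> D z) \<Longrightarrow> (\<forall>z. D z \<longrightarrow> (z \<epsilon> x \<longleftrightarrow> z \<epsilon> y)) \<longleftrightarrow> x = y"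
  using D_trans ext[of x y] by metis

lemma dfn_qr_s:
  assumes "tm A t" "tm A s"
  shows "dfn m D A (\<lambda>e. t e = qr_s m (s e))"
proof (rule dfn_lift2[where P = "\<lambda>x y. x = qr_s m y", OF _ assms])
  have "dfn m D A (\<lambda>e. e 1 \<epsilon> momega m \<and> (\<forall>z. D z \<longrightarrow> (z \<epsilon> e 0 \<longleftrightarrow> z \<epsilon> e 1 \<or> z = e 1))
      \<or> \<not> e 1 \<epsilon> momega m \<and> e 0 = e 1)"
    by (intro dfn_base omega_A)
  then show "dfn m D A (\<lambda>e. e 0 = qr_s m (e 1))"
  proof (rule dfn_cong)
    fix e :: "nat \<Rightarrow> 'v" assume "\<And>i. D (e i)"
    then have "(\<forall>z. D z \<longrightarrow> (z \<epsilon> e 0 \<longleftrightarrow> z \<epsilon> e 1 \<or> z = e 1)) \<longleftrightarrow> e 0 = msucc m (e 1)"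
      using D_trans eq_iff_D[of "e 0" "msucc m (e 1)"] by auto
    then show "e 1 \<epsilon> momega m \<and> (\<forall>z. D z \<longrightarrow> (z \<epsilon> e 0 \<longleftrightarrow> z \<epsilon> e 1 \<or> z = e 1))
      \<or> \<not> e 1 \<epsilon> momega m \<and> e 0 = e 1 \<longleftrightarrow> e 0 = qr_s m (e 1)"
      by (auto simp: qr_s_def)
  qed
qed

end

context zf begin

interpretation U: zf_domain m "\<lambda>_. True" UNIV
  by unfold_locales auto

lemma mem_qr_f0: "t \<epsilon> qr_f0 m X \<longleftrightarrow> (\<exists>r. r \<epsilon> X \<and> t = qr_s m r)"
  unfolding qr_f0_def by (rule mem_mimage) (intro U.dfn_qr_s dfnU_base)

lemma mem_qr_f1: "t \<epsilon> qr_f1 m X \<longleftrightarrow> (\<exists>r. r \<epsilon> X \<and> t = qr_s m r) \<or> t = mempty m"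
  unfolding qr_f1_def mem_qr_f0[symmetric] by (rule mem_setof) (rule insert_ex)

lemma qr_s_neq_mempty: "qr_s m r \<noteq> mempty m"
  by (auto simp: qr_s_def)

text \<open>On \<omega> this is the injective successor with values in \<omega>; elsewhere it is the
  identity. Values of the two kinds cannot meet.\<close>

lemma qr_s_inject: "qr_s m r = qr_s m r' \<longleftrightarrow> r = r'"
  by (auto simp: qr_s_def msucc_momega)

lemma qr_f0_inject: "qr_f0 m X = qr_f0 m Y \<Longrightarrow> X = Y"
  by (rule ext) (metis mem_qr_f0 qr_s_inject)

lemma qr_f1_inject: "qr_f1 m X = qr_f1 m Y \<Longrightarrow> X = Y"
  by (rule ext) (metis mem_qr_f1 qr_s_inject qr_s_neq_mempty)

text \<open>The empty set belongs to every value of \<open>qr_f1\<close> and to no value of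
  \<open>qr_f0\<close>, because \<open>qr_s\<close> never takes it as a value.\<close>

lemma qr_f0_neq_qr_f1: "qr_f0 m X \<noteq> qr_f1 m Y"
  by (metis mem_qr_f0 mem_qr_f1 qr_s_neq_mempty)

end

text \<open>Closure is asked of the building blocks: the elements of a pair are values of
  \<open>qr_f0\<close> and \<open>qr_f1\<close>, and \<open>eq_iff_D\<close> then handles the pair
  itself.\<close>

locale qr_domain = zf_domain +
  assumes D_qr_s: "D r \<Longrightarrow> D (qr_s m r)"
    and D_qr_f0: "D r \<Longrightarrow> D (qr_f0 m r)"
    and D_qr_f1: "D r \<Longrightarrow> D (qr_f1 m r)"
    and empty_A: "mempty m \<in> A"
begin

lemma dfn_qr_f0:
  assumes "tm A t" "tm A s"
  shows "dfn m D A (\<lambda>e. t e = qr_f0 m (s e))"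
proof (rule dfn_lift2[where P = "\<lambda>x y. x = qr_f0 m y", OF _ assms])
  have "dfn m D A (\<lambda>e. \<forall>t. D t \<longrightarrow> (t \<epsilon> e 0 \<longleftrightarrow> (\<exists>r. r \<epsilon> e 1 \<and> t = qr_s m r)))"
    by (intro dfn_base dfn_qr_s)
  then show "dfn m D A (\<lambda>e. e 0 = qr_f0 m (e 1))"
  proof (rule dfn_cong)
    fix e :: "nat \<Rightarrow> 'a" assume D: "\<And>i. D (e i)"
    then show "(\<forall>t. D t \<longrightarrow> (t \<epsilon> e 0 \<longleftrightarrow> (\<exists>r. r \<epsilon> e 1 \<and> t = qr_s m r))) \<longleftrightarrow> e 0 = qr_f0 m (e 1)"
      using D_trans D_qr_s eq_iff_D[of "e 0" "qr_f0 m (e 1)"] by (auto simp: mem_qr_f0)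
  qed
qed

lemma dfn_qr_f1:
  assumes "tm A t" "tm A s"
  shows "dfn m D A (\<lambda>e. t e = qr_f1 m (s e))"
proof (rule dfn_lift2[where P = "\<lambda>x y. x = qr_f1 m y", OF _ assms])
  have "dfn m D A (\<lambda>e. \<forall>t. D t \<longrightarrow> (t \<epsilon> e 0 \<longleftrightarrow> (\<exists>r. r \<epsilon> e 1 \<and> t = qr_s m r) \<or> t = mempty m))"
    by (intro dfn_base dfn_qr_s empty_A)
  then show "dfn m D A (\<lambda>e. e 0 = qr_f1 m (e 1))"
  proof (rule dfn_cong)
    fix e :: "nat \<Rightarrow> 'a" assume D: "\<And>i. D (e i)"
    then show "(\<forall>t. D t \<longrightarrow> (t \<epsilon> e 0 \<longleftrightarrow> (\<exists>r. r \<epsilon> e 1 \<and> t = qr_s m r) \<or> t = mempty m))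
        \<longleftrightarrow> e 0 = qr_f1 m (e 1)"
      using D_trans D_qr_s A_D[OF empty_A] eq_iff_D[of "e 0" "qr_f1 m (e 1)"] by (auto simp: mem_qr_f1)
  qed
qed

end

context zf begin

interpretation U: qr_domain m "\<lambda>_. True" UNIV
  by unfold_locales auto

lemma mem_qr_pair: "w \<epsilon> qr_pair m x y \<longleftrightarrow>
    (\<exists>u. u \<epsilon> x \<and> w = qr_f0 m u) \<or> (\<exists>v. v \<epsilon> y \<and> w = qr_f1 m v)"
proof -
  have "z \<epsilon> mimage m (qr_f0 m) x \<longleftrightarrow> (\<exists>u. u \<epsilon> x \<and> z = qr_f0 m u)" for z
    by (rule mem_mimage) (intro U.dfn_qr_f0 dfnU_base)
  moreover have "z \<epsilon> mimage m (qr_f1 m) y \<longleftrightarrow> (\<exists>v. v \<epsilon> y \<and> z = qr_f1 m v)" for z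
    by (rule mem_mimage) (intro U.dfn_qr_f1 dfnU_base)
  moreover have "w \<epsilon> qr_pair m x y \<longleftrightarrow> w \<epsilon> mimage m (qr_f0 m) x \<or> w \<epsilon> mimage m (qr_f1 m) y"
    unfolding qr_pair_def by (rule mem_setof) (rule binary_union_ex)
  ultimately show ?thesis by simp
qed

lemma qr_pair_inject [simp]: "qr_pair m x y = qr_pair m x' y' \<longleftrightarrow> x = x' \<and> y = y'"
proof
  assume eq: "qr_pair m x y = qr_pair m x' y'"
  have "u \<epsilon> x \<longleftrightarrow> qr_f0 m u \<epsilon> qr_pair m x y" "u \<epsilon> y \<longleftrightarrow> qr_f1 m u \<epsilon> qr_pair m x y" for u x y
    unfolding mem_qr_pair using qr_f0_inject qr_f1_inject qr_f0_neq_qr_f1 by metis+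
  then show "x = x' \<and> y = y'" using eq ext[of x x'] ext[of y y'] by metis
qed simp

end

context qr_domain begin

lemma dfn_qr_pair:
  assumes "tm A t" "tm A s" "tm A r"
  shows "dfn m D A (\<lambda>e. t e = qr_pair m (s e) (r e))"
proof (rule dfn_lift3[where P = "\<lambda>x y z. x = qr_pair m y z", OF _ assms])
  have "dfn m D A (\<lambda>e. \<forall>w. D w \<longrightarrow> (w \<epsilon> e 0 \<longleftrightarrow>
      (\<exists>u. u \<epsilon> e 1 \<and> w = qr_f0 m u) \<or> (\<exists>v. v \<epsilon> e 2 \<and> w = qr_f1 m v)))"
    by (intro dfn_base dfn_qr_f0 dfn_qr_f1)
  then show "dfn m D A (\<lambda>e. e 0 = qr_pair m (e 1) (e 2))"
  proof (rule dfn_cong)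
    fix e :: "nat \<Rightarrow> 'a" assume D: "\<And>i. D (e i)"
    then have "D z" if "z \<epsilon> qr_pair m (e 1) (e 2)" for z
      using that D_trans D_qr_f0 D_qr_f1 unfolding mem_qr_pair by blast
    then show "(\<forall>w. D w \<longrightarrow> (w \<epsilon> e 0 \<longleftrightarrow>
      (\<exists>u. u \<epsilon> e 1 \<and> w = qr_f0 m u) \<or> (\<exists>v. v \<epsilon> e 2 \<and> w = qr_f1 m v))) \<longleftrightarrow> e 0 = qr_pair m (e 1) (e 2)"
      using D[of 0] eq_iff_D[of "e 0" "qr_pair m (e 1) (e 2)"] unfolding mem_qr_pair by blast
  qed
qed

lemma dfn_qr_pair_mem:
  assumes "tm A t" "tm A s" "tm A r"
  shows "dfn m D A (\<lambda>e. qr_pair m (s e) (r e) \<epsilon> t e)"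
proof (rule dfn_lift3[where P = "\<lambda>x y z. qr_pair m y z \<epsilon> x", OF _ assms])
  have "dfn m D A (\<lambda>e. \<exists>w. w \<epsilon> e 0 \<and> w = qr_pair m (e 1) (e 2))"
    by (intro dfn_base dfn_qr_pair)
  then show "dfn m D A (\<lambda>e. qr_pair m (e 1) (e 2) \<epsilon> e 0)"
    by (rule dfn_cong) blast
qed

end

section \<open>The cumulative hierarchy\<close>

context zf begin

section \<open>The recursion behind \<open>mV\<close>\<close>

lemma dfnU_kpair:
  assumes "tm UNIV t" "tm UNIV s" "tm UNIV r"
  shows "dfnU (\<lambda>e. t e = kpair m (s e) (r e))"
proof (rule U.dfn_lift3[where P = "\<lambda>x y z. x = kpair m y z", OF _ assms])
  have "dfnU (\<lambda>e. \<forall>z. z \<epsilon> e 0 \<longleftrightarrow>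
      (\<forall>w. w \<epsilon> z \<longleftrightarrow> w = e 1) \<or> (\<forall>w. w \<epsilon> z \<longleftrightarrow> w = e 1 \<or> w = e 2))"
    by (intro dfnU_base)
  then show "dfnU (\<lambda>e. e 0 = kpair m (e 1) (e 2))"
  proof (rule dfn_cong)
    fix e :: "nat \<Rightarrow> 'v"
    have s: "(\<forall>w. w \<epsilon> z \<longleftrightarrow> w = x) \<longleftrightarrow> z = setof m (\<lambda>w. w = x)"
      and p: "(\<forall>w. w \<epsilon> z \<longleftrightarrow> w = x \<or> w = y) \<longleftrightarrow> z = setof m (\<lambda>w. w = x \<or> w = y)" for x y z
      using ext[of z "setof m (\<lambda>w. w = x)"] ext[of z "setof m (\<lambda>w. w = x \<or> w = y)"] by auto
    show "(\<forall>z. z \<epsilon> e 0 \<longleftrightarrow>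
      (\<forall>w. w \<epsilon> z \<longleftrightarrow> w = e 1) \<or> (\<forall>w. w \<epsilon> z \<longleftrightarrow> w = e 1 \<or> w = e 2)) \<longleftrightarrow> e 0 = kpair m (e 1) (e 2)"
      unfolding s p mem_kpair[symmetric] using ext[of "e 0" "kpair m (e 1) (e 2)"] by auto
  qed
qed

lemma dfnU_kpair_mem:
  assumes "tm UNIV t" "tm UNIV s" "tm UNIV r"
  shows "dfnU (\<lambda>e. kpair m (s e) (r e) \<epsilon> t e)"
proof (rule U.dfn_lift3[where P = "\<lambda>x y z. kpair m y z \<epsilon> x", OF _ assms])
  have "dfnU (\<lambda>e. \<exists>w. w = kpair m (e 1) (e 2) \<and> w \<epsilon> e 0)"
    by (intro dfnU_base dfnU_kpair)
  then show "dfnU (\<lambda>e. kpair m (e 1) (e 2) \<epsilon> e 0)" by simp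
qed

lemma range_ex: "\<exists>r. \<forall>x y. kpair m x y \<epsilon> f \<longrightarrow> y \<epsilon> r"
proof -
  obtain u where u: "\<And>z. z \<epsilon> u \<longleftrightarrow> (\<exists>y. y \<epsilon> f \<and> z \<epsilon> y)" using union_ex[of f] by blast
  obtain r where r: "\<And>z. z \<epsilon> r \<longleftrightarrow> (\<exists>y. y \<epsilon> u \<and> z \<epsilon> y)" using union_ex[of u] by blast
  have "y \<epsilon> r" if "kpair m x y \<epsilon> f" for x y
    unfolding r u using that
    by (intro exI[of _ "setof m (\<lambda>w. w = x \<or> w = y)"] conjI exI[of _ "kpair m x y"]) (auto simp: mem_kpair)
  then show ?thesis by blast
qed

text \<open>All these \<open>z\<close> are subsets of the union of the range of \<open>f\<close>, so
  a power set bounds them.\<close>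

lemma level_ex: "\<exists>y. \<forall>z. z \<epsilon> y \<longleftrightarrow> (\<exists>\<gamma>. \<gamma> \<epsilon> \<beta> \<and> (\<exists>u. kpair m \<gamma> u \<epsilon> f \<and> msubset m z u))"
proof -
  obtain r where r: "\<And>x y. kpair m x y \<epsilon> f \<Longrightarrow> y \<epsilon> r" using range_ex[of f] by blast
  obtain s where s: "\<And>z. z \<epsilon> s \<longleftrightarrow> (\<exists>y. y \<epsilon> r \<and> z \<epsilon> y)" using union_ex[of r] by blast
  obtain p where p: "\<And>z. z \<epsilon> p \<longleftrightarrow> msubset m z s" using power_ex[of s] by blast
  have "\<exists>y. \<forall>z. z \<epsilon> y \<longleftrightarrow> z \<epsilon> p \<and> (\<exists>\<gamma>. \<gamma> \<epsilon> \<beta> \<and> (\<exists>u. kpair m \<gamma> u \<epsilon> f \<and> msubset m z u))"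
    by (rule separation) (intro dfnU_base dfnU_kpair_mem)
  moreover have "z \<epsilon> p" if "kpair m \<gamma> u \<epsilon> f" "msubset m z u" for z \<gamma> u
    using that r s unfolding p msubset_def by blast
  ultimately show ?thesis by blast
qed

text \<open>The recursion "V_\<gamma> is the union of the power sets of V_\<delta> for \<delta>
  below \<gamma>", for all \<gamma> up to \<beta>. Written without \<open>mapp\<close> and
  \<open>setof\<close>, it is visibly first-order and may enter separation and replacement.\<close>

definition is_rec :: "'v \<Rightarrow> 'v \<Rightarrow> bool" where
  "is_rec f \<beta> \<longleftrightarrow> (\<forall>x y y'. kpair m x y \<epsilon> f \<longrightarrow> kpair m x y' \<epsilon> f \<longrightarrow> y = y') \<and>
    (\<forall>\<gamma>. \<gamma> \<epsilon> \<beta> \<or> \<gamma> = \<beta> \<longrightarrow> (\<exists>y. kpair m \<gamma> y \<epsilon> f \<and>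
      (\<forall>z. z \<epsilon> y \<longleftrightarrow> (\<exists>\<delta>. \<delta> \<epsilon> \<gamma> \<and> (\<exists>u. kpair m \<delta> u \<epsilon> f \<and> msubset m z u)))))"

lemma is_recD:
  assumes "is_rec f \<beta>"
  shows "kpair m x y \<epsilon> f \<Longrightarrow> kpair m x y' \<epsilon> f \<Longrightarrow> y = y'"
    and "\<gamma> \<epsilon> \<beta> \<or> \<gamma> = \<beta> \<Longrightarrow> \<exists>y. kpair m \<gamma> y \<epsilon> f"
    and "\<gamma> \<epsilon> \<beta> \<or> \<gamma> = \<beta> \<Longrightarrow> kpair m \<gamma> y \<epsilon> f \<Longrightarrow>
      z \<epsilon> y \<longleftrightarrow> (\<exists>\<delta>. \<delta> \<epsilon> \<gamma> \<and> (\<exists>u. kpair m \<delta> u \<epsilon> f \<and> msubset m z u))"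
  using assms unfolding is_rec_def by metis+

lemma mV_eq:
  assumes "mordinal m \<alpha>"
  shows "mV m \<alpha> = (THE v. \<exists>f. is_rec f \<alpha> \<and> kpair m \<alpha> v \<epsilon> f)"
proof -
  have tr: "\<delta> \<epsilon> \<alpha> \<or> \<delta> = \<alpha>" if "\<delta> \<epsilon> \<gamma>" "\<gamma> \<epsilon> \<alpha> \<or> \<gamma> = \<alpha>" for \<gamma> \<delta>
    using that assms unfolding mordinal_def mtransitive_def msubset_def by blast
  have "(\<forall>x y y'. kpair m x y \<epsilon> f \<and> kpair m x y' \<epsilon> f \<longrightarrow> y = y') \<and>
      (\<forall>\<beta>. \<beta> \<epsilon> msucc m \<alpha> \<longrightarrow> (\<exists>y. kpair m \<beta> y \<epsilon> f)) \<and>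
      (\<forall>\<beta>. \<beta> \<epsilon> msucc m \<alpha> \<longrightarrow>
          mapp m f \<beta> = setof m (\<lambda>z. \<exists>\<gamma>. \<gamma> \<epsilon> \<beta> \<and> msubset m z (mapp m f \<gamma>))) \<and>
      v = mapp m f \<alpha> \<longleftrightarrow> is_rec f \<alpha> \<and> kpair m \<alpha> v \<epsilon> f" (is "?F \<and> ?T \<and> ?R \<and> ?V \<longleftrightarrow> _") for f v
  \<comment> \<open>\<open>mapp\<close> has its intended meaning only for a functional
    \<open>f\<close> with a value at every point up to \<alpha>. If \<open>f\<close> lacks this,
    both sides are false.\<close>
  proof (cases "?F \<and> ?T")
    case True
    have app: "mapp m f x = y \<longleftrightarrow> kpair m x y \<epsilon> f" if "x \<epsilon> \<alpha> \<or> x = \<alpha>" for x y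
    proof -
      obtain w where w: "kpair m x w \<epsilon> f" using True \<open>x \<epsilon> \<alpha> \<or> x = \<alpha>\<close> by auto
      then have "mapp m f x = w" unfolding mapp_def using True by (intro the_equality) auto
      then show ?thesis using w True by auto
    qed
    have lev: "mapp m f \<beta> = setof m (\<lambda>z. \<exists>\<gamma>. \<gamma> \<epsilon> \<beta> \<and> msubset m z (mapp m f \<gamma>)) \<longleftrightarrow>
      (\<exists>y. kpair m \<beta> y \<epsilon> f \<and> (\<forall>z. z \<epsilon> y \<longleftrightarrow> (\<exists>\<delta>. \<delta> \<epsilon> \<beta> \<and> (\<exists>u. kpair m \<delta> u \<epsilon> f \<and> msubset m z u))))"
      if "\<beta> \<epsilon> \<alpha> \<or> \<beta> = \<alpha>" for \<beta>
    proof -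
      have eq: "(\<exists>\<gamma>. \<gamma> \<epsilon> \<beta> \<and> msubset m z (mapp m f \<gamma>)) \<longleftrightarrow> (\<exists>\<delta>. \<delta> \<epsilon> \<beta> \<and> (\<exists>u. kpair m \<delta> u \<epsilon> f \<and> msubset m z u))" for z
        using app tr \<open>\<beta> \<epsilon> \<alpha> \<or> \<beta> = \<alpha>\<close> by metis
      let ?S = "setof m (\<lambda>z. \<exists>\<gamma>. \<gamma> \<epsilon> \<beta> \<and> msubset m z (mapp m f \<gamma>))"
      have S: "z \<epsilon> ?S \<longleftrightarrow> (\<exists>\<delta>. \<delta> \<epsilon> \<beta> \<and> (\<exists>u. kpair m \<delta> u \<epsilon> f \<and> msubset m z u))" for z
        unfolding eq by (rule mem_setof) (rule level_ex)
      show ?thesis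
      proof
        assume "mapp m f \<beta> = ?S"
        then have "kpair m \<beta> ?S \<epsilon> f" using app[OF that] by blast
        then show "\<exists>y. kpair m \<beta> y \<epsilon> f \<and> (\<forall>z. z \<epsilon> y \<longleftrightarrow> (\<exists>\<delta>. \<delta> \<epsilon> \<beta> \<and> (\<exists>u. kpair m \<delta> u \<epsilon> f \<and> msubset m z u)))"
          using S by blast
      next
        assume "\<exists>y. kpair m \<beta> y \<epsilon> f \<and> (\<forall>z. z \<epsilon> y \<longleftrightarrow> (\<exists>\<delta>. \<delta> \<epsilon> \<beta> \<and> (\<exists>u. kpair m \<delta> u \<epsilon> f \<and> msubset m z u)))"
        then obtain y where y: "kpair m \<beta> y \<epsilon> f"
          "\<And>z. z \<epsilon> y \<longleftrightarrow> (\<exists>\<delta>. \<delta> \<epsilon> \<beta> \<and> (\<exists>u. kpair m \<delta> u \<epsilon> f \<and> msubset m z u))" by blast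
        have "y = ?S" by (rule ext) (simp only: S y(2))
        then show "mapp m f \<beta> = ?S" using y(1) app[OF that] by blast
      qed
    qed
    have "?R \<longleftrightarrow> (\<forall>\<gamma>. \<gamma> \<epsilon> \<alpha> \<or> \<gamma> = \<alpha> \<longrightarrow> (\<exists>y. kpair m \<gamma> y \<epsilon> f \<and>
      (\<forall>z. z \<epsilon> y \<longleftrightarrow> (\<exists>\<delta>. \<delta> \<epsilon> \<gamma> \<and> (\<exists>u. kpair m \<delta> u \<epsilon> f \<and> msubset m z u)))))"
      unfolding mem_msucc by (simp add: lev cong: imp_cong)
    moreover have "?V \<longleftrightarrow> kpair m \<alpha> v \<epsilon> f" using app[of \<alpha> v] by auto
    ultimately show ?thesis using True unfolding is_rec_def by (simp only: simp_thms) blast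
  next
    case False
    then have "\<not> is_rec f \<alpha>" using is_recD(1,2)[of f \<alpha>] unfolding mem_msucc by blast
    then show ?thesis using False by blast
  qed
  then show ?thesis unfolding mV_def by simp
qed

text \<open>At a least argument of disagreement the two relations coincide below, and the recursion
  gives both values the same elements.\<close>

lemma is_rec_unique:
  assumes "mtransitive m \<beta>" "mtransitive m \<beta>'" "is_rec f \<beta>" "is_rec f' \<beta>'"
    and "\<gamma> \<epsilon> \<beta> \<or> \<gamma> = \<beta>" "\<gamma> \<epsilon> \<beta>' \<or> \<gamma> = \<beta>'" "kpair m \<gamma> y \<epsilon> f" "kpair m \<gamma> y' \<epsilon> f'"
  shows "y = y'"
proof (rule ccontr)
  assume "y \<noteq> y'"
  let ?P = "\<lambda>\<gamma>. (\<gamma> \<epsilon> \<beta>' \<or> \<gamma> = \<beta>') \<and> (\<exists>y. kpair m \<gamma> y \<epsilon> f \<and> (\<exists>y'. kpair m \<gamma> y' \<epsilon> f' \<and> y \<noteq> y'))"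
  have "\<exists>z. z \<epsilon> msucc m \<beta> \<and> ?P z \<and> (\<forall>y. y \<epsilon> z \<longrightarrow> y \<epsilon> msucc m \<beta> \<longrightarrow> \<not> ?P y)"
    by (rule least_in[of _ \<gamma>]) (intro dfnU_base dfnU_kpair_mem, use assms \<open>y \<noteq> y'\<close> in auto)
  then obtain \<gamma> where \<gamma>: "\<gamma> \<epsilon> \<beta> \<or> \<gamma> = \<beta>" "?P \<gamma>" "\<And>\<delta>. \<delta> \<epsilon> \<gamma> \<Longrightarrow> \<delta> \<epsilon> msucc m \<beta> \<Longrightarrow> \<not> ?P \<delta>"
    unfolding mem_msucc by blast
  then obtain y y' where y: "kpair m \<gamma> y \<epsilon> f" "kpair m \<gamma> y' \<epsilon> f'" "y \<noteq> y'" and \<gamma>': "\<gamma> \<epsilon> \<beta>' \<or> \<gamma> = \<beta>'" by blast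
  have "kpair m \<delta> u \<epsilon> f \<longleftrightarrow> kpair m \<delta> u \<epsilon> f'" if "\<delta> \<epsilon> \<gamma>" for \<delta> u
  proof -
    have d: "\<delta> \<epsilon> \<beta>" "\<delta> \<epsilon> \<beta>'"
      using that assms(1,2) \<gamma>(1) \<gamma>' unfolding mtransitive_def msubset_def by blast+
    then have "\<not> (\<exists>y. kpair m \<delta> y \<epsilon> f \<and> (\<exists>y'. kpair m \<delta> y' \<epsilon> f' \<and> y \<noteq> y'))" using \<gamma>(3)[OF that] by simp
    then show ?thesis using is_recD(2)[OF assms(3), of \<delta>] is_recD(2)[OF assms(4), of \<delta>] d by metis
  qed
  then have "y = y'"
    using is_recD(3)[OF assms(3) \<gamma>(1) y(1)] is_recD(3)[OF assms(4) \<gamma>' y(2)] by (intro ext) auto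
  then show False using y(3) by simp
qed

lemma dfnU_is_rec: "tm UNIV t \<Longrightarrow> tm UNIV s \<Longrightarrow> dfnU (\<lambda>e. is_rec (t e) (s e))"
  by (rule U.dfn_lift2[where P = is_rec]) (unfold is_rec_def, intro dfnU_base dfnU_kpair_mem)

lemma is_rec_below:
  assumes "is_rec f \<beta>" "mtransitive m \<beta>" "\<gamma> \<epsilon> \<beta>"
  shows "is_rec f \<gamma>"
proof -
  have sub: "\<delta> \<epsilon> \<beta> \<or> \<delta> = \<beta>" if "\<delta> \<epsilon> \<gamma> \<or> \<delta> = \<gamma>" for \<delta>
    using that assms(2,3) unfolding mtransitive_def msubset_def by blast
  have "kpair m x y \<epsilon> f \<Longrightarrow> kpair m x y' \<epsilon> f \<Longrightarrow> y = y'" for x y y'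
    by (rule is_recD(1)[OF assms(1)])
  moreover have "\<exists>y. kpair m \<delta> y \<epsilon> f \<and>
      (\<forall>z. z \<epsilon> y \<longleftrightarrow> (\<exists>\<delta>'. \<delta>' \<epsilon> \<delta> \<and> (\<exists>u. kpair m \<delta>' u \<epsilon> f \<and> msubset m z u)))"
    if "\<delta> \<epsilon> \<gamma> \<or> \<delta> = \<gamma>" for \<delta>
    using assms(1)[unfolded is_rec_def, THEN conjunct2, rule_format, OF sub[OF that]] .
  ultimately show ?thesis unfolding is_rec_def by (intro conjI allI impI)
qed

text \<open>At a least ordinal without an attempt, replacement collects the values computed by
  shorter attempts, and one further pair adds the value on top.\<close>

lemma is_rec_ex:
  assumes "mordinal m \<alpha>"
  shows "\<exists>f. is_rec f \<alpha>"
proof (rule ccontr)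
  assume "\<nexists>f. is_rec f \<alpha>"
  have "\<exists>z. z \<epsilon> msucc m \<alpha> \<and> (\<nexists>f. is_rec f z) \<and> (\<forall>y. y \<epsilon> z \<longrightarrow> y \<epsilon> msucc m \<alpha> \<longrightarrow> \<not> (\<nexists>f. is_rec f y))"
    by (rule least_in[of _ \<alpha>]) (intro dfnU_base dfnU_is_rec, use \<open>\<nexists>f. is_rec f \<alpha>\<close> in auto)
  then obtain \<beta> where \<beta>: "\<beta> \<epsilon> \<alpha> \<or> \<beta> = \<alpha>" "\<nexists>f. is_rec f \<beta>"
    "\<And>\<gamma>. \<gamma> \<epsilon> \<beta> \<Longrightarrow> \<gamma> \<epsilon> msucc m \<alpha> \<Longrightarrow> \<exists>f. is_rec f \<gamma>"
    unfolding mem_msucc by blast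
  have sub: "\<gamma> \<epsilon> \<alpha>" if "\<gamma> \<epsilon> \<beta>" for \<gamma>
    using that \<beta>(1) assms unfolding mordinal_def mtransitive_def msubset_def by blast
  have tr: "mtransitive m \<gamma>" if "\<gamma> \<epsilon> \<beta> \<or> \<gamma> = \<beta>" for \<gamma>
    using that \<beta>(1) sub assms unfolding mordinal_def by blast
  define Val where "Val \<gamma> v \<longleftrightarrow> (\<exists>f. is_rec f \<gamma> \<and> kpair m \<gamma> v \<epsilon> f)" for \<gamma> v
  have Val: "\<exists>!v. Val \<gamma> v" if "\<gamma> \<epsilon> \<beta>" for \<gamma>
  proof (rule ex_ex1I)
    obtain f where "is_rec f \<gamma>" using \<beta>(3) sub \<open>\<gamma> \<epsilon> \<beta>\<close> by auto
    then show "\<exists>v. Val \<gamma> v" unfolding Val_def using is_recD(2) by blast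
    show "v = w" if "Val \<gamma> v" "Val \<gamma> w" for v w
      using that is_rec_unique[of \<gamma> \<gamma> _ _ \<gamma> v w] tr[of \<gamma>] \<open>\<gamma> \<epsilon> \<beta>\<close> unfolding Val_def by blast
  qed
  have "\<exists>g. \<forall>w. w \<epsilon> g \<longleftrightarrow> (\<exists>\<gamma>. \<gamma> \<epsilon> \<beta> \<and> (\<exists>v. Val \<gamma> v \<and> w = kpair m \<gamma> v))"
  proof (rule replacement)
    show "dfnU (\<lambda>e. \<exists>v. Val (e 0) v \<and> e 1 = kpair m (e 0) v)"
      unfolding Val_def by (intro dfnU_base dfnU_is_rec dfnU_kpair_mem dfnU_kpair)
    show "\<exists>!w. \<exists>v. Val \<gamma> v \<and> w = kpair m \<gamma> v" if "\<gamma> \<epsilon> \<beta>" for \<gamma>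
      using Val[OF that] by metis
  qed
  then obtain g where g: "\<And>w. w \<epsilon> g \<longleftrightarrow> (\<exists>\<gamma>. \<gamma> \<epsilon> \<beta> \<and> (\<exists>v. Val \<gamma> v \<and> w = kpair m \<gamma> v))" by blast
  obtain Y where Y: "\<And>z. z \<epsilon> Y \<longleftrightarrow> (\<exists>\<gamma>. \<gamma> \<epsilon> \<beta> \<and> (\<exists>u. kpair m \<gamma> u \<epsilon> g \<and> msubset m z u))"
    using level_ex[of \<beta> g] by blast
  obtain f where f: "\<And>w. w \<epsilon> f \<longleftrightarrow> w \<epsilon> g \<or> w = kpair m \<beta> Y" using insert_ex[of g "kpair m \<beta> Y"] by blast
  have fV: "kpair m \<gamma> v \<epsilon> f \<longleftrightarrow> \<gamma> \<epsilon> \<beta> \<and> Val \<gamma> v \<or> \<gamma> = \<beta> \<and> v = Y" for \<gamma> v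
    unfolding f g by auto
  have "is_rec f \<beta>" unfolding is_rec_def
  proof (intro conjI allI impI)
    show "y = y'" if "kpair m x y \<epsilon> f" "kpair m x y' \<epsilon> f" for x y y'
      using that Val[of x] unfolding fV by auto
    fix \<gamma> assume \<gamma>: "\<gamma> \<epsilon> \<beta> \<or> \<gamma> = \<beta>"
    show "\<exists>y. kpair m \<gamma> y \<epsilon> f \<and> (\<forall>z. z \<epsilon> y \<longleftrightarrow> (\<exists>\<delta>. \<delta> \<epsilon> \<gamma> \<and> (\<exists>u. kpair m \<delta> u \<epsilon> f \<and> msubset m z u)))"
    proof (cases "\<gamma> = \<beta>")
      case True
      have "kpair m \<delta> u \<epsilon> f \<longleftrightarrow> kpair m \<delta> u \<epsilon> g" if "\<delta> \<epsilon> \<beta>" for \<delta> u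
        using that unfolding f by auto
      then show ?thesis using True Y fV by (intro exI[of _ Y]) auto
    next
      case False
      then obtain f' v where f': "is_rec f' \<gamma>" "kpair m \<gamma> v \<epsilon> f'" "Val \<gamma> v"
        using Val[of \<gamma>] \<gamma> unfolding Val_def by blast
      \<comment> \<open>\<open>f\<close> is glued from many attempts. Below \<gamma> it agrees with
        \<open>f'\<close>, because \<open>f'\<close> is itself an attempt at each such \<delta> and
        values are unique.\<close>
      have "kpair m \<delta> u \<epsilon> f \<longleftrightarrow> kpair m \<delta> u \<epsilon> f'" if "\<delta> \<epsilon> \<gamma>" for \<delta> u
      proof -
        have d: "\<delta> \<epsilon> \<beta>" using that \<gamma> False tr[of \<beta>] unfolding mtransitive_def msubset_def by blast
        have "is_rec f' \<delta>" by (rule is_rec_below[OF f'(1) tr[OF \<gamma>] that])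
        then have "kpair m \<delta> w \<epsilon> f' \<Longrightarrow> Val \<delta> w" for w unfolding Val_def by blast
        moreover obtain w where "kpair m \<delta> w \<epsilon> f'" using is_recD(2)[OF f'(1)] \<open>\<delta> \<epsilon> \<gamma>\<close> by blast
        ultimately have "Val \<delta> u \<longleftrightarrow> kpair m \<delta> u \<epsilon> f'" using Val[OF d] by metis
        then show ?thesis unfolding fV using d by auto
      qed
      then show ?thesis using f'(3) False \<gamma> fV is_recD(3)[OF f'(1) _ f'(2)]
        by (intro exI[of _ v]) auto
    qed
  qed
  then show False using \<beta>(2) by blast
qed

text \<open>\<open>L\<close> consists of the levels V_\<gamma> for \<gamma> below \<alpha>. The two
  stated properties are all that is carried on: from here levels take the place of ordinals.\<close>

lemma mV_levels:
  assumes "mordinal m \<alpha>"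
  shows "\<exists>L. (\<forall>z x. z \<epsilon> L \<longrightarrow> (x \<epsilon> z \<longleftrightarrow> (\<exists>y. y \<epsilon> L \<and> y \<epsilon> z \<and> msubset m x y))) \<and>
    (\<forall>x. x \<epsilon> mV m \<alpha> \<longleftrightarrow> (\<exists>y. y \<epsilon> L \<and> msubset m x y))"
proof -
  obtain f where f: "is_rec f \<alpha>" using is_rec_ex[OF assms] by blast
  have tr: "mtransitive m \<alpha>" using assms by (simp add: mordinal_def)
  obtain v where v: "kpair m \<alpha> v \<epsilon> f" using is_recD(2)[OF f] by blast
  have "mV m \<alpha> = v" unfolding mV_eq[OF assms]
  proof (rule the_equality)
    show "\<exists>f. is_rec f \<alpha> \<and> kpair m \<alpha> v \<epsilon> f" using f v by blast
    show "w = v" if "\<exists>f. is_rec f \<alpha> \<and> kpair m \<alpha> w \<epsilon> f" for w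
      using that is_rec_unique[OF tr tr _ f] v by blast
  qed
  obtain r where r: "\<And>x y. kpair m x y \<epsilon> f \<Longrightarrow> y \<epsilon> r" using range_ex[of f] by blast
  have "\<exists>L. \<forall>z. z \<epsilon> L \<longleftrightarrow> z \<epsilon> r \<and> (\<exists>\<gamma>. \<gamma> \<epsilon> \<alpha> \<and> kpair m \<gamma> z \<epsilon> f)"
    by (rule separation) (intro dfnU_base dfnU_kpair_mem)
  then obtain L where L: "\<And>z. z \<epsilon> L \<longleftrightarrow> (\<exists>\<gamma>. \<gamma> \<epsilon> \<alpha> \<and> kpair m \<gamma> z \<epsilon> f)"
    using r by blast
  have "x \<epsilon> z \<longleftrightarrow> (\<exists>y. y \<epsilon> L \<and> y \<epsilon> z \<and> msubset m x y)" if "z \<epsilon> L" for x z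
  proof -
    obtain \<gamma> where \<gamma>: "\<gamma> \<epsilon> \<alpha>" "kpair m \<gamma> z \<epsilon> f" using \<open>z \<epsilon> L\<close> L by blast
    have mem: "w \<epsilon> z \<longleftrightarrow> (\<exists>\<delta>. \<delta> \<epsilon> \<gamma> \<and> (\<exists>u. kpair m \<delta> u \<epsilon> f \<and> msubset m w u))" for w
      using is_recD(3)[OF f _ \<gamma>(2)] \<gamma>(1) by blast
    show ?thesis
    proof
      assume "x \<epsilon> z"
      then obtain \<delta> u where u: "\<delta> \<epsilon> \<gamma>" "kpair m \<delta> u \<epsilon> f" "msubset m x u" using mem by blast
      moreover have "u \<epsilon> z" unfolding mem using u by (auto simp: msubset_def)
      moreover have "u \<epsilon> L" unfolding L using u \<gamma>(1) tr unfolding mtransitive_def msubset_def by blast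
      ultimately show "\<exists>y. y \<epsilon> L \<and> y \<epsilon> z \<and> msubset m x y" by blast
    next
      assume "\<exists>y. y \<epsilon> L \<and> y \<epsilon> z \<and> msubset m x y"
      then show "x \<epsilon> z" unfolding mem msubset_def by blast
    qed
  qed
  moreover have "x \<epsilon> mV m \<alpha> \<longleftrightarrow> (\<exists>y. y \<epsilon> L \<and> msubset m x y)" for x
    unfolding \<open>mV m \<alpha> = v\<close> L using is_recD(3)[OF f _ v] by blast
  ultimately show ?thesis by blast
qed

end

section \<open>Levels in place of ordinals\<close>

lemma msubset_refl [simp]: "msubset m x x"
  by (simp add: msubset_def)

lemma msubset_trans: "msubset m x y \<Longrightarrow> msubset m y z \<Longrightarrow> msubset m x z"
  by (simp add: msubset_def)

text \<open>\<open>W\<close> stands for V_\<alpha> and \<open>L\<close> for the set of levels below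
  it. The first assumption, that a level collects the subsets of the levels in it, makes the levels
  well ordered by membership.\<close>

locale hierarchy = zf m for m :: "'v \<Rightarrow> 'v \<Rightarrow> bool" (infix "\<epsilon>" 50) +
  fixes W L :: 'v
  assumes L_mem: "z \<epsilon> L \<Longrightarrow> x \<epsilon> z \<longleftrightarrow> (\<exists>y. y \<epsilon> L \<and> y \<epsilon> z \<and> msubset m x y)"
    and W_mem: "x \<epsilon> W \<longleftrightarrow> (\<exists>y. y \<epsilon> L \<and> msubset m x y)"
begin

definition inW :: "'v \<Rightarrow> bool" where "inW x \<longleftrightarrow> x \<epsilon> W"

lemma L_inW: "y \<epsilon> L \<Longrightarrow> inW y"
  unfolding inW_def W_mem by (intro exI[of _ y]) simp

lemma L_swelled: "z \<epsilon> L \<Longrightarrow> y \<epsilon> z \<Longrightarrow> msubset m x y \<Longrightarrow> x \<epsilon> z"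
  using L_mem[of z y] L_mem[of z x] msubset_trans[of m x y] by blast

lemma inW_swelled: "inW y \<Longrightarrow> msubset m x y \<Longrightarrow> inW x"
  unfolding inW_def W_mem using msubset_trans[of m x y] by blast

text \<open>In a least level that is not transitive, an element \<open>x\<close> is included in a
  level \<open>w\<close> belonging to it, and \<open>w\<close> is transitive. So each element of
  \<open>x\<close> is a subset of \<open>w\<close> and lies in the given level.\<close>

lemma L_trans:
  assumes "y \<epsilon> x" "x \<epsilon> z" "z \<epsilon> L"
  shows "y \<epsilon> z"
proof (rule ccontr)
  assume "\<not> y \<epsilon> z"
  let ?P = "\<lambda>z. \<exists>x. x \<epsilon> z \<and> (\<exists>y. y \<epsilon> x \<and> \<not> y \<epsilon> z)"
  have "\<exists>z. z \<epsilon> L \<and> ?P z \<and> (\<forall>y. y \<epsilon> z \<longrightarrow> y \<epsilon> L \<longrightarrow> \<not> ?P y)"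
    by (rule least_in[of _ z]) (intro dfnU_base, (use assms \<open>\<not> y \<epsilon> z\<close> in blast)+)
  then obtain z x y where z: "z \<epsilon> L" "\<And>w. w \<epsilon> z \<Longrightarrow> w \<epsilon> L \<Longrightarrow> \<not> ?P w"
    and y: "x \<epsilon> z" "y \<epsilon> x" "\<not> y \<epsilon> z" by blast
  obtain w where w: "w \<epsilon> L" "w \<epsilon> z" "msubset m x w" using L_mem[OF z(1)] y(1) by blast
  have "msubset m y w" using z(2)[OF w(2,1)] w(3) y(2) unfolding msubset_def by blast
  then show False using L_swelled[OF z(1) w(2)] y(3) by blast
qed

lemma L_msubset: "x \<epsilon> z \<Longrightarrow> z \<epsilon> L \<Longrightarrow> msubset m x z"
  unfolding msubset_def using L_trans by blast

lemma inW_trans: "inW y \<Longrightarrow> x \<epsilon> y \<Longrightarrow> inW x"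
  using inW_swelled[of _ x] L_inW L_msubset unfolding inW_def W_mem[of y] msubset_def[of _ y] by blast

text \<open>As for ordinals: take a least \<open>y\<close> incomparable with something, then a least
  \<open>z\<close> incomparable with \<open>y\<close>. They contain the same levels, and a level is
  determined by the levels in it.\<close>

lemma L_linear:
  assumes "y \<epsilon> L" "z \<epsilon> L"
  shows "y \<epsilon> z \<or> y = z \<or> z \<epsilon> y"
proof (rule ccontr)
  let ?Q = "\<lambda>y z. \<not> (y \<epsilon> z \<or> y = z \<or> z \<epsilon> y)"
  assume n: "?Q y z"
  have "\<exists>y. y \<epsilon> L \<and> (\<exists>z. z \<epsilon> L \<and> ?Q y z) \<and> (\<forall>y'. y' \<epsilon> y \<longrightarrow> y' \<epsilon> L \<longrightarrow> \<not> (\<exists>z. z \<epsilon> L \<and> ?Q y' z))"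
    by (rule least_in[of _ y]) (intro dfnU_base, (use assms n in blast)+)
  then obtain y z where y: "y \<epsilon> L" "z \<epsilon> L" "?Q y z"
    "\<And>y' z. y' \<epsilon> y \<Longrightarrow> y' \<epsilon> L \<Longrightarrow> z \<epsilon> L \<Longrightarrow> \<not> ?Q y' z" by blast
  have "\<exists>z. z \<epsilon> L \<and> ?Q y z \<and> (\<forall>z'. z' \<epsilon> z \<longrightarrow> z' \<epsilon> L \<longrightarrow> \<not> ?Q y z')"
    by (rule least_in[of _ z]) (intro dfnU_base, (use y in blast)+)
  then obtain z where z: "z \<epsilon> L" "?Q y z" "\<And>z'. z' \<epsilon> z \<Longrightarrow> z' \<epsilon> L \<Longrightarrow> \<not> ?Q y z'" by blast
  have "u \<epsilon> y \<longleftrightarrow> u \<epsilon> z" if "u \<epsilon> L" for u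
    using y(4)[of u z] z(3)[of u] L_trans[of z u y] L_trans[of y u z] that y(1) z(1,2) by blast
  then have "y = z" using L_mem[OF y(1)] L_mem[OF z(1)] by (intro ext) blast
  then show False using z(2) by blast
qed

lemma L_not_mem: "y \<epsilon> L \<Longrightarrow> z \<epsilon> L \<Longrightarrow> \<not> y \<epsilon> z \<longleftrightarrow> msubset m z y"
  using L_linear[of y z] L_msubset[of z y] unfolding msubset_def by auto

text \<open>\<open>z\<close> turns out to be the least level that contains every member of
  \<open>S\<close>. This is how a history is seen to produce levels.\<close>

lemma L_sup:
  assumes "\<And>u. u \<epsilon> S \<Longrightarrow> u \<epsilon> L" and "inW z"
    and z: "\<And>x. inW x \<Longrightarrow> x \<epsilon> z \<longleftrightarrow> (\<exists>u. u \<epsilon> S \<and> msubset m x u)"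
  shows "z \<epsilon> L"
proof -
  obtain w where w: "w \<epsilon> L" "msubset m z w" using assms(2) unfolding inW_def W_mem by blast
  have "u \<epsilon> w" if "u \<epsilon> S" for u
    using that z[OF L_inW[OF assms(1)[OF that]]] w(2) msubset_refl[of m u] unfolding msubset_def by blast
  then have "\<exists>v. v \<epsilon> L \<and> (\<forall>u. u \<epsilon> S \<longrightarrow> u \<epsilon> v) \<and> (\<forall>v'. v' \<epsilon> v \<longrightarrow> v' \<epsilon> L \<longrightarrow> \<not> (\<forall>u. u \<epsilon> S \<longrightarrow> u \<epsilon> v'))"
    by (intro least_in[of "\<lambda>v. \<forall>u. u \<epsilon> S \<longrightarrow> u \<epsilon> v", OF _ w(1)] dfnU_base) blast
  then obtain v where v: "v \<epsilon> L" "\<And>u. u \<epsilon> S \<Longrightarrow> u \<epsilon> v"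
    "\<And>v'. v' \<epsilon> v \<Longrightarrow> v' \<epsilon> L \<Longrightarrow> \<exists>u. u \<epsilon> S \<and> \<not> u \<epsilon> v'" by blast
  have "z = v"
  proof (rule ext)
    fix x show "x \<epsilon> z \<longleftrightarrow> x \<epsilon> v"
    proof
      assume "x \<epsilon> z"
      then obtain u where "u \<epsilon> S" "msubset m x u" using z inW_trans[OF assms(2)] by blast
      then show "x \<epsilon> v" using L_swelled[OF v(1)] v(2) by blast
    next
      assume x: "x \<epsilon> v"
      then obtain w where w: "w \<epsilon> L" "w \<epsilon> v" "msubset m x w" using L_mem[OF v(1)] by blast
      then obtain u where u: "u \<epsilon> S" "\<not> u \<epsilon> w" using v(3) by blast
      then have "msubset m w u" using L_not_mem assms(1) w(1) by blast
      then show "x \<epsilon> z" using z[OF inW_trans[OF L_inW[OF v(1)] x]] u(1) w(3) msubset_trans[of m x w u] by blast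
    qed
  qed
  then show ?thesis using v(1) by simp
qed

text \<open>The levels below a level form a history in the sense of Scott and Potter; this makes
  being a level first-order definable over \<open>W\<close>.\<close>

lemma L_iff_history:
  assumes "inW z"
  shows "z \<epsilon> L \<longleftrightarrow> (\<exists>h. inW h \<and>
    (\<forall>y. y \<epsilon> h \<longrightarrow> (\<forall>x. inW x \<longrightarrow> (x \<epsilon> y \<longleftrightarrow> (\<exists>u. u \<epsilon> h \<and> u \<epsilon> y \<and> msubset m x u)))) \<and>
    (\<forall>x. inW x \<longrightarrow> (x \<epsilon> z \<longleftrightarrow> (\<exists>u. u \<epsilon> h \<and> msubset m x u))))"
proof
  assume z: "z \<epsilon> L"
  have "\<exists>h. \<forall>y. y \<epsilon> h \<longleftrightarrow> y \<epsilon> z \<and> y \<epsilon> L"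
    by (rule separation) (intro dfnU_base)
  then obtain h where h: "\<And>y. y \<epsilon> h \<longleftrightarrow> y \<epsilon> z \<and> y \<epsilon> L" by blast
  have "inW h" using inW_swelled[OF assms, of h] h unfolding msubset_def by blast
  moreover have "x \<epsilon> y \<longleftrightarrow> (\<exists>u. u \<epsilon> h \<and> u \<epsilon> y \<and> msubset m x u)" if "y \<epsilon> h" for x y
    using that h[of y] L_mem[of y x] L_trans[of _ y z] z unfolding h by blast
  moreover have "x \<epsilon> z \<longleftrightarrow> (\<exists>u. u \<epsilon> h \<and> msubset m x u)" for x
    unfolding h using L_mem[OF z] by blast
  ultimately show "\<exists>h. inW h \<and>
    (\<forall>y. y \<epsilon> h \<longrightarrow> (\<forall>x. inW x \<longrightarrow> (x \<epsilon> y \<longleftrightarrow> (\<exists>u. u \<epsilon> h \<and> u \<epsilon> y \<and> msubset m x u)))) \<and>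
    (\<forall>x. inW x \<longrightarrow> (x \<epsilon> z \<longleftrightarrow> (\<exists>u. u \<epsilon> h \<and> msubset m x u)))" by blast
next
  assume "\<exists>h. inW h \<and>
    (\<forall>y. y \<epsilon> h \<longrightarrow> (\<forall>x. inW x \<longrightarrow> (x \<epsilon> y \<longleftrightarrow> (\<exists>u. u \<epsilon> h \<and> u \<epsilon> y \<and> msubset m x u)))) \<and>
    (\<forall>x. inW x \<longrightarrow> (x \<epsilon> z \<longleftrightarrow> (\<exists>u. u \<epsilon> h \<and> msubset m x u)))"
  then obtain h where h: "inW h"
    "\<And>y x. y \<epsilon> h \<Longrightarrow> inW x \<Longrightarrow> x \<epsilon> y \<longleftrightarrow> (\<exists>u. u \<epsilon> h \<and> u \<epsilon> y \<and> msubset m x u)"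
    "\<And>x. inW x \<Longrightarrow> x \<epsilon> z \<longleftrightarrow> (\<exists>u. u \<epsilon> h \<and> msubset m x u)" by blast
  have "y \<epsilon> L" if "y \<epsilon> h" for y
  proof (rule ccontr)
    assume "\<not> y \<epsilon> L"
    \<comment> \<open>For a least member of \<open>h\<close> that is not a level, those of its
      elements that belong to \<open>h\<close> are levels, so \<open>L_sup\<close> makes it a level
      after all.\<close>
    have "\<exists>y. y \<epsilon> h \<and> \<not> y \<epsilon> L \<and> (\<forall>u. u \<epsilon> y \<longrightarrow> u \<epsilon> h \<longrightarrow> \<not> \<not> u \<epsilon> L)"
      by (rule least_in[of "\<lambda>y. \<not> y \<epsilon> L", OF _ \<open>y \<epsilon> h\<close> \<open>\<not> y \<epsilon> L\<close>]) (intro dfnU_base)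
    then obtain y where y: "y \<epsilon> h" "\<not> y \<epsilon> L" "\<And>u. u \<epsilon> y \<Longrightarrow> u \<epsilon> h \<Longrightarrow> u \<epsilon> L" by blast
    have "\<exists>S. \<forall>u. u \<epsilon> S \<longleftrightarrow> u \<epsilon> h \<and> u \<epsilon> y"
      by (rule separation) (intro dfnU_base)
    then obtain S where S: "\<And>u. u \<epsilon> S \<longleftrightarrow> u \<epsilon> h \<and> u \<epsilon> y" by blast
    have "y \<epsilon> L"
      by (rule L_sup[of S]) (use S y(3) h(2)[OF y(1)] inW_trans[OF h(1) y(1)] in auto)
    then show False using y(2) by blast
  qed
  then show "z \<epsilon> L" by (rule L_sup[of h]) (use assms h(3) in auto)
qed

lemma transitive_domain_inW: "(\<And>c. c \<in> A \<Longrightarrow> inW c) \<Longrightarrow> transitive_domain m inW A"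
  by unfold_locales (auto intro: inW_trans)

lemma dfn_L:
  assumes "\<And>c. c \<in> A \<Longrightarrow> inW c" "tm A t"
  shows "dfn m inW A (\<lambda>e. t e \<epsilon> L)"
proof -
  interpret transitive_domain m inW A using assms(1) by (rule transitive_domain_inW)
  show ?thesis
  proof (rule dfn_lift1[where P = "\<lambda>x. x \<epsilon> L", OF _ assms(2)])
    have "dfn m inW A (\<lambda>e. \<exists>h. inW h \<and>
      (\<forall>y. y \<epsilon> h \<longrightarrow> (\<forall>x. inW x \<longrightarrow> (x \<epsilon> y \<longleftrightarrow> (\<exists>u. u \<epsilon> h \<and> u \<epsilon> y \<and> msubset m x u)))) \<and>
      (\<forall>x. inW x \<longrightarrow> (x \<epsilon> e 0 \<longleftrightarrow> (\<exists>u. u \<epsilon> h \<and> msubset m x u))))"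
      by (intro dfn_base dfn_msubset)
    then show "dfn m inW A (\<lambda>e. e 0 \<epsilon> L)"
      by (rule dfn_cong) (simp add: L_iff_history)
  qed
qed

text \<open>The formula over \<open>W\<close> is relativized, with \<open>W\<close> as one more
  parameter, so that separation in the model applies. The result lies in \<open>W\<close> because
  \<open>W\<close> contains the subsets of its elements.\<close>

lemma separation_W:
  assumes P: "dfn m inW {c. inW c} (\<lambda>e. P (e 0))" and b: "inW b"
  shows "\<exists>S. inW S \<and> (\<forall>z. z \<epsilon> S \<longleftrightarrow> z \<epsilon> b \<and> P z)"
proof -
  obtain \<psi> c where \<psi>: "\<And>z. inW z \<Longrightarrow> sat m inW \<psi> (case_nat z c) \<longleftrightarrow> P z"
    using P b by (rule dfn_unary_formula) blast
  obtain \<chi> where \<chi>: "\<And>e. sat m (\<lambda>_. True) \<chi> e = sat m (\<lambda>x. x \<epsilon> e 0) \<psi> (\<lambda>n. e (Suc n))"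
    using sat_relativize[of m \<psi>] by blast
  let ?e = "\<lambda>z. case_nat W (case_nat z c)"
  define \<sigma> :: "nat \<Rightarrow> (nat \<Rightarrow> 'v) \<Rightarrow> 'v" where
    "\<sigma> n = (case n of 0 \<Rightarrow> (\<lambda>e. W) | Suc 0 \<Rightarrow> (\<lambda>e. e 0) | Suc (Suc k) \<Rightarrow> (\<lambda>e. c k))" for n
  have "tm UNIV (\<sigma> n)" for n unfolding \<sigma>_def tm_def by (auto split: nat.split)
  then have "dfnU (\<lambda>e. sat m (\<lambda>_. True) \<chi> (\<lambda>n. \<sigma> n e))" by (rule dfn_sat)
  moreover have "(\<lambda>n. \<sigma> n e) = ?e (e 0)" for e unfolding \<sigma>_def by (auto split: nat.split)
  ultimately have "dfnU (\<lambda>e. sat m (\<lambda>_. True) \<chi> (?e (e 0)))" by simp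
  then have "\<exists>S. \<forall>z. z \<epsilon> S \<longleftrightarrow> z \<epsilon> b \<and> sat m (\<lambda>_. True) \<chi> (?e z)"
    by (rule separation[where P = "\<lambda>z. sat m (\<lambda>_. True) \<chi> (?e z)"])
  moreover have "sat m (\<lambda>_. True) \<chi> (?e z) \<longleftrightarrow> P z" if "z \<epsilon> b" for z
  proof -
    have "inW = (\<lambda>x. x \<epsilon> W)" by (auto simp: inW_def)
    then show ?thesis using \<psi>[OF inW_trans[OF b that]] by (simp add: \<chi>)
  qed
  ultimately obtain S where S: "\<And>z. z \<epsilon> S \<longleftrightarrow> z \<epsilon> b \<and> P z" by blast
  then have "inW S" using inW_swelled[OF b, of S] unfolding msubset_def by blast
  then show ?thesis using S by blast
qed

text \<open>\<open>L\<close> need not be an element of \<open>W\<close>, so separation is applied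
  inside \<open>z\<close>; if no earlier level satisfies \<open>P\<close>, then \<open>z\<close>
  itself is minimal.\<close>

lemma least_level:
  assumes P: "dfn m inW {c. inW c} (\<lambda>e. P (e 0))" and z: "z \<epsilon> L" "P z"
  shows "\<exists>z. z \<epsilon> L \<and> P z \<and> (\<forall>y. y \<epsilon> z \<longrightarrow> y \<epsilon> L \<longrightarrow> \<not> P y)"
proof -
  have "dfn m inW {c. inW c} (\<lambda>e. e 0 \<epsilon> L \<and> P (e 0))"
    by (rule dfn_conj[OF dfn_L P]) (simp, rule tm_var)
  then have "\<exists>S. inW S \<and> (\<forall>y. y \<epsilon> S \<longleftrightarrow> y \<epsilon> z \<and> y \<epsilon> L \<and> P y)"
    using L_inW[OF z(1)] by (rule separation_W)
  then obtain S where S: "\<And>y. y \<epsilon> S \<longleftrightarrow> y \<epsilon> z \<and> y \<epsilon> L \<and> P y" by blast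
  show ?thesis
  proof (cases "\<exists>y. y \<epsilon> S")
    case True
    then obtain y where "y \<epsilon> S" "\<And>x. x \<epsilon> y \<Longrightarrow> \<not> x \<epsilon> S" using foundation by blast
    then show ?thesis using S L_trans z(1) by blast
  next
    case False
    then show ?thesis using S z by blast
  qed
qed

interpretation U: qr_domain m "\<lambda>_. True" UNIV
  by unfold_locales auto

text \<open>Going back from the pair to \<open>y\<close> undoes \<open>qr_f1\<close> and
  \<open>qr_s\<close>, and neither step raises the level. So a level that includes \<open>a\<close>
  bounds every section of \<open>a\<close>.\<close>

lemma qr_pair_mem_level:
  assumes "qr_pair m x y \<epsilon> v" "v \<epsilon> L"
  shows "y \<epsilon> v"
proof -
  obtain w where w: "w \<epsilon> L" "w \<epsilon> v" "msubset m (qr_pair m x y) w" using L_mem assms by blast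
  have "u \<epsilon> w" if "u \<epsilon> y" for u
  proof -
    have "qr_f1 m u \<epsilon> w" using w(3) that unfolding msubset_def mem_qr_pair by blast
    then obtain w' where w': "w' \<epsilon> L" "w' \<epsilon> w" "msubset m (qr_f1 m u) w'" using L_mem[OF w(1)] by blast
    have "r \<epsilon> w'" if "r \<epsilon> u" for r
    proof -
      have "qr_s m r \<epsilon> w'" using w'(3) that unfolding msubset_def mem_qr_f1 by blast
      then show ?thesis using L_trans[of r "msucc m r" w'] w'(1) by (auto simp: qr_s_def split: if_splits)
    qed
    then have "msubset m u w'" by (simp add: msubset_def)
    then show ?thesis using L_swelled[OF w(1) w'(2)] by blast
  qed
  then have "msubset m y w" by (simp add: msubset_def)
  then show ?thesis using L_swelled[OF assms(2) w(2)] by blast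
qed

lemma qr_sec:
  assumes "inW a"
  shows "y \<epsilon> qr_sec m a x \<longleftrightarrow> qr_pair m x y \<epsilon> a" and "inW (qr_sec m a x)"
proof -
  obtain v where v: "v \<epsilon> L" "msubset m a v" using assms unfolding inW_def W_mem by blast
  have bd: "y \<epsilon> v" if "qr_pair m x y \<epsilon> a" for y
    using that v qr_pair_mem_level unfolding msubset_def by blast
  have mem: "y \<epsilon> qr_sec m a x \<longleftrightarrow> qr_pair m x y \<epsilon> a" for y
    unfolding qr_sec_def by (rule mem_setof_bounded[OF _ bd]) (intro dfnU_base U.dfn_qr_pair_mem)
  then show "y \<epsilon> qr_sec m a x \<longleftrightarrow> qr_pair m x y \<epsilon> a" .
  show "inW (qr_sec m a x)"
    by (rule inW_swelled[OF L_inW[OF v(1)]]) (auto simp: msubset_def mem bd)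
qed

lemma mem_qr_fam:
  assumes "inW a"
  shows "z \<epsilon> qr_fam m a b \<longleftrightarrow> (\<exists>x. x \<epsilon> b \<and> z = qr_sec m a x)"
  unfolding qr_fam_def
proof (rule mem_mimage)
  have "dfnU (\<lambda>e. \<forall>y. y \<epsilon> e 1 \<longleftrightarrow> qr_pair m (e 0) y \<epsilon> a)"
    by (intro dfnU_base U.dfn_qr_pair_mem)
  then show "dfnU (\<lambda>e. e 1 = qr_sec m a (e 0))"
  proof (rule dfn_cong)
    fix e :: "nat \<Rightarrow> 'v"
    show "(\<forall>y. y \<epsilon> e 1 \<longleftrightarrow> qr_pair m (e 0) y \<epsilon> a) \<longleftrightarrow> e 1 = qr_sec m a (e 0)"
      using qr_sec(1)[OF assms] ext[of "e 1" "qr_sec m a (e 0)"] by auto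
  qed
qed

end

section \<open>The critical level of a definable embedding\<close>

lemma (in zf) nat_cases:
  assumes "n \<epsilon> momega m"
  shows "n = mempty m \<or> (\<exists>k. k \<epsilon> momega m \<and> n = msucc m k)"
proof -
  have "dfnU (\<lambda>e. e 0 = mempty m \<or> (\<exists>k. k \<epsilon> momega m \<and> e 0 = msucc m k))"
    by (intro dfnU_base dfnU_msucc)
  from this assms show ?thesis by (rule momega_induct) auto
qed

text \<open>The situation to be refuted, without the origin of \<open>p\<close>. Definability of
  \<open>j\<close> is what lets separation over \<open>W\<close> mention \<open>j\<close>.\<close>

locale definable_embedding = hierarchy m W L
  for m :: "'v \<Rightarrow> 'v \<Rightarrow> bool" (infix "\<epsilon>" 50) and W L +
  fixes j :: "'v \<Rightarrow> 'v" and \<phi> :: form and p :: 'v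
  assumes j_inW: "inW x \<Longrightarrow> inW (j x)"
    and j_elementary: "(\<And>i. inW (e i)) \<Longrightarrow> sat m inW \<psi> e \<longleftrightarrow> sat m inW \<psi> (j \<circ> e)"
    and p_inW: "inW p"
    and j_defined: "inW u \<Longrightarrow> inW w \<Longrightarrow> j u = w \<longleftrightarrow> sat m inW \<phi> ((\<lambda>_. p)(0 := u, 1 := w))"
    and j_nontrivial: "\<exists>x. inW x \<and> j x \<noteq> x"
begin

text \<open>Two parameter sets are kept apart: formulas transferred along \<open>j\<close> take
  their parameters from \<open>FixW\<close>, while separation over \<open>W\<close> may use any in
  \<open>AllW\<close>.\<close>

definition FixW :: "'v set" where "FixW = {c. inW c \<and> j c = c}"

abbreviation AllW :: "'v set" where "AllW \<equiv> {c. inW c}"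

sublocale F: transitive_domain m inW FixW
  by (rule transitive_domain_inW) (simp add: FixW_def)

sublocale P: transitive_domain m inW AllW
  by (rule transitive_domain_inW) simp

lemma dfn_L_Fix: "tm FixW t \<Longrightarrow> dfn m inW FixW (\<lambda>e. t e \<epsilon> L)"
  by (rule dfn_L; simp add: FixW_def)

lemma transfer4:
  assumes "dfn m inW FixW (\<lambda>e. P (e 0) (e 1) (e 2) (e 3))" and "inW x" "inW y" "inW z" "inW w"
  shows "P x y z w \<longleftrightarrow> P (j x) (j y) (j z) (j w)"
proof -
  let ?e = "\<lambda>i::nat. if i = 0 then x else if i = 1 then y else if i = 2 then z else w"
  have "P (?e 0) (?e 1) (?e 2) (?e 3) \<longleftrightarrow> P (j (?e 0)) (j (?e 1)) (j (?e 2)) (j (?e 3))"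
    by (rule dfn_elementary[OF assms(1) _ _ j_elementary j_inW, of ?e])
      (use assms(2-) in \<open>simp_all add: FixW_def\<close>)
  then show ?thesis by simp
qed

lemma transfer3:
  assumes "dfn m inW FixW (\<lambda>e. P (e 0) (e 1) (e 2))" and "inW x" "inW y" "inW z"
  shows "P x y z \<longleftrightarrow> P (j x) (j y) (j z)"
  using transfer4[of "\<lambda>x y z _. P x y z" x y z z] assms by simp

lemma transfer2:
  assumes "dfn m inW FixW (\<lambda>e. P (e 0) (e 1))" and "inW x" "inW y"
  shows "P x y \<longleftrightarrow> P (j x) (j y)"
  using transfer4[of "\<lambda>x y _ _. P x y" x y y y] assms by simp

lemma transfer1:
  assumes "dfn m inW FixW (\<lambda>e. P (e 0))" and "inW x"
  shows "P x \<longleftrightarrow> P (j x)"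
  using transfer4[of "\<lambda>x _ _ _. P x" x x x x] assms by simp

section \<open>Elementarity and the least moved level\<close>

lemma j_mem: "inW x \<Longrightarrow> inW y \<Longrightarrow> j x \<epsilon> j y \<longleftrightarrow> x \<epsilon> y"
  by (rule transfer2[of "\<lambda>x y. x \<epsilon> y", symmetric]) (intro F.dfn_base)

lemma j_inject: "inW x \<Longrightarrow> inW y \<Longrightarrow> j x = j y \<longleftrightarrow> x = y"
  by (rule transfer2[of "\<lambda>x y. x = y", symmetric]) (intro F.dfn_base)

lemma j_msubset: "inW x \<Longrightarrow> inW y \<Longrightarrow> msubset m (j x) (j y) \<longleftrightarrow> msubset m x y"
  by (rule transfer2[of "\<lambda>x y. msubset m x y", symmetric]) (intro F.dfn_base F.dfn_msubset)

lemma j_L: "inW x \<Longrightarrow> j x \<epsilon> L \<longleftrightarrow> x \<epsilon> L"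
  by (rule transfer1[of "\<lambda>x. x \<epsilon> L", symmetric]) (intro F.dfn_base dfn_L_Fix)

text \<open>The defining formula of \<open>j\<close> with its parameter left open, so that other
  sections can be put in place of \<open>p\<close>.\<close>

definition Phi :: "'v \<Rightarrow> 'v \<Rightarrow> 'v \<Rightarrow> bool" where
  "Phi u w q \<longleftrightarrow> sat m inW \<phi> ((\<lambda>_. q)(0 := u, 1 := w))"

lemma dfn_Phi:
  assumes "tm A t" "tm A s" "tm A r"
  shows "dfn m inW A (\<lambda>e. Phi (t e) (s e) (r e))"
proof -
  have "(\<lambda>_. r e)(0 := t e, 1 := s e) = (\<lambda>n::nat. (if n = 0 then t else if n = 1 then s else r) e)"
    for e :: "nat \<Rightarrow> 'v" by auto
  then show ?thesis
    using dfn_sat[of A "\<lambda>n. if n = 0 then t else if n = 1 then s else r" m inW \<phi>] assms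
    unfolding Phi_def by simp
qed

lemma dfn_j:
  assumes "tm AllW t" "tm AllW s"
  shows "dfn m inW AllW (\<lambda>e. j (t e) = s e)"
proof (rule P.dfn_lift2[where P = "\<lambda>x y. j x = y", OF _ assms])
  have "dfn m inW AllW (\<lambda>e. Phi (e 0) (e 1) p)"
    by (intro dfn_Phi tm_var tm_const) (simp add: p_inW)
  then show "dfn m inW AllW (\<lambda>e. j (e 0) = e 1)"
    by (rule dfn_cong) (simp add: Phi_def j_defined)
qed

text \<open>In a least level \<open>v\<close> with a moved subset \<open>x\<close>, all elements of
  \<open>v\<close> are fixed, being subsets of earlier levels. Since \<open>j x\<close> is again a
  subset of \<open>v\<close>, it has the same elements as \<open>x\<close>.\<close>

lemma j_fixed:
  assumes "\<nu> \<epsilon> L" and fixed: "\<And>v. v \<epsilon> L \<Longrightarrow> v \<epsilon> \<nu> \<or> v = \<nu> \<Longrightarrow> j v = v" and x: "msubset m x \<nu>"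
  shows "j x = x"
proof (rule ccontr)
  assume "j x \<noteq> x"
  let ?P = "\<lambda>v. (v \<epsilon> \<nu> \<or> v = \<nu>) \<and> (\<exists>x. inW x \<and> msubset m x v \<and> \<not> j x = x)"
  have "dfn m inW AllW (\<lambda>e. ?P (e 0))"
    by (intro P.dfn_base P.dfn_msubset dfn_j) (simp_all add: L_inW assms(1))
  moreover have "?P \<nu>" using x \<open>j x \<noteq> x\<close> inW_swelled[OF L_inW[OF assms(1)]] by blast
  ultimately have "\<exists>z. z \<epsilon> L \<and> ?P z \<and> (\<forall>y. y \<epsilon> z \<longrightarrow> y \<epsilon> L \<longrightarrow> \<not> ?P y)"
    using assms(1) by (intro least_level[where P = ?P])
  then obtain v x where v: "v \<epsilon> L" "v \<epsilon> \<nu> \<or> v = \<nu>" "\<And>w. w \<epsilon> v \<Longrightarrow> w \<epsilon> L \<Longrightarrow> \<not> ?P w"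
    and x: "inW x" "msubset m x v" "j x \<noteq> x" by blast
  have sub: "msubset m (j x) v"
    using j_msubset[OF x(1) L_inW[OF v(1)]] fixed[OF v(1,2)] x(2) by simp
  have "j y = y" "inW y" if "y \<epsilon> v" for y
  proof -
    show "inW y" using inW_trans[OF L_inW[OF v(1)] that] .
    obtain w where w: "w \<epsilon> L" "w \<epsilon> v" "msubset m y w" using L_mem[OF v(1)] \<open>y \<epsilon> v\<close> by blast
    moreover have "w \<epsilon> \<nu>" using L_trans[OF w(2) _ assms(1)] v(2) w(2) by blast
    ultimately show "j y = y" using v(3)[OF w(2,1)] \<open>inW y\<close> by blast
  qed
  then have "y \<epsilon> j x \<longleftrightarrow> y \<epsilon> x" if "y \<epsilon> v" for y
    using j_mem[of y x] x(1) that by metis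
  then have "j x = x" using sub x(2) unfolding msubset_def by (intro ext) blast
  then show False using x(3) by simp
qed

lemma critical_level_ex: "\<exists>\<kappa>. \<kappa> \<epsilon> L \<and> \<not> j \<kappa> = \<kappa> \<and> (\<forall>y. y \<epsilon> \<kappa> \<longrightarrow> y \<epsilon> L \<longrightarrow> \<not> \<not> j y = y)"
proof -
  obtain x \<nu> where x: "j x \<noteq> x" "\<nu> \<epsilon> L" "msubset m x \<nu>"
    using j_nontrivial unfolding inW_def W_mem by blast
  then obtain v where v: "v \<epsilon> L" "\<not> j v = v" using j_fixed by blast
  have "dfn m inW AllW (\<lambda>e. \<not> j (e 0) = e 0)" by (intro P.dfn_base dfn_j)
  from this v show ?thesis by (rule least_level)
qed

text \<open>The first level moved by \<open>j\<close>; it plays the part of V at the critical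
  point.\<close>

definition \<kappa> :: 'v where
  "\<kappa> = (SOME \<kappa>. \<kappa> \<epsilon> L \<and> \<not> j \<kappa> = \<kappa> \<and> (\<forall>y. y \<epsilon> \<kappa> \<longrightarrow> y \<epsilon> L \<longrightarrow> \<not> \<not> j y = y))"

lemma \<kappa>_L: "\<kappa> \<epsilon> L" and \<kappa>_moved: "j \<kappa> \<noteq> \<kappa>" and below_\<kappa>: "y \<epsilon> \<kappa> \<Longrightarrow> y \<epsilon> L \<Longrightarrow> j y = y"
  using someI_ex[OF critical_level_ex] unfolding \<kappa>_def[symmetric] by auto

lemmas \<kappa>_inW = L_inW[OF \<kappa>_L]

text \<open>\<open>j \<kappa>\<close> is a level other than \<open>\<kappa>\<close>. If it were
  below \<open>\<kappa>\<close>, it would be fixed, and injectivity of \<open>j\<close> would give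
  \<open>j \<kappa> = \<kappa>\<close>.\<close>

lemma \<kappa>_mem_j: "\<kappa> \<epsilon> j \<kappa>"
proof -
  have L: "j \<kappa> \<epsilon> L" using j_L \<kappa>_inW \<kappa>_L by blast
  then have "\<not> j \<kappa> \<epsilon> \<kappa>" using below_\<kappa> j_inject \<kappa>_inW j_inW \<kappa>_moved by metis
  then show ?thesis using L_linear[OF \<kappa>_L L] \<kappa>_moved by auto
qed

lemma mem_\<kappa>_fixed:
  assumes "x \<epsilon> \<kappa>"
  shows "j x = x"
proof -
  obtain \<nu> where \<nu>: "\<nu> \<epsilon> L" "\<nu> \<epsilon> \<kappa>" "msubset m x \<nu>" using L_mem[OF \<kappa>_L] assms by blast
  show ?thesis
    by (rule j_fixed[OF \<nu>(1) _ \<nu>(3)]) (use \<nu>(2) below_\<kappa> L_trans \<kappa>_L in blast)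
qed

lemma mempty_\<kappa>: "mempty m \<epsilon> \<kappa>"
proof (rule ccontr)
  assume "\<not> mempty m \<epsilon> \<kappa>"
  then have "\<not> x \<epsilon> \<kappa>" for x using L_swelled[OF \<kappa>_L, of x "mempty m"] by (auto simp: msubset_def)
  moreover have "(\<forall>x. inW x \<longrightarrow> \<not> x \<epsilon> \<kappa>) \<longleftrightarrow> (\<forall>x. inW x \<longrightarrow> \<not> x \<epsilon> j \<kappa>)"
    by (rule transfer1[of "\<lambda>k. \<forall>x. inW x \<longrightarrow> \<not> x \<epsilon> k"]) (intro F.dfn_base, rule \<kappa>_inW)
  ultimately show False using \<kappa>_mem_j \<kappa>_inW by blast
qed

text \<open>\<open>\<kappa>\<close> is a limit of levels. Otherwise it would be the power set of a
  fixed \<open>\<nu>\<close>; elementarity would make \<open>j \<kappa>\<close> the same power set,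
  and \<open>\<kappa> \<epsilon> j \<kappa>\<close> would put \<open>\<nu>\<close> into
  itself.\<close>

lemma power_\<kappa>:
  assumes "\<nu> \<epsilon> L" "\<nu> \<epsilon> \<kappa>"
  obtains v where "v \<epsilon> L" "v \<epsilon> \<kappa>" "\<And>x. x \<epsilon> v \<longleftrightarrow> msubset m x \<nu>"
proof -
  have "dfn m inW AllW (\<lambda>e. \<nu> \<epsilon> e 0)"
    by (intro P.dfn_base) (simp add: L_inW assms(1))
  then have "\<exists>v. v \<epsilon> L \<and> \<nu> \<epsilon> v \<and> (\<forall>y. y \<epsilon> v \<longrightarrow> y \<epsilon> L \<longrightarrow> \<not> \<nu> \<epsilon> y)"
    using \<kappa>_L assms(2) by (rule least_level)
  then obtain v where v: "v \<epsilon> L" "\<nu> \<epsilon> v" "\<And>y. y \<epsilon> v \<Longrightarrow> y \<epsilon> L \<Longrightarrow> \<not> \<nu> \<epsilon> y" by blast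
  have mem: "x \<epsilon> v \<longleftrightarrow> msubset m x \<nu>" for x
  proof
    assume "x \<epsilon> v"
    then obtain w where w: "w \<epsilon> L" "w \<epsilon> v" "msubset m x w" using L_mem[OF v(1)] by blast
    then have "msubset m w \<nu>" using v(3) L_not_mem[OF assms(1)] by blast
    then show "msubset m x \<nu>" using w(3) by (rule msubset_trans[rotated])
  next
    assume "msubset m x \<nu>"
    then show "x \<epsilon> v" using L_swelled[OF v(1,2)] by blast
  qed
  have "v \<noteq> \<kappa>"
  proof
    assume "v = \<kappa>"
    have "(\<forall>x. inW x \<longrightarrow> (x \<epsilon> \<kappa> \<longleftrightarrow> msubset m x \<nu>)) \<longleftrightarrow> (\<forall>x. inW x \<longrightarrow> (x \<epsilon> j \<kappa> \<longleftrightarrow> msubset m x (j \<nu>)))"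
      by (rule transfer2[of "\<lambda>k \<nu>. \<forall>x. inW x \<longrightarrow> (x \<epsilon> k \<longleftrightarrow> msubset m x \<nu>)"])
        (intro F.dfn_base F.dfn_msubset, rule \<kappa>_inW, rule L_inW, rule assms(1))
    then have "\<kappa> \<epsilon> j \<kappa> \<longleftrightarrow> msubset m \<kappa> \<nu>"
      using mem \<open>v = \<kappa>\<close> below_\<kappa> assms \<kappa>_inW by simp
    then have "\<nu> \<epsilon> \<nu>" using \<kappa>_mem_j assms(2) unfolding msubset_def by blast
    then show False by simp
  qed
  then have "v \<epsilon> \<kappa>" using L_linear[OF v(1) \<kappa>_L] v(3) \<kappa>_L assms(2) by blast
  then show ?thesis using that v(1) mem by blast
qed

text \<open>Consequently \<omega> of the model is included in \<open>\<kappa>\<close>, belongs to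
  \<open>W\<close> and is fixed pointwise: a nontrivial \<open>j\<close> forces \<alpha> beyond
  \<omega>.\<close>

lemma minductive_\<kappa>: "minductive m \<kappa>"
  unfolding minductive_def
proof (intro conjI allI impI)
  show "mempty m \<epsilon> \<kappa>" by (rule mempty_\<kappa>)
  fix u assume "u \<epsilon> \<kappa>"
  then obtain \<nu> where \<nu>: "\<nu> \<epsilon> L" "\<nu> \<epsilon> \<kappa>" "msubset m u \<nu>" using L_mem[OF \<kappa>_L] by blast
  obtain v where v: "v \<epsilon> L" "v \<epsilon> \<kappa>" "\<And>x. x \<epsilon> v \<longleftrightarrow> msubset m x \<nu>" using power_\<kappa>[OF \<nu>(1,2)] by blast
  have "msubset m (msucc m u) v"
    using \<nu>(3) v(3) L_msubset[OF _ \<nu>(1)] unfolding msubset_def[of _ "msucc m u"] msubset_def[of _ u]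
    by (auto simp: msubset_def)
  then show "msucc m u \<epsilon> \<kappa>" using L_swelled[OF \<kappa>_L v(2)] by blast
qed

lemma momega_\<kappa>: "n \<epsilon> momega m \<Longrightarrow> n \<epsilon> \<kappa>"
  using momega_least minductive_\<kappa> unfolding msubset_def by blast

lemma momega_inW: "inW (momega m)"
  using inW_swelled[OF \<kappa>_inW] momega_\<kappa> by (auto simp: msubset_def)

lemma nat_fixed: "n \<epsilon> momega m \<Longrightarrow> j n = n"
  using mem_\<kappa>_fixed momega_\<kappa> by blast

lemma mempty_Fix: "mempty m \<in> FixW"
  using nat_fixed inW_trans[OF momega_inW] by (simp add: FixW_def)

lemma momega_Fix: "momega m \<in> FixW"
proof -
  \<comment> \<open>Every element is empty or the successor of an element. This passes to
    \<open>j (momega m)\<close>, and by foundation such a set has no element outside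
    \<omega>.\<close>
  let ?Q = "\<lambda>w. \<forall>x. x \<epsilon> w \<longrightarrow> x = mempty m \<or> (\<exists>y. y \<epsilon> w \<and> (\<forall>z. inW z \<longrightarrow> (z \<epsilon> x \<longleftrightarrow> z \<epsilon> y \<or> z = y)))"
  have "?Q (momega m)" using nat_cases by fastforce
  moreover have "?Q (momega m) \<longleftrightarrow> ?Q (j (momega m))"
    by (rule transfer1[where P = ?Q]) (intro F.dfn_base mempty_Fix, rule momega_inW)
  ultimately have Q: "?Q (j (momega m))" by simp
  have "x \<epsilon> momega m" if "x \<epsilon> j (momega m)" for x
  proof (rule ccontr)
    assume "\<not> x \<epsilon> momega m"
    have "\<exists>x. x \<epsilon> j (momega m) \<and> \<not> x \<epsilon> momega m \<and> (\<forall>y. y \<epsilon> x \<longrightarrow> y \<epsilon> j (momega m) \<longrightarrow> \<not> \<not> y \<epsilon> momega m)"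
      using _ \<open>x \<epsilon> j (momega m)\<close> \<open>\<not> x \<epsilon> momega m\<close> by (rule least_in) (intro dfnU_base)
    then obtain x where x: "x \<epsilon> j (momega m)" "\<not> x \<epsilon> momega m"
      "\<And>y. y \<epsilon> x \<Longrightarrow> y \<epsilon> j (momega m) \<Longrightarrow> y \<epsilon> momega m" by blast
    have "x \<noteq> mempty m" using x(2) by auto
    then obtain y where y: "y \<epsilon> j (momega m)" "\<And>z. inW z \<Longrightarrow> z \<epsilon> x \<longleftrightarrow> z \<epsilon> y \<or> z = y"
      using Q x(1) by blast
    have W: "inW (j (momega m))" by (rule j_inW[OF momega_inW])
    have "x = msucc m y"
      using y(2) inW_trans[OF W] inW_trans x(1) y(1) by (intro ext) (metis mem_msucc)
    moreover have "y \<epsilon> momega m" using x(3)[of y] y(1) \<open>x = msucc m y\<close> by simp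
    ultimately show False using x(2) msucc_momega by blast
  qed
  moreover have "x \<epsilon> j (momega m)" if "x \<epsilon> momega m" for x
    using j_mem[OF inW_trans[OF momega_inW that] momega_inW] that nat_fixed[OF that] by simp
  ultimately have "j (momega m) = momega m" by (intro ext) blast
  then show ?thesis using momega_inW by (simp add: FixW_def)
qed

section \<open>Closure of the upper levels under Quine-Rosser pairs\<close>

lemma qr_s_level: "t \<epsilon> v \<Longrightarrow> v \<epsilon> L \<Longrightarrow> msubset m (qr_s m t) v"
  unfolding qr_s_def using L_msubset[of t v] by (auto simp: msubset_def)

text \<open>A level not below \<open>\<kappa>\<close> includes \<open>\<kappa>\<close> and hence
  \<omega>, so adding one to natural numbers does not lead out of it.\<close>

lemma qr_s_above: "t \<epsilon> v \<Longrightarrow> v \<epsilon> L \<Longrightarrow> \<not> v \<epsilon> \<kappa> \<Longrightarrow> qr_s m t \<epsilon> v"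
  unfolding qr_s_def using momega_\<kappa> msucc_momega L_not_mem[OF _ \<kappa>_L] by (auto simp: msubset_def)

lemma mempty_above: "v \<epsilon> L \<Longrightarrow> \<not> v \<epsilon> \<kappa> \<Longrightarrow> mempty m \<epsilon> v"
  using mempty_\<kappa> L_not_mem[OF _ \<kappa>_L] by (auto simp: msubset_def)

text \<open>\<open>u\<close> is included in a level \<open>w\<close> in \<open>v\<close>. If
  \<open>w\<close> is below \<open>\<kappa>\<close>, then \<open>z\<close> is included in the power
  set of \<open>w\<close>, which is still below \<open>\<kappa>\<close>. Otherwise
  \<open>qr_s\<close> maps \<open>w\<close> into itself and \<open>z\<close> is a subset of
  \<open>w\<close>.\<close>

lemma qr_image_level:
  assumes v: "v \<epsilon> L" "\<not> v \<epsilon> \<kappa>" and u: "u \<epsilon> v"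
    and z: "\<And>t. t \<epsilon> z \<Longrightarrow> t = mempty m \<or> (\<exists>r. r \<epsilon> u \<and> t = qr_s m r)"
  shows "z \<epsilon> v"
proof -
  obtain w where w: "w \<epsilon> L" "w \<epsilon> v" "msubset m u w" using L_mem[OF v(1)] u by blast
  show ?thesis
  proof (cases "w \<epsilon> \<kappa>")
    case True
    obtain v' where v': "v' \<epsilon> L" "v' \<epsilon> \<kappa>" "\<And>x. x \<epsilon> v' \<longleftrightarrow> msubset m x w" using power_\<kappa>[OF w(1) True] by blast
    have "t \<epsilon> v'" if "t \<epsilon> z" for t
      using z[OF that] w(3) qr_s_level[OF _ w(1)] unfolding v'(3) by (auto simp: msubset_def)
    then have "msubset m z v'" by (simp add: msubset_def)
    then have "z \<epsilon> \<kappa>" using L_swelled[OF \<kappa>_L v'(2)] by blast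
    then show ?thesis using L_not_mem[OF v(1) \<kappa>_L] v(2) by (simp add: msubset_def)
  next
    case False
    have "t \<epsilon> w" if "t \<epsilon> z" for t
      using z[OF that] w(3) qr_s_above[OF _ w(1) False] mempty_above[OF w(1) False]
      by (auto simp: msubset_def)
    then have "msubset m z w" by (simp add: msubset_def)
    then show ?thesis using L_swelled[OF v(1) w(2)] by blast
  qed
qed

lemma qr_f_level:
  assumes "v \<epsilon> L" "\<not> v \<epsilon> \<kappa>" "u \<epsilon> v"
  shows "qr_f0 m u \<epsilon> v" "qr_f1 m u \<epsilon> v"
  by (rule qr_image_level[OF assms]; auto simp: mem_qr_f0 mem_qr_f1)+

lemma level_above:
  assumes "inW u"
  obtains w where "w \<epsilon> L" "\<not> w \<epsilon> \<kappa>" "msubset m u w"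
proof -
  obtain w where w: "w \<epsilon> L" "msubset m u w" using assms unfolding inW_def W_mem by blast
  show ?thesis
  proof (cases "w \<epsilon> \<kappa>")
    case True
    then show ?thesis
      using that[OF \<kappa>_L] w(2) L_msubset[OF True \<kappa>_L] msubset_trans[of m u w \<kappa>] by simp
  next
    case False
    then show ?thesis using that w by blast
  qed
qed

lemma qr_inW:
  assumes "inW u"
  shows "inW (qr_s m u)" "inW (qr_f0 m u)" "inW (qr_f1 m u)"
proof -
  obtain w where w: "w \<epsilon> L" "\<not> w \<epsilon> \<kappa>" "msubset m u w" using level_above[OF assms] by blast
  have "msubset m (qr_f0 m u) w" "msubset m (qr_f1 m u) w"
    using w(3) qr_s_above[OF _ w(1,2)] mempty_above[OF w(1,2)]
    by (auto simp: msubset_def mem_qr_f0 mem_qr_f1)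
  then show "inW (qr_f0 m u)" "inW (qr_f1 m u)" using inW_swelled L_inW[OF w(1)] by blast+
  show "inW (qr_s m u)"
    unfolding qr_s_def using assms inW_trans[OF momega_inW msucc_momega] by simp
qed

text \<open>The flatness that Kuratowski pairs lack: a pair of elements of \<open>v\<close> stays in
  \<open>v\<close> even if \<open>v\<close> is a successor level. Below \<open>\<kappa>\<close> two
  power sets leave enough room.\<close>

lemma qr_pair_level:
  assumes v: "v \<epsilon> L" "\<not> v \<epsilon> \<kappa>" and "x \<epsilon> v" "y \<epsilon> v"
  shows "qr_pair m x y \<epsilon> v"
proof -
  obtain w1 where w1: "w1 \<epsilon> L" "w1 \<epsilon> v" "msubset m x w1" using L_mem[OF v(1)] assms(3) by blast
  obtain w2 where w2: "w2 \<epsilon> L" "w2 \<epsilon> v" "msubset m y w2" using L_mem[OF v(1)] assms(4) by blast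
  obtain w where w: "w \<epsilon> L" "w \<epsilon> v" "msubset m x w" "msubset m y w"
  proof (cases "w1 \<epsilon> w2")
    case True
    then show ?thesis
      using that[OF w2(1,2) _ w2(3)] L_msubset[OF True w2(1)] w1(3) msubset_trans[of m x w1 w2] by blast
  next
    case False
    then show ?thesis
      using that[OF w1(1,2,3)] L_not_mem[OF w1(1) w2(1)] w2(3) msubset_trans[of m y w2 w1] by blast
  qed
  show ?thesis
  proof (cases "w \<epsilon> \<kappa>")
    case True
    obtain v1 where v1: "v1 \<epsilon> L" "v1 \<epsilon> \<kappa>" "\<And>x. x \<epsilon> v1 \<longleftrightarrow> msubset m x w" using power_\<kappa>[OF w(1) True] by blast
    obtain v2 where v2: "v2 \<epsilon> L" "v2 \<epsilon> \<kappa>" "\<And>x. x \<epsilon> v2 \<longleftrightarrow> msubset m x v1" using power_\<kappa>[OF v1(1,2)] by blast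
    have s: "qr_s m r \<epsilon> v1" if "r \<epsilon> u" "u \<epsilon> w" for r u
      using qr_s_level[OF L_trans[OF that w(1)] w(1)] v1(3) by blast
    have e: "mempty m \<epsilon> v1" unfolding v1(3) by (simp add: msubset_def)
    have "qr_f0 m u \<epsilon> v2" "qr_f1 m u \<epsilon> v2" if "u \<epsilon> w" for u
      unfolding v2(3) using s[OF _ that] e by (auto simp: msubset_def mem_qr_f0 mem_qr_f1)
    then have "msubset m (qr_pair m x y) v2"
      using w(3,4) by (auto simp: msubset_def mem_qr_pair)
    then have "qr_pair m x y \<epsilon> \<kappa>" using L_swelled[OF \<kappa>_L v2(2)] by blast
    then show ?thesis using L_not_mem[OF v(1) \<kappa>_L] v(2) by (simp add: msubset_def)
  next
    case False
    have "msubset m (qr_pair m x y) w"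
      using w(3,4) qr_f_level[OF w(1) False] by (auto simp: msubset_def mem_qr_pair)
    then show ?thesis using L_swelled[OF v(1) w(2)] by blast
  qed
qed

lemma qr_domain_W: "FixW \<subseteq> A \<Longrightarrow> A \<subseteq> AllW \<Longrightarrow> qr_domain m inW A"
  using momega_Fix mempty_Fix by unfold_locales (auto intro: inW_trans qr_inW)

end

section \<open>Sequences coded by Quine--Rosser pairs\<close>

context definable_embedding begin

sublocale FQ: qr_domain m inW FixW
  by (rule qr_domain_W) (auto simp: FixW_def)

sublocale PQ: qr_domain m inW AllW
  by (rule qr_domain_W) (auto simp: FixW_def)

lemma lift_All4:
  assumes "dfn m inW FixW (\<lambda>e. P (e 0) (e 1) (e 2) (e 3))"
    and "tm AllW t0" "tm AllW t1" "tm AllW t2" "tm AllW t3"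
  shows "dfn m inW AllW (\<lambda>e. P (t0 e) (t1 e) (t2 e) (t3 e))"
  by (rule P.dfn_lift4[OF dfn_mono[OF assms(1)] assms(2-)]) (auto simp: FixW_def)

lemma lift_All3:
  assumes "dfn m inW FixW (\<lambda>e. P (e 0) (e 1) (e 2))" and "tm AllW t0" "tm AllW t1" "tm AllW t2"
  shows "dfn m inW AllW (\<lambda>e. P (t0 e) (t1 e) (t2 e))"
  by (rule P.dfn_lift3[OF dfn_mono[OF assms(1)] assms(2-)]) (auto simp: FixW_def)

lemma lift_All2:
  assumes "dfn m inW FixW (\<lambda>e. P (e 0) (e 1))" and "tm AllW t0" "tm AllW t1"
  shows "dfn m inW AllW (\<lambda>e. P (t0 e) (t1 e))"
  by (rule P.dfn_lift2[OF dfn_mono[OF assms(1)] assms(2-)]) (auto simp: FixW_def)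

lemma dfn_msucc_All:
  assumes "tm AllW t" "tm AllW s"
  shows "dfn m inW AllW (\<lambda>e. t e = msucc m (s e))"
proof (rule P.dfn_lift2[where P = "\<lambda>x y. x = msucc m y", OF _ assms])
  have "dfn m inW AllW (\<lambda>e. \<forall>z. inW z \<longrightarrow> (z \<epsilon> e 0 \<longleftrightarrow> z \<epsilon> e 1 \<or> z = e 1))"
    by (intro P.dfn_base)
  then show "dfn m inW AllW (\<lambda>e. e 0 = msucc m (e 1))"
  proof (rule dfn_cong)
    fix e :: "nat \<Rightarrow> 'v" assume "\<And>i. inW (e i)"
    then show "(\<forall>z. inW z \<longrightarrow> (z \<epsilon> e 0 \<longleftrightarrow> z \<epsilon> e 1 \<or> z = e 1)) \<longleftrightarrow> e 0 = msucc m (e 1)"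
      using inW_trans PQ.eq_iff_D[of "e 0" "msucc m (e 1)"] by auto
  qed
qed

lemma momega_induct_W:
  assumes "dfn m inW AllW (\<lambda>e. P (e 0))" and "n \<epsilon> momega m"
    and "P (mempty m)" and "\<And>n. n \<epsilon> momega m \<Longrightarrow> P n \<Longrightarrow> P (msucc m n)"
  shows "P n"
proof -
  obtain S where S: "\<And>z. z \<epsilon> S \<longleftrightarrow> z \<epsilon> momega m \<and> P z"
    using separation_W[OF assms(1) momega_inW] by blast
  have "n \<epsilon> S" by (rule momega_induct_set) (use S assms msucc_momega in auto)
  then show ?thesis using S by blast
qed

text \<open>The section of \<open>a\<close> at \<open>x\<close>, expressed by quantifiers over
  \<open>W\<close>. With natural numbers for \<open>x\<close>, the same formula reads
  \<open>a\<close> as a sequence of sets.\<close>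

definition Sec :: "'v \<Rightarrow> 'v \<Rightarrow> 'v \<Rightarrow> bool" where
  "Sec a x q \<longleftrightarrow> (\<forall>y. inW y \<longrightarrow> (y \<epsilon> q \<longleftrightarrow> qr_pair m x y \<epsilon> a))"

lemma dfn_Sec0: "dfn m inW FixW (\<lambda>e. Sec (e 0) (e 1) (e 2))"
  unfolding Sec_def by (intro F.dfn_base FQ.dfn_qr_pair_mem)

lemmas dfn_Sec_F = F.dfn_lift3[where P = Sec, OF dfn_Sec0]
  and dfn_Sec = lift_All3[where P = Sec, OF dfn_Sec0]

lemma Sec_unique: "inW q \<Longrightarrow> inW q' \<Longrightarrow> Sec a x q \<Longrightarrow> Sec a x q' \<Longrightarrow> q = q'"
  unfolding Sec_def using inW_trans by (intro ext) blast

text \<open>Flatness keeps all pairs of a natural number and an element of \<open>b\<close> inside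
  one level \<open>v\<close>, so \<open>T\<close> is a subset of \<open>v\<close> and an element of
  \<open>W\<close>, also when \<alpha> is a successor.\<close>

lemma code_relation:
  assumes M: "dfn m inW AllW (\<lambda>e. M (e 0) (e 1))" and b: "inW b"
  shows "\<exists>T. inW T \<and> (\<forall>k y. qr_pair m k y \<epsilon> T \<longleftrightarrow> k \<epsilon> momega m \<and> y \<epsilon> b \<and> M k y)"
proof -
  obtain v where v: "v \<epsilon> L" "\<not> v \<epsilon> \<kappa>" "msubset m b v" using level_above[OF b] by blast
  have pair: "qr_pair m k y \<epsilon> v" if "k \<epsilon> momega m" "y \<epsilon> b" for k y
    using that v qr_pair_level[OF v(1,2)] momega_\<kappa> L_not_mem[OF v(1) \<kappa>_L] unfolding msubset_def by blast
  have "dfn m inW AllW (\<lambda>e. \<exists>k. k \<epsilon> momega m \<and> (\<exists>y. y \<epsilon> b \<and> e 0 = qr_pair m k y \<and> M k y))"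
    by (intro P.dfn_base PQ.dfn_qr_pair P.dfn_lift2[where P = M, OF M]) (simp_all add: momega_inW b)
  then have "\<exists>T. inW T \<and> (\<forall>z. z \<epsilon> T \<longleftrightarrow> z \<epsilon> v \<and>
      (\<exists>k. k \<epsilon> momega m \<and> (\<exists>y. y \<epsilon> b \<and> z = qr_pair m k y \<and> M k y)))"
    using L_inW[OF v(1)] by (rule separation_W)
  then obtain T where T: "inW T" "\<And>z. z \<epsilon> T \<longleftrightarrow> z \<epsilon> v \<and>
      (\<exists>k. k \<epsilon> momega m \<and> (\<exists>y. y \<epsilon> b \<and> z = qr_pair m k y \<and> M k y))" by blast
  have "qr_pair m k y \<epsilon> T \<longleftrightarrow> k \<epsilon> momega m \<and> y \<epsilon> b \<and> M k y" for k y
    unfolding T(2) using pair by auto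
  then show ?thesis using T(1) by blast
qed

text \<open>Recursion along \<omega> for a step \<open>G\<close> that is given by a definition over
  \<open>W\<close>. Attempts are coded relations between \<omega> and \<open>b\<close>, hence
  elements of \<open>W\<close>, and quantifying over them is first-order over
  \<open>W\<close>.\<close>

lemma sequence_ex:
  assumes G: "dfn m inW AllW (\<lambda>e. G (e 0) (e 1))" and b: "inW b" and B0: "msubset m B0 b"
    and step: "\<And>X. msubset m X b \<Longrightarrow> \<exists>Y. msubset m Y b \<and> G X Y"
    and unique: "\<And>X Y Y'. inW Y \<Longrightarrow> inW Y' \<Longrightarrow> G X Y \<Longrightarrow> G X Y' \<Longrightarrow> Y = Y'"
  shows "\<exists>T. inW T \<and> Sec T (mempty m) B0 \<and>
    (\<forall>k. k \<epsilon> momega m \<longrightarrow> (\<exists>X Y. msubset m X b \<and> msubset m Y b \<and> Sec T k X \<and> Sec T (msucc m k) Y \<and> G X Y))"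
proof -
  note sub = inW_swelled[OF b]
  \<comment> \<open>The successor of \<open>k\<close> is named by a quantified \<open>s\<close>,
    since formulas over \<open>W\<close> have no term for it; \<open>StepI\<close> and
    \<open>StepD\<close> remove it again.\<close>
  define Step where "Step T k \<longleftrightarrow> (\<exists>X. inW X \<and> (\<exists>Y. inW Y \<and> (\<exists>s. inW s \<and> s = msucc m k \<and>
    msubset m X b \<and> msubset m Y b \<and> Sec T k X \<and> Sec T s Y \<and> G X Y)))" for T k
  \<comment> \<open>Only the entries from 0 to \<open>n\<close> are constrained; later ones are
    arbitrary.\<close>
  define Att where "Att T n \<longleftrightarrow> Sec T (mempty m) B0 \<and> (\<forall>k. k \<epsilon> n \<longrightarrow> Step T k)" for T n
  have sW: "inW (msucc m k)" if "k \<epsilon> momega m" for k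
    using inW_trans[OF momega_inW msucc_momega[OF that]] .
  have StepI: "Step T k" if "k \<epsilon> momega m" "msubset m X b" "msubset m Y b" "Sec T k X" "Sec T (msucc m k) Y" "G X Y" for T k X Y
    unfolding Step_def using that sub sW[OF that(1)] by blast
  have StepD: "\<exists>X Y. msubset m X b \<and> msubset m Y b \<and> Sec T k X \<and> Sec T (msucc m k) Y \<and> G X Y" if "Step T k" for T k
    using that unfolding Step_def by blast
  have dfn_G: "tm AllW t \<Longrightarrow> tm AllW s \<Longrightarrow> dfn m inW AllW (\<lambda>e. G (t e) (s e))" for t s
    by (rule P.dfn_lift2[where P = G, OF G])
  have "dfn m inW AllW (\<lambda>e. Step (e 0) (e 1))"
    unfolding Step_def by (intro P.dfn_base P.dfn_msubset dfn_msucc_All dfn_Sec dfn_G) (simp_all add: b)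
  then have dfn_Step: "tm AllW t \<Longrightarrow> tm AllW s \<Longrightarrow> dfn m inW AllW (\<lambda>e. Step (t e) (s e))" for t s
    by (rule P.dfn_lift2[where P = Step])
  have "dfn m inW AllW (\<lambda>e. Att (e 0) (e 1))"
    unfolding Att_def using inW_trans[OF momega_inW mempty_momega] sub[OF B0]
    by (intro P.dfn_base dfn_Step dfn_Sec) simp_all
  then have dfn_Att: "tm AllW t \<Longrightarrow> tm AllW s \<Longrightarrow> dfn m inW AllW (\<lambda>e. Att (t e) (s e))" for t s
    by (rule P.dfn_lift2[where P = Att])
  have agree: "\<exists>X. msubset m X b \<and> Sec T k X \<and> Sec T' k X"
    if T: "inW T" "inW T'" "Att T n" "Att T' n'" and n: "n \<epsilon> momega m" "n' \<epsilon> momega m"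
      and k: "k \<epsilon> momega m" "k \<epsilon> msucc m n" "k \<epsilon> msucc m n'" for T T' n n' k
  proof -
    let ?P = "\<lambda>k. k \<epsilon> msucc m n \<and> k \<epsilon> msucc m n' \<longrightarrow> (\<exists>X. inW X \<and> msubset m X b \<and> Sec T k X \<and> Sec T' k X)"
    have "dfn m inW AllW (\<lambda>e. ?P (e 0))"
      by (intro P.dfn_base dfn_Sec P.dfn_msubset) (simp_all add: b T sW n)
    then have "?P k" using k(1)
    proof (rule momega_induct_W[where P = ?P])
      show "?P (mempty m)" using T(3,4) B0 sub[OF B0] unfolding Att_def by blast
      fix k assume "k \<epsilon> momega m" and IH: "?P k"
      show "?P (msucc m k)"
      proof
        assume s: "msucc m k \<epsilon> msucc m n \<and> msucc m k \<epsilon> msucc m n'"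
        have "k \<epsilon> n'" if "msucc m k \<epsilon> msucc m n'" "n' \<epsilon> momega m" for n'
          using that nat_trans[of k "msucc m k" n'] by auto
        then have kn: "k \<epsilon> n" "k \<epsilon> n'" using s n by blast+
        then obtain X where X: "inW X" "Sec T k X" "Sec T' k X" using IH by auto
        obtain X1 Y1 where 1: "msubset m X1 b" "msubset m Y1 b" "Sec T k X1" "Sec T (msucc m k) Y1" "G X1 Y1"
          using T(3) kn(1) StepD unfolding Att_def by blast
        obtain X2 Y2 where 2: "msubset m X2 b" "msubset m Y2 b" "Sec T' k X2" "Sec T' (msucc m k) Y2" "G X2 Y2"
          using T(4) kn(2) StepD unfolding Att_def by blast
        have "X1 = X" "X2 = X"
          using Sec_unique[OF sub[OF 1(1)] X(1) 1(3) X(2)] Sec_unique[OF sub[OF 2(1)] X(1) 2(3) X(3)] by auto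
        then have "Y1 = Y2" using unique[OF sub[OF 1(2)] sub[OF 2(2)]] 1(5) 2(5) by blast
        then show "\<exists>X. inW X \<and> msubset m X b \<and> Sec T (msucc m k) X \<and> Sec T' (msucc m k) X"
          using 1(2,4) 2(4) sub[OF 1(2)] by blast
      qed
    qed
    then show ?thesis using k(2,3) by blast
  qed
  have att_ex: "\<exists>T. inW T \<and> Att T n" if "n \<epsilon> momega m" for n
  proof -
    have "dfn m inW AllW (\<lambda>e. \<exists>T. inW T \<and> Att T (e 0))" by (intro P.dfn_base dfn_Att)
    from this that show ?thesis
    proof (rule momega_induct_W[where P = "\<lambda>n. \<exists>T. inW T \<and> Att T n"])
      \<comment> \<open>The constant sequence with entry \<open>B0\<close> is an attempt of length
        0.\<close>
      have "dfn m inW AllW (\<lambda>e. e 1 \<epsilon> B0)" using sub[OF B0] by (intro P.dfn_base) simp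
      then obtain T where "inW T" "\<And>k y. qr_pair m k y \<epsilon> T \<longleftrightarrow> k \<epsilon> momega m \<and> y \<epsilon> b \<and> y \<epsilon> B0"
        using code_relation[where M = "\<lambda>k y. y \<epsilon> B0", OF _ b] by blast
      then have "inW T \<and> Att T (mempty m)" using B0 unfolding Att_def Sec_def msubset_def by auto
      then show "\<exists>T. inW T \<and> Att T (mempty m)" by blast
    next
      fix n assume n: "n \<epsilon> momega m" and "\<exists>T. inW T \<and> Att T n"
      then obtain T where T: "inW T" "Att T n" by blast
      obtain X where X: "msubset m X b" "Sec T n X" using agree[OF T(1,1,2,2) n n n] by auto
      obtain Y where Y: "msubset m Y b" "G X Y" using step[OF X(1)] by blast
      let ?M = "\<lambda>k y. k \<epsilon> msucc m n \<and> qr_pair m k y \<epsilon> T \<or> k = msucc m n \<and> y \<epsilon> Y"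
      have "dfn m inW AllW (\<lambda>e. ?M (e 0) (e 1))"
        by (intro P.dfn_base PQ.dfn_qr_pair_mem) (simp_all add: T sW n sub[OF Y(1)])
      then obtain T' where T': "inW T'" "\<And>k y. qr_pair m k y \<epsilon> T' \<longleftrightarrow> k \<epsilon> momega m \<and> y \<epsilon> b \<and> ?M k y"
        using code_relation[where M = ?M, OF _ b] by blast
      have old: "Sec T' k Z" if "k \<epsilon> msucc m n" "Sec T k Z" "msubset m Z b" for k Z
        using that momega_trans[OF _ msucc_momega[OF n], of k] mem_irrefl[of "msucc m n"]
        unfolding Sec_def T'(2) msubset_def by metis
      have new: "Sec T' (msucc m n) Y"
        using Y(1) msucc_momega[OF n] unfolding Sec_def T'(2) msubset_def by auto
      have "Step T' k" if "k \<epsilon> msucc m n" for k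
      proof (cases "k = n")
        case True
        then show ?thesis using StepI[OF n X(1) Y(1) old[OF _ X(2,1)] new Y(2)] by simp
      next
        case False
        then have k: "k \<epsilon> n" using that by simp
        have s: "msucc m k \<epsilon> msucc m n"
        proof -
          have "dfnU (\<lambda>e. \<forall>k. k \<epsilon> e 0 \<longrightarrow> (\<exists>s. s = msucc m k \<and> (s \<epsilon> e 0 \<or> s = e 0)))"
            by (intro dfnU_base dfnU_msucc)
          from this n have "\<forall>k. k \<epsilon> n \<longrightarrow> (\<exists>s. s = msucc m k \<and> (s \<epsilon> n \<or> s = n))"
            by (rule momega_induct) auto
          then show ?thesis using k by auto
        qed
        obtain X' Y' where "msubset m X' b" "msubset m Y' b" "Sec T k X'" "Sec T (msucc m k) Y'" "G X' Y'"
          using T(2) k StepD unfolding Att_def by blast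
        then show ?thesis using StepI[OF momega_trans[OF k n]] old[OF \<open>k \<epsilon> msucc m n\<close>] old[OF s] by blast
      qed
      moreover have "Sec T' (mempty m) B0"
      proof (rule old)
        have "dfnU (\<lambda>e. mempty m \<epsilon> e 0 \<or> mempty m = e 0)" by (intro dfnU_base)
        from this n show "mempty m \<epsilon> msucc m n" unfolding mem_msucc by (rule momega_induct) auto
      qed (use T(2) B0 Att_def in auto)
      ultimately show "\<exists>T. inW T \<and> Att T (msucc m n)" using T'(1) unfolding Att_def by blast
    qed
  qed
  \<comment> \<open>Entry \<open>k\<close> of the full sequence is read off from any attempt of
    length \<open>k\<close>; by \<open>agree\<close> the choice does not matter.\<close>
  let ?M = "\<lambda>k y. \<exists>T. inW T \<and> Att T k \<and> qr_pair m k y \<epsilon> T"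
  have "dfn m inW AllW (\<lambda>e. ?M (e 0) (e 1))" by (intro P.dfn_base dfn_Att PQ.dfn_qr_pair_mem)
  then obtain T where T: "inW T" "\<And>k y. qr_pair m k y \<epsilon> T \<longleftrightarrow> k \<epsilon> momega m \<and> y \<epsilon> b \<and> ?M k y"
    using code_relation[where M = ?M, OF _ b] by blast
  have Att_below: "Att T' k" if "Att T' n" "k \<epsilon> msucc m n" "n \<epsilon> momega m" for T' k n
    using that nat_trans[of _ k n] unfolding Att_def mem_msucc by blast
  have sec: "Sec T k X" if "inW T'" "Att T' n" "n \<epsilon> momega m" "k \<epsilon> msucc m n" "Sec T' k X" "msubset m X b" for T' n k X
    unfolding Sec_def
  proof (intro allI impI)
    have k: "k \<epsilon> momega m" using momega_trans[OF that(4) msucc_momega[OF that(3)]] .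
    fix y assume y: "inW y"
    have "qr_pair m k y \<epsilon> T'' \<longleftrightarrow> y \<epsilon> X" if T'': "inW T''" "Att T'' k" for T''
    proof -
      obtain X' where X': "msubset m X' b" "Sec T' k X'" "Sec T'' k X'"
        using agree[OF \<open>inW T'\<close> T''(1) \<open>Att T' n\<close> T''(2) \<open>n \<epsilon> momega m\<close> k k \<open>k \<epsilon> msucc m n\<close>] by auto
      then have "X' = X" using Sec_unique sub \<open>Sec T' k X\<close> \<open>msubset m X b\<close> by blast
      then show ?thesis using X'(3) y unfolding Sec_def by blast
    qed
    then show "y \<epsilon> X \<longleftrightarrow> qr_pair m k y \<epsilon> T"
      using Att_below[OF that(2,4,3)] that(1,6) k unfolding T(2) msubset_def by blast
  qed
  have "\<exists>X Y. msubset m X b \<and> msubset m Y b \<and> Sec T k X \<and> Sec T (msucc m k) Y \<and> G X Y" if k: "k \<epsilon> momega m" for k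
  proof -
    obtain T' where T': "inW T'" "Att T' (msucc m k)" using att_ex[OF msucc_momega[OF k]] by blast
    then obtain X Y where "msubset m X b" "msubset m Y b" "Sec T' k X" "Sec T' (msucc m k) Y" "G X Y"
      using StepD[of T' k] unfolding Att_def by auto
    then show ?thesis using sec[OF T' msucc_momega[OF k]] by (metis mem_msucc)
  qed
  moreover have "Sec T (mempty m) B0"
  proof -
    obtain T' where T': "inW T'" "Att T' (mempty m)" using att_ex[OF mempty_momega] by blast
    then show ?thesis using sec[OF T' mempty_momega _ _ B0] unfolding Att_def by simp
  qed
  ultimately show ?thesis using T(1) by blast
qed

end

section \<open>The embeddings indexed by a section\<close>

context definable_embedding begin

text \<open>\<open>K a x\<close> is the relation \<open>k\<^sub>x\<close> of the introduction for the family coded by \<open>a\<close>.\<close>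

definition K :: "'v \<Rightarrow> 'v \<Rightarrow> 'v \<Rightarrow> 'v \<Rightarrow> bool" where
  "K a x u w \<longleftrightarrow> (\<exists>q. inW q \<and> Sec a x q \<and> Phi u w q)"

lemma dfn_K0: "dfn m inW FixW (\<lambda>e. K (e 0) (e 1) (e 2) (e 3))"
  unfolding K_def by (intro F.dfn_base dfn_Sec_F dfn_Phi)

lemmas dfn_K_F = F.dfn_lift4[where P = K, OF dfn_K0]
  and dfn_K = lift_All4[where P = K, OF dfn_K0]

section \<open>Critical levels and the preserved formulas\<close>

definition crit :: "'v \<Rightarrow> 'v \<Rightarrow> 'v \<Rightarrow> bool" where
  "crit a x \<mu> \<longleftrightarrow> \<mu> \<epsilon> L \<and> \<not> K a x \<mu> \<mu> \<and> (\<forall>\<nu>. \<nu> \<epsilon> \<mu> \<longrightarrow> \<nu> \<epsilon> L \<longrightarrow> K a x \<nu> \<nu>)"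

lemma dfn_crit0: "dfn m inW FixW (\<lambda>e. crit (e 0) (e 1) (e 2))"
  unfolding crit_def by (intro F.dfn_base dfn_K_F dfn_L_Fix)

lemmas dfn_crit_F = F.dfn_lift3[where P = crit, OF dfn_crit0]
  and dfn_crit = lift_All3[where P = crit, OF dfn_crit0]

definition mincrit :: "'v \<Rightarrow> 'v \<Rightarrow> 'v \<Rightarrow> bool" where
  "mincrit B a \<mu> \<longleftrightarrow> (\<exists>x. x \<epsilon> B \<and> crit a x \<mu>) \<and> (\<forall>\<nu>. \<nu> \<epsilon> \<mu> \<longrightarrow> \<not> (\<exists>x. x \<epsilon> B \<and> crit a x \<nu>))"

lemma dfn_mincrit0: "dfn m inW FixW (\<lambda>e. mincrit (e 0) (e 1) (e 2))"
  unfolding mincrit_def by (intro F.dfn_base dfn_crit_F)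

lemmas dfn_mincrit_F = F.dfn_lift3[where P = mincrit, OF dfn_mincrit0]

lemma mincrit_unique: "mincrit B a \<mu> \<Longrightarrow> mincrit B a \<mu>' \<Longrightarrow> \<mu> = \<mu>'"
  using L_linear[of \<mu> \<mu>'] unfolding mincrit_def crit_def by blast

lemma mincrit_ex:
  assumes "inW B" "inW a" "x \<epsilon> B" "crit a x \<kappa>'"
  shows "\<exists>\<mu>. \<mu> \<epsilon> L \<and> mincrit B a \<mu>"
proof -
  have "dfn m inW AllW (\<lambda>e. \<exists>x. x \<epsilon> B \<and> crit a x (e 0))"
    by (intro P.dfn_base dfn_crit) (simp_all add: assms)
  then have "\<exists>\<mu>. \<mu> \<epsilon> L \<and> (\<exists>x. x \<epsilon> B \<and> crit a x \<mu>) \<and> (\<forall>\<nu>. \<nu> \<epsilon> \<mu> \<longrightarrow> \<nu> \<epsilon> L \<longrightarrow> \<not> (\<exists>x. x \<epsilon> B \<and> crit a x \<nu>))"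
    by (rule least_level[where P = "\<lambda>\<mu>. \<exists>x. x \<epsilon> B \<and> crit a x \<mu>"]) (use assms crit_def in auto)
  then show ?thesis unfolding mincrit_def crit_def by blast
qed

definition Inter_seq :: "'v \<Rightarrow> 'v \<Rightarrow> bool" where
  "Inter_seq B T \<longleftrightarrow> (\<forall>y. inW y \<longrightarrow> (y \<epsilon> B \<longleftrightarrow> (\<forall>i. i \<epsilon> momega m \<longrightarrow> qr_pair m i y \<epsilon> T)))"

lemma dfn_Inter_seq0: "dfn m inW FixW (\<lambda>e. Inter_seq (e 0) (e 1))"
  unfolding Inter_seq_def by (intro F.dfn_base FQ.dfn_qr_pair_mem momega_Fix)

lemmas dfn_Inter_seq_F = F.dfn_lift2[where P = Inter_seq, OF dfn_Inter_seq0]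

text \<open>The preservation statements used for \<open>k\<^sub>x\<close>. As \<open>K a x\<close>
  is a relation, totality is included and the rest is stated for all choices of values. Being one
  predicate definable from fixed parameters, \<open>good\<close> is carried by \<open>j\<close> to
  the sections of \<open>j a\<close>, where at \<open>x0\<close> it becomes elementarity of
  \<open>j\<close>.\<close>

definition good :: "'v \<Rightarrow> 'v \<Rightarrow> bool" where
  "good a x \<longleftrightarrow> (\<forall>u. inW u \<longrightarrow> (\<exists>w. inW w \<and> K a x u w)) \<and>
    (\<forall>B. inW B \<longrightarrow> (\<forall>c. inW c \<longrightarrow> (\<forall>\<mu>. inW \<mu> \<longrightarrow> (\<forall>B'. inW B' \<longrightarrow> (\<forall>c'. inW c' \<longrightarrow> (\<forall>\<mu>'. inW \<mu>' \<longrightarrow>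
      K a x B B' \<longrightarrow> K a x c c' \<longrightarrow> K a x \<mu> \<mu>' \<longrightarrow> mincrit B c \<mu> \<longrightarrow> mincrit B' c' \<mu>')))))) \<and>
    (\<forall>T. inW T \<longrightarrow> (\<forall>X. inW X \<longrightarrow> (\<forall>T'. inW T' \<longrightarrow> (\<forall>X'. inW X' \<longrightarrow>
      K a x T T' \<longrightarrow> K a x X X' \<longrightarrow> (\<forall>i. i \<epsilon> momega m \<longrightarrow> Sec T i X \<longrightarrow> Sec T' i X'))))) \<and>
    (\<forall>B. inW B \<longrightarrow> (\<forall>T. inW T \<longrightarrow> (\<forall>B'. inW B' \<longrightarrow> (\<forall>T'. inW T' \<longrightarrow>
      K a x B B' \<longrightarrow> K a x T T' \<longrightarrow> Inter_seq B T \<longrightarrow> Inter_seq B' T'))))"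

lemma dfn_good0: "dfn m inW FixW (\<lambda>e. good (e 0) (e 1))"
  unfolding good_def
  by (intro F.dfn_base dfn_K_F dfn_mincrit_F dfn_Sec_F dfn_Inter_seq_F momega_Fix)

lemmas dfn_good_F = F.dfn_lift2[where P = good, OF dfn_good0]
  and dfn_good = lift_All2[where P = good, OF dfn_good0]

lemma goodD:
  assumes "good a x"
  shows "inW u \<Longrightarrow> \<exists>w. inW w \<and> K a x u w"
    and "inW B \<Longrightarrow> inW c \<Longrightarrow> inW \<mu> \<Longrightarrow> inW B' \<Longrightarrow> inW c' \<Longrightarrow> inW \<mu>' \<Longrightarrow>
      K a x B B' \<Longrightarrow> K a x c c' \<Longrightarrow> K a x \<mu> \<mu>' \<Longrightarrow> mincrit B c \<mu> \<Longrightarrow> mincrit B' c' \<mu>'"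
    and "inW T \<Longrightarrow> inW X \<Longrightarrow> inW T' \<Longrightarrow> inW X' \<Longrightarrow> K a x T T' \<Longrightarrow> K a x X X' \<Longrightarrow>
      i \<epsilon> momega m \<Longrightarrow> Sec T i X \<Longrightarrow> Sec T' i X'"
    and "inW B \<Longrightarrow> inW T \<Longrightarrow> inW B' \<Longrightarrow> inW T' \<Longrightarrow> K a x B B' \<Longrightarrow> K a x T T' \<Longrightarrow>
      Inter_seq B T \<Longrightarrow> Inter_seq B' T'"
  using assms unfolding good_def by (elim conjE, simp)+

lemma j_mincrit: "inW B \<Longrightarrow> inW c \<Longrightarrow> inW \<mu> \<Longrightarrow> mincrit B c \<mu> \<Longrightarrow> mincrit (j B) (j c) (j \<mu>)"
  using transfer3[where P = mincrit, OF dfn_mincrit0] by blast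

text \<open>The index stays in place because \<open>j\<close> fixes every natural number; so the
  entries of \<open>j T\<close> are the images of the entries of \<open>T\<close>.\<close>

lemma j_Sec: "inW T \<Longrightarrow> inW X \<Longrightarrow> i \<epsilon> momega m \<Longrightarrow> Sec T i X \<Longrightarrow> Sec (j T) i (j X)"
  using transfer3[where P = Sec, OF dfn_Sec0, of T i X] nat_fixed inW_trans[OF momega_inW] by simp

lemma j_Inter_seq: "inW B \<Longrightarrow> inW T \<Longrightarrow> Inter_seq B T \<Longrightarrow> Inter_seq (j B) (j T)"
  using transfer2[where P = Inter_seq, OF dfn_Inter_seq0] by blast

section \<open>The contradiction\<close>

theorem not_defined_from_section:
  assumes a: "inW a" and b: "inW b" and x0: "x0 \<epsilon> j b" and p: "p = qr_sec m (j a) x0"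
  shows False
proof -
  have x0W: "inW x0" using inW_trans[OF j_inW[OF b] x0] .
  have "Sec (j a) x0 p" unfolding Sec_def p using qr_sec(1)[OF j_inW[OF a]] by blast
  \<comment> \<open>\<open>p\<close> is the section of \<open>j a\<close> at \<open>x0\<close>, so
    in the family given by \<open>j a\<close> the relation at \<open>x0\<close> is \<open>j\<close>
    itself.\<close>
  then have K_j: "K (j a) x0 u w \<longleftrightarrow> j u = w" if "inW u" "inW w" for u w
    using j_defined[OF that] Sec_unique[OF _ p_inW] p_inW unfolding K_def Phi_def[symmetric] by blast
  then have "\<exists>w. inW w \<and> K (j a) x0 u w" if "inW u" for u
    using that j_inW by blast
  then have good0: "good (j a) x0"
    unfolding good_def using j_inW j_mincrit j_Sec j_Inter_seq by (auto simp: K_j)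
  have crit0: "crit (j a) x0 \<kappa>"
    unfolding crit_def using \<kappa>_L \<kappa>_moved below_\<kappa> \<kappa>_inW L_inW by (auto simp: K_j)

  have "dfn m inW AllW (\<lambda>e. good a (e 0) \<and> K a (e 0) a (j a))"
    by (intro P.dfn_base dfn_good dfn_K) (simp_all add: a j_inW)
  then have "\<exists>B. inW B \<and> (\<forall>x. x \<epsilon> B \<longleftrightarrow> x \<epsilon> b \<and> good a x \<and> K a x a (j a))"
    using b by (rule separation_W)
  then obtain B0 where B0W: "inW B0" and B0: "\<And>x. x \<epsilon> B0 \<longleftrightarrow> x \<epsilon> b \<and> good a x \<and> K a x a (j a)" by blast
  have B0b: "msubset m B0 b" by (simp add: msubset_def B0)
  have jB0: "x0 \<epsilon> j B0"
  proof -
    \<comment> \<open>A transferred formula must not mention \<open>j\<close>, whose parameter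
      \<open>p\<close> may be moved. So \<open>j a\<close> enters as a separate argument, sent to
      \<open>j (j a)\<close>, and the last condition on \<open>x0\<close> becomes
      \<open>j (j a) = j (j a)\<close>.\<close>
    let ?P = "\<lambda>B b a a'. \<forall>x. inW x \<longrightarrow> (x \<epsilon> B \<longleftrightarrow> x \<epsilon> b \<and> good a x \<and> K a x a a')"
    have "?P B0 b a (j a) \<longleftrightarrow> ?P (j B0) (j b) (j a) (j (j a))"
      by (rule transfer4[where P = ?P]) (intro F.dfn_base dfn_good_F dfn_K_F, simp_all add: a b B0W j_inW)
    then have "x0 \<epsilon> j B0 \<longleftrightarrow> x0 \<epsilon> j b \<and> good (j a) x0 \<and> K (j a) x0 (j a) (j (j a))"
      using B0 x0W by blast
    then show ?thesis using x0 good0 K_j a j_inW by blast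
  qed

  \<comment> \<open>Again \<open>X'\<close> stands for \<open>j X\<close>, to keep \<open>j\<close>
    out of the transferred formula. \<open>Y\<close> is the next set of the decreasing sequence
    after \<open>X\<close>.\<close>
  let ?St = "\<lambda>Y X X' a. \<forall>x. inW x \<longrightarrow> (x \<epsilon> Y \<longleftrightarrow> x \<epsilon> X \<and> K a x X X')"
  define G where "G X Y \<longleftrightarrow> (\<exists>X'. inW X' \<and> j X = X' \<and> ?St Y X X' a)" for X Y
  have dfn_G: "dfn m inW AllW (\<lambda>e. G (e 0) (e 1))"
    unfolding G_def by (intro P.dfn_base dfn_j dfn_K) (simp add: a)
  have step: "\<exists>Y. msubset m Y b \<and> G X Y" if X: "msubset m X b" for X
  proof -
    have XW: "inW X" using inW_swelled[OF b X] .
    have "dfn m inW AllW (\<lambda>e. K a (e 0) X (j X))"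
      by (intro dfn_K P.dfn_base) (simp_all add: a XW j_inW)
    then have "\<exists>Y. inW Y \<and> (\<forall>x. x \<epsilon> Y \<longleftrightarrow> x \<epsilon> X \<and> K a x X (j X))"
      using XW by (rule separation_W)
    then obtain Y where "inW Y" "\<And>x. x \<epsilon> Y \<longleftrightarrow> x \<epsilon> X \<and> K a x X (j X)" by blast
    then show ?thesis using X j_inW[OF XW] unfolding G_def msubset_def by blast
  qed
  have unique: "Y = Y'" if W: "inW Y" "inW Y'" and "G X Y" "G X Y'" for X Y Y'
  proof -
    have "x \<epsilon> Y \<longleftrightarrow> x \<epsilon> Y'" if "inW x" for x
      using \<open>G X Y\<close> \<open>G X Y'\<close> that unfolding G_def by auto
    then show ?thesis using inW_trans[OF W(1)] inW_trans[OF W(2)] by (intro ext) blast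
  qed
  have "\<exists>T. inW T \<and> Sec T (mempty m) B0 \<and>
    (\<forall>k. k \<epsilon> momega m \<longrightarrow> (\<exists>X Y. msubset m X b \<and> msubset m Y b \<and> Sec T k X \<and> Sec T (msucc m k) Y \<and> G X Y))"
    using dfn_G b B0b step unique by (rule sequence_ex)
  then obtain T where TW: "inW T" and T0: "Sec T (mempty m) B0" and
    T: "\<And>k. k \<epsilon> momega m \<Longrightarrow> \<exists>X Y. msubset m X b \<and> msubset m Y b \<and> Sec T k X \<and> Sec T (msucc m k) Y \<and> G X Y"
    by (elim exE conjE) simp

  have jX: "x0 \<epsilon> j X" if "i \<epsilon> momega m" "inW X" "Sec T i X" for i X
  proof -
    \<comment> \<open>\<open>j X\<close> is named by \<open>Z\<close>, because \<open>dfn_j\<close>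
      supplies \<open>j\<close> only as a relation between terms.\<close>
    let ?P = "\<lambda>i. \<forall>X. inW X \<longrightarrow> Sec T i X \<longrightarrow> (\<exists>Z. inW Z \<and> j X = Z \<and> x0 \<epsilon> Z)"
    have "dfn m inW AllW (\<lambda>e. ?P (e 0))"
      by (intro P.dfn_base dfn_Sec dfn_j) (simp_all add: TW x0W)
    from this that(1) have "?P i"
    proof (rule momega_induct_W[where P = ?P])
      show "?P (mempty m)" using Sec_unique[OF B0W _ T0] jB0 j_inW[OF B0W] by blast
      fix k assume k: "k \<epsilon> momega m" and IH: "?P k"
      obtain X Y where XY: "msubset m X b" "msubset m Y b" "Sec T k X" "Sec T (msucc m k) Y" "G X Y"
        using T[OF k] by blast
      have W: "inW X" "inW Y" using XY inW_swelled[OF b] by blast+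
      have "?St Y X (j X) a" using XY(5) unfolding G_def by blast
      moreover have "?St Y X (j X) a \<longleftrightarrow> ?St (j Y) (j X) (j (j X)) (j a)"
        by (rule transfer4[where P = ?St]) (intro F.dfn_base dfn_K_F, simp_all add: a W j_inW)
      ultimately have "x0 \<epsilon> j Y \<longleftrightarrow> x0 \<epsilon> j X \<and> K (j a) x0 (j X) (j (j X))" using x0W by blast
      moreover have "x0 \<epsilon> j X" using IH W(1) XY(3) by blast
      ultimately have "x0 \<epsilon> j Y" using K_j W j_inW by blast
      then show "?P (msucc m k)" using Sec_unique[OF W(2) _ XY(4)] j_inW[OF W(2)] by blast
    qed
    then show ?thesis using that(2,3) by blast
  qed

  have "dfn m inW AllW (\<lambda>e. \<forall>i. i \<epsilon> momega m \<longrightarrow> qr_pair m i (e 0) \<epsilon> T)"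
    by (intro P.dfn_base PQ.dfn_qr_pair_mem) (simp_all add: TW momega_inW)
  then have "\<exists>B. inW B \<and> (\<forall>y. y \<epsilon> B \<longleftrightarrow> y \<epsilon> B0 \<and> (\<forall>i. i \<epsilon> momega m \<longrightarrow> qr_pair m i y \<epsilon> T))"
    using B0W by (rule separation_W)
  then obtain B where BW: "inW B" and B: "\<And>y. y \<epsilon> B \<longleftrightarrow> y \<epsilon> B0 \<and> (\<forall>i. i \<epsilon> momega m \<longrightarrow> qr_pair m i y \<epsilon> T)" by blast
  have BT: "Inter_seq B T"
    unfolding Inter_seq_def B using T0[unfolded Sec_def] mempty_momega by blast
  \<comment> \<open>As \<omega> itself is fixed, no new indices appear: \<open>j B\<close> is the
    intersection of the entries of \<open>j T\<close> at the natural numbers.\<close>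
  have jBT: "Inter_seq (j B) (j T)" by (rule j_Inter_seq[OF BW TW BT])
  have x0B: "x0 \<epsilon> j B"
  proof -
    have "qr_pair m i x0 \<epsilon> j T" if i: "i \<epsilon> momega m" for i
    proof -
      obtain X where X: "msubset m X b" "Sec T i X" using T[OF i] by blast
      have XW: "inW X" using inW_swelled[OF b X(1)] .
      show ?thesis using jX[OF i XW X(2)] j_Sec[OF TW XW i X(2)] x0W unfolding Sec_def by blast
    qed
    then show ?thesis using jBT x0W unfolding Inter_seq_def by blast
  qed
  \<comment> \<open>The values of \<open>k\<^sub>x\<close> and \<open>j\<close> at \<open>T\<close>
    have the same entries at all natural numbers, and both maps preserve the intersection.\<close>
  have KB: "K a x B (j B)" if x: "x \<epsilon> B" for x
  proof -
    have xW: "inW x" using inW_trans[OF BW x] .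
    have g: "good a x" using x unfolding B B0 by blast
    obtain T' where T': "inW T'" "K a x T T'" using goodD(1)[OF g TW] by blast
    obtain B' where B': "inW B'" "K a x B B'" using goodD(1)[OF g BW] by blast
    have BT': "Inter_seq B' T'" by (rule goodD(4)[OF g BW TW B'(1) T'(1) B'(2) T'(2) BT])
    have "qr_pair m i y \<epsilon> T' \<longleftrightarrow> qr_pair m i y \<epsilon> j T" if i: "i \<epsilon> momega m" and y: "inW y" for i y
    proof -
      obtain X Y where XY: "msubset m X b" "msubset m Y b" "Sec T i X" "Sec T (msucc m i) Y" "G X Y"
        using T[OF i] by blast
      have XW: "inW X" using inW_swelled[OF b XY(1)] .
      \<comment> \<open>Membership is used one step ahead: lying in entry \<open>i + 1\<close> means
        that \<open>k\<^sub>x\<close> and \<open>j\<close> agree on entry \<open>i\<close>.\<close>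
      have "x \<epsilon> Y" using x XY(4) xW msucc_momega[OF i] unfolding B Sec_def by blast
      then have "K a x X (j X)" using XY(5) xW unfolding G_def by blast
      then have "Sec T' i (j X)" by (rule goodD(3)[OF g TW XW T'(1) j_inW[OF XW] T'(2) _ i XY(3)])
      then show ?thesis using j_Sec[OF TW XW i XY(3)] y unfolding Sec_def by blast
    qed
    then have "B' = j B"
      using BT' jBT inW_trans[OF B'(1)] inW_trans[OF j_inW[OF BW]] unfolding Inter_seq_def by (intro ext) metis
    then show ?thesis using B'(2) by simp
  qed

  \<comment> \<open>A least critical level is first found for \<open>j B\<close> and
    \<open>j a\<close>, where \<open>x0\<close> and \<open>\<kappa>\<close> are witnesses, and then
    pulled back by elementarity.\<close>
  have "\<exists>\<mu>. inW \<mu> \<and> mincrit (j B) (j a) \<mu>"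
    using mincrit_ex[OF j_inW[OF BW] j_inW[OF a] x0B crit0] L_inW by blast
  moreover have "(\<exists>\<mu>. inW \<mu> \<and> mincrit B a \<mu>) \<longleftrightarrow> (\<exists>\<mu>. inW \<mu> \<and> mincrit (j B) (j a) \<mu>)"
    by (rule transfer2[where P = "\<lambda>B a. \<exists>\<mu>. inW \<mu> \<and> mincrit B a \<mu>"])
      (intro F.dfn_base dfn_mincrit_F, rule BW, rule a)
  ultimately obtain \<mu> where \<mu>: "inW \<mu>" "mincrit B a \<mu>" by blast
  then obtain x where x: "x \<epsilon> B" "crit a x \<mu>" unfolding mincrit_def by blast
  have \<mu>L: "\<mu> \<epsilon> L" using x(2) unfolding crit_def by blast
  have g: "good a x" "K a x a (j a)" using x(1) unfolding B B0 by blast+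
  obtain w where w: "inW w" "K a x \<mu> w" using goodD(1)[OF g(1) \<mu>(1)] by blast
  have j\<mu>: "mincrit (j B) (j a) (j \<mu>)" by (rule j_mincrit[OF BW a \<mu>])
  \<comment> \<open>\<open>k\<^sub>x\<close> sends \<open>B\<close> and \<open>a\<close> to the same
    sets as \<open>j\<close>, so its value at \<open>\<mu>\<close> is the least critical level of
    the same family.\<close>
  have "mincrit (j B) (j a) w"
    by (rule goodD(2)[OF g(1) BW a \<mu>(1) j_inW[OF BW] j_inW[OF a] w(1) KB[OF x(1)] g(2) w(2) \<mu>(2)])
  then have "w = j \<mu>" using mincrit_unique j\<mu> by blast
  then have "j \<mu> \<noteq> \<mu>" using w(2) x(2) unfolding crit_def by auto
  then have "\<mu> = \<kappa> \<or> \<kappa> \<epsilon> \<mu>" using below_\<kappa>[OF _ \<mu>L] L_linear[OF \<mu>L \<kappa>_L] by blast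
  then have "\<kappa> \<epsilon> j \<mu>"
    using \<kappa>_mem_j j_mem[OF \<kappa>_inW \<mu>(1)] j_L[OF \<mu>(1)] \<mu>L L_trans[of \<kappa> "j \<kappa>" "j \<mu>"] by blast
  \<comment> \<open>\<open>\<kappa>\<close> is the critical level at the index \<open>x0\<close> in
    \<open>j B\<close>, yet lies below the supposed minimum \<open>j \<mu>\<close>.\<close>
  then show False using j\<mu> x0B crit0 unfolding mincrit_def by blast
qed

end

theorem theorem3p11:
  fixes m :: "'v \<Rightarrow> 'v \<Rightarrow> bool" and \<alpha> a b p :: 'v and j :: "'v \<Rightarrow> 'v"
  assumes "zf_model m"
    and "mordinal m \<alpha>"
    and "fully_elementary m (mV m \<alpha>) j"
    and "\<exists>x. m x (mV m \<alpha>) \<and> j x \<noteq> x"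
    and "m a (mV m \<alpha>)" and "m b (mV m \<alpha>)"
    and "m p (qr_fam m (j a) (j b))"
  shows "\<not> definable_from m (mV m \<alpha>) j p"
proof
  assume "definable_from m (mV m \<alpha>) j p"
  then obtain \<phi> where \<phi>: "\<And>u w. m u (mV m \<alpha>) \<Longrightarrow> m w (mV m \<alpha>) \<Longrightarrow>
      j u = w \<longleftrightarrow> sat m (\<lambda>x. m x (mV m \<alpha>)) \<phi> ((\<lambda>_. p)(0 := u, 1 := w))"
    unfolding definable_from_def by blast
  interpret zf m by unfold_locales (rule assms(1))
  from mV_levels[OF assms(2)] obtain L
    where L: "\<forall>z x. m z L \<longrightarrow> (m x z \<longleftrightarrow> (\<exists>y. m y L \<and> m y z \<and> msubset m x y))"
      "\<forall>x. m x (mV m \<alpha>) \<longleftrightarrow> (\<exists>y. m y L \<and> msubset m x y)"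
    by (elim exE conjE) (rule that)
  interpret hierarchy m "mV m \<alpha>" L
    by unfold_locales (rule L(1)[rule_format], assumption, rule L(2)[rule_format])
  have inW: "inW = (\<lambda>x. m x (mV m \<alpha>))" by (auto simp: inW_def)
  have jW: "\<And>x. inW x \<Longrightarrow> inW (j x)"
    and el: "\<And>\<psi> e. (\<And>i. inW (e i)) \<Longrightarrow> sat m inW \<psi> e \<longleftrightarrow> sat m inW \<psi> (j \<circ> e)"
    using assms(3) unfolding fully_elementary_def inW by simp_all
  have ja: "inW (j a)" using jW assms(5) by (simp add: inW)
  obtain x0 where x0: "m x0 (j b)" "p = qr_sec m (j a) x0" using assms(7) mem_qr_fam[OF ja] by blast
  have pW: "inW p" using qr_sec(2)[OF ja] x0(2) by simp
  have def_j: "\<And>u w. inW u \<Longrightarrow> inW w \<Longrightarrow> j u = w \<longleftrightarrow> sat m inW \<phi> ((\<lambda>_. p)(0 := u, 1 := w))"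
    unfolding inW by (rule \<phi>)
  have nt: "\<exists>x. inW x \<and> j x \<noteq> x" unfolding inW by (rule assms(4))
  interpret definable_embedding m "mV m \<alpha>" L j \<phi> p
    by unfold_locales (fact jW el pW def_j nt)+
  have "inW a" "inW b" unfolding inW by (rule assms(5), rule assms(6))
  then show False using x0 by (rule not_defined_from_section)
qed

end
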